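(* There is a universal constant $c>0$ such that for all $n\ge1$ and $0<\epsilon\le1/3$ the following holds. Consider a protocol with $N$ channel uses belonging to either (a) the input-restricted coherent adaptive model, in which every fresh input state $\rho_{\ell}^{\mathbf o_{<\ell}}$ on $S_\ell A_\ell$ satisfies the reduction criterion; or (b) the measurement-restricted coherent adaptive model, in which every POVM $\{E_{o_\ell}^{\mathbf o_{<\ell}}\}_{o_\ell}$ on $S_\ell A_\ell$ satisfies the reduction-criterion restriction. If the protocol solves Pauli channel learning for $n$-qubit Pauli channels (accuracy $\epsilon$, success probability at least $2/3$), then $$N\ \ge\ c\,\epsilon^{-1}2^{n/2},$$ i.e. $N=\Omega(\epsilon^{-1}2^{n/2})$.
   Context: All quantum systems are finite-dimensional and POVMs/instruments have finitely many outcomes; $X\le Y$ means $Y-X$ is positive semidefinite. Pauli channels: let $\mathcal P_n=\{I,X,Y,Z\}^{\otimes n}$. An $n$-qubit Pauli channel is a map $\Lambda(\rho)=\sum_{P\in\mathcal P_n}p_P\,P\rho P$ with $\{p_P\}$ a probability distribution; $\Lambda(P)=\lambda_P P$ defines the Pauli eigenvalues $\lambda_P$. Pauli channel learning: given $N$ uses of an unknown $n$-qubit Pauli channel $\Lambda$, the learner outputs estimates $\{\hat\lambda_P\}_{P\in\mathcal P_n}$ such that, for every $\Lambda$, $\max_{P}|\hat\lambda_P-\lambda_P|\le\epsilon$ with probability at least $2/3$. Notation: for each round $\ell=1,\dots,N$, $S_\ell$ is an $n$-qubit register on which $\Lambda$ acts in that round and $A_\ell$ is an associated ancilla of arbitrary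 dimension; $\mathbf o_{<\ell}=(o_1,\dots,o_{\ell-1})$ and $\mathbf o_{\le\ell}=(o_1,\dots,o_\ell)$. In both models the estimates are computed from the full outcome record $\mathbf o_{\le N}$. Input-restricted coherent adaptive model: there are quantum memories $W_0,\dots,W_N$ of arbitrary dimension, with $W_0$ and $W_N$ one-dimensional. In round $\ell$, conditioned on $\mathbf o_{<\ell}$, the learner prepares a fresh state $\rho_\ell^{\mathbf o_{<\ell}}$ on $S_\ell A_\ell$, in a product state with the retained memory $W_{\ell-1}$ (uncorrelated conditioned on $\mathbf o_{<\ell}$). After $\Lambda$ acts on $S_\ell$, the learner applies an arbitrary quantum instrument $\{\mathcal J_{\mathbf o_{<\ell},o_\ell}\}_{o_\ell}$ (completely positive trace-nonincreasing maps from operators on $W_{\ell-1}S_\ell A_\ell$ to operators on $W_\ell$ whose sum over $o_\ell$ is trace preserving), which may depend on $\mathbf o_{<\ell}$, producing the outcome $o_\ell$ and the new memory $W_\ell$. Measurement-restricted coherent adaptive model: the learner starts with an arbitrary state on $S_1A_1\cdots S_NA_N$ (possibly entangled across rounds). In round $\ell$, $\Lambda$ acts on $S_\ell$; then, conditioned on $\mathbf o_{<\ell}$, a POVM $\{E_{o_\ell}^{\mathbf o_{<\ell}}\}_{o_\ell}$ acting only on $S_\ell A_\ell$ is measured, giving outcome $o_\ell$ (and $S_\ell A_\ell$ is discarded); then a CPTP map depending on $\mathbf o_{\le\ell}$ is applied to the remaining registers $C_\ell=S_{\ell+1}A_{\ell+1}\cdots S_NA_N$. Reduction criterion for a state $\rho_{SA}$: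 $\rho_{SA}\le I_S\otimes\rho_A$ with $\rho_A=\mathrm{Tr}_S\,\rho_{SA}$. Reduction-criterion restriction for a POVM $\{E_o\}$ on $SA$: for every outcome with $\mathrm{Tr}\,E_o>0$, $\dfrac{E_o}{\mathrm{Tr}\,E_o}\le I_S\otimes\sigma_A^o$ with $\sigma_A^o=\dfrac{\mathrm{Tr}_S E_o}{\mathrm{Tr}\,E_o}$. *)

theory Defs
  imports "Jordan_Normal_Form.Matrix" Complex_Main
begin

text \<open>Operators on a system of dimension \<open>d\<close> are complex \<open>d \<times> d\<close> matrices.  A composite
  system of dimensions \<open>d\<^sub>1, d\<^sub>2\<close> has dimension \<open>d\<^sub>1 * d\<^sub>2\<close>, and the basis vector
  \<open>|i\<rangle> \<otimes> |j\<rangle>\<close> has index \<open>i * d\<^sub>2 + j\<close>.\<close>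

text \<open>In the order on complex numbers, \<open>0 \<le> z\<close> means that \<open>z\<close> is real and nonnegative; so
  positive semidefinite matrices are in particular Hermitian.\<close>

definition psd :: "nat \<Rightarrow> complex mat \<Rightarrow> bool" where
  "psd d A \<longleftrightarrow> A \<in> carrier_mat d d \<and> (\<forall>v \<in> carrier_vec d. 0 \<le> (A *\<^sub>v v) \<bullet>c v)"

definition loewner_le :: "nat \<Rightarrow> complex mat \<Rightarrow> complex mat \<Rightarrow> bool" where
  "loewner_le d X Y \<longleftrightarrow> X \<in> carrier_mat d d \<and> Y \<in> carrier_mat d d \<and> psd d (Y - X)"

definition mtrace :: "complex mat \<Rightarrow> complex" where
  "mtrace A = (\<Sum>i<dim_row A. A $$ (i, i))"

definition density :: "nat \<Rightarrow> complex mat \<Rightarrow> bool" where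
  "density d \<rho> \<longleftrightarrow> psd d \<rho> \<and> mtrace \<rho> = 1"

definition msum :: "nat \<Rightarrow> 'i set \<Rightarrow> ('i \<Rightarrow> complex mat) \<Rightarrow> complex mat" where
  "msum d S f = mat d d (\<lambda>ij. \<Sum>x\<in>S. f x $$ ij)"

definition kron :: "complex mat \<Rightarrow> complex mat \<Rightarrow> complex mat" where
  "kron A B = mat (dim_row A * dim_row B) (dim_col A * dim_col B)
     (\<lambda>(i, j). A $$ (i div dim_row B, j div dim_col B) * B $$ (i mod dim_row B, j mod dim_col B))"

text \<open>Partial trace over the first factor (of dimension \<open>d\<^sub>1\<close>).\<close>

definition ptrace_left :: "nat \<Rightarrow> nat \<Rightarrow> complex mat \<Rightarrow> complex mat" where
  "ptrace_left d1 d2 X = mat d2 d2 (\<lambda>(i, j). \<Sum>s<d1. X $$ (s * d2 + i, s * d2 + j))"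

text \<open>The map \<open>id\<^sub>l \<otimes> \<Phi> \<otimes> id\<^sub>r\<close>, for \<open>\<Phi>\<close> linear from \<open>d \<times> d\<close> to \<open>e \<times> e\<close> matrices: \<open>\<Phi>\<close> is
  applied to each \<open>d \<times> d\<close> block obtained by fixing the basis indices of the outer factors.\<close>

definition local_map ::
  "nat \<Rightarrow> nat \<Rightarrow> nat \<Rightarrow> nat \<Rightarrow> (complex mat \<Rightarrow> complex mat) \<Rightarrow> complex mat \<Rightarrow> complex mat" where
  "local_map l r d e \<Phi> X = mat (l * e * r) (l * e * r) (\<lambda>(i, j).
     \<Phi> (mat d d (\<lambda>(s, t). X $$ ((i div (e * r) * d + s) * r + i mod r,
                                (j div (e * r) * d + t) * r + j mod r)))
       $$ (i div r mod e, j div r mod e))"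

definition linear_map :: "nat \<Rightarrow> nat \<Rightarrow> (complex mat \<Rightarrow> complex mat) \<Rightarrow> bool" where
  "linear_map d e \<Phi> \<longleftrightarrow>
     (\<forall>X \<in> carrier_mat d d. \<Phi> X \<in> carrier_mat e e) \<and>
     (\<forall>X \<in> carrier_mat d d. \<forall>Y \<in> carrier_mat d d. \<Phi> (X + Y) = \<Phi> X + \<Phi> Y) \<and>
     (\<forall>c. \<forall>X \<in> carrier_mat d d. \<Phi> (c \<cdot>\<^sub>m X) = c \<cdot>\<^sub>m \<Phi> X)"

definition completely_positive :: "nat \<Rightarrow> nat \<Rightarrow> (complex mat \<Rightarrow> complex mat) \<Rightarrow> bool" where
  "completely_positive d e \<Phi> \<longleftrightarrow> linear_map d e \<Phi> \<and>
     (\<forall>k X. psd (k * d) X \<longrightarrow> psd (k * e) (local_map k 1 d e \<Phi> X))"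

definition trace_nonincreasing :: "nat \<Rightarrow> (complex mat \<Rightarrow> complex mat) \<Rightarrow> bool" where
  "trace_nonincreasing d \<Phi> \<longleftrightarrow> (\<forall>X. psd d X \<longrightarrow> mtrace (\<Phi> X) \<le> mtrace X)"

definition trace_preserving :: "nat \<Rightarrow> (complex mat \<Rightarrow> complex mat) \<Rightarrow> bool" where
  "trace_preserving d \<Phi> \<longleftrightarrow> (\<forall>X \<in> carrier_mat d d. mtrace (\<Phi> X) = mtrace X)"

definition cptp :: "nat \<Rightarrow> nat \<Rightarrow> (complex mat \<Rightarrow> complex mat) \<Rightarrow> bool" where
  "cptp d e \<Phi> \<longleftrightarrow> completely_positive d e \<Phi> \<and> trace_preserving d \<Phi>"

definition instrument :: "nat \<Rightarrow> nat \<Rightarrow> 'o set \<Rightarrow> ('o \<Rightarrow> complex mat \<Rightarrow> complex mat) \<Rightarrow> bool" where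
  "instrument d e S J \<longleftrightarrow> finite S \<and>
     (\<forall>x\<in>S. completely_positive d e (J x) \<and> trace_nonincreasing d (J x)) \<and>
     trace_preserving d (\<lambda>X. msum e S (\<lambda>x. J x X))"

definition povm :: "nat \<Rightarrow> 'o set \<Rightarrow> ('o \<Rightarrow> complex mat) \<Rightarrow> bool" where
  "povm d S E \<longleftrightarrow> finite S \<and> (\<forall>x\<in>S. psd d (E x)) \<and> msum d S E = 1\<^sub>m d"

text \<open>The factors \<open>S\<close> and \<open>A\<close> have dimensions \<open>dS\<close> and \<open>dA\<close>.\<close>

definition reduction_criterion :: "nat \<Rightarrow> nat \<Rightarrow> complex mat \<Rightarrow> bool" where
  "reduction_criterion dS dA \<rho> \<longleftrightarrow>
     loewner_le (dS * dA) \<rho> (kron (1\<^sub>m dS) (ptrace_left dS dA \<rho>))"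

definition povm_reduction_restriction ::
  "nat \<Rightarrow> nat \<Rightarrow> 'o set \<Rightarrow> ('o \<Rightarrow> complex mat) \<Rightarrow> bool" where
  "povm_reduction_restriction dS dA S E \<longleftrightarrow>
     (\<forall>x\<in>S. mtrace (E x) > 0 \<longrightarrow>
        loewner_le (dS * dA) ((1 / mtrace (E x)) \<cdot>\<^sub>m E x)
          (kron (1\<^sub>m dS) ((1 / mtrace (E x)) \<cdot>\<^sub>m ptrace_left dS dA (E x))))"


section \<open>Pauli channels\<close>

datatype pauli = PauliI | PauliX | PauliY | PauliZ

fun pauli_mat :: "pauli \<Rightarrow> complex mat" where
  "pauli_mat PauliI = mat_of_rows_list 2 [[1, 0], [0, 1]]"
| "pauli_mat PauliX = mat_of_rows_list 2 [[0, 1], [1, 0]]"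
| "pauli_mat PauliY = mat_of_rows_list 2 [[0, - \<i>], [\<i>, 0]]"
| "pauli_mat PauliZ = mat_of_rows_list 2 [[1, 0], [0, - 1]]"

definition pauli_strings :: "nat \<Rightarrow> pauli list set" where
  "pauli_strings n = {P. length P = n}"

definition pauli_op :: "pauli list \<Rightarrow> complex mat" where
  "pauli_op P = foldr (\<lambda>a B. kron (pauli_mat a) B) P (1\<^sub>m 1)"

definition pauli_distribution :: "nat \<Rightarrow> (pauli list \<Rightarrow> real) \<Rightarrow> bool" where
  "pauli_distribution n p \<longleftrightarrow>
     (\<forall>P \<in> pauli_strings n. 0 \<le> p P) \<and> (\<Sum>P \<in> pauli_strings n. p P) = 1"

definition pauli_channel :: "nat \<Rightarrow> (pauli list \<Rightarrow> real) \<Rightarrow> complex mat \<Rightarrow> complex mat" where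
  "pauli_channel n p \<rho> = msum (2 ^ n) (pauli_strings n)
     (\<lambda>P. complex_of_real (p P) \<cdot>\<^sub>m (pauli_op P * \<rho> * pauli_op P))"

definition pauli_eigenvalue :: "nat \<Rightarrow> (pauli list \<Rightarrow> real) \<Rightarrow> pauli list \<Rightarrow> real" where
  "pauli_eigenvalue n p P =
     (THE l. pauli_channel n p (pauli_op P) = complex_of_real l \<cdot>\<^sub>m pauli_op P)"


section \<open>Outcome records and the learning task\<close>

text \<open>An outcome record is the list of outcomes in chronological order.  After the record \<open>h\<close>
  the next outcome is one of \<open>0, \<dots>, nout h - 1\<close>.  Rounds are counted from \<open>0\<close>, so round \<open>k\<close> is
  conditioned on a record of length \<open>k\<close>.\<close>

definition records :: "(nat list \<Rightarrow> nat) \<Rightarrow> nat \<Rightarrow> nat list set" where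
  "records nout k = {h. length h = k \<and> (\<forall>i<k. h ! i < nout (take i h))}"

text \<open>\<open>prob p h\<close> is the probability of the record \<open>h\<close> when the unknown channel is
  \<open>pauli_channel n p\<close>, and \<open>est h P\<close> is the estimate of \<open>pauli_eigenvalue n p P\<close>.\<close>

definition solves_pauli_learning ::
  "nat \<Rightarrow> real \<Rightarrow> nat list set \<Rightarrow> ((pauli list \<Rightarrow> real) \<Rightarrow> nat list \<Rightarrow> real) \<Rightarrow>
     (nat list \<Rightarrow> pauli list \<Rightarrow> real) \<Rightarrow> bool" where
  "solves_pauli_learning n \<epsilon> R prob est \<longleftrightarrow>
     (\<forall>p. pauli_distribution n p \<longrightarrow>
        (\<Sum>h \<in> {h \<in> R. (MAX P \<in> pauli_strings n. \<bar>est h P - pauli_eigenvalue n p P\<bar>) \<le> \<epsilon>}.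
           prob p h) \<ge> 2 / 3)"


section \<open>Input-restricted coherent adaptive model\<close>

text \<open>\<open>in_memdim k\<close> is the dimension of \<open>W\<^sub>k\<close>, and \<open>in_ancdim k\<close> that of the ancilla of round \<open>k\<close>.
  \<open>in_input h\<close> is the fresh state and \<open>in_instr h\<close> the instrument of round \<open>length h\<close>.\<close>

record input_protocol =
  in_ancdim :: "nat \<Rightarrow> nat"
  in_memdim :: "nat \<Rightarrow> nat"
  in_nout :: "nat list \<Rightarrow> nat"
  in_input :: "nat list \<Rightarrow> complex mat"
  in_instr :: "nat list \<Rightarrow> nat \<Rightarrow> complex mat \<Rightarrow> complex mat"
  in_est :: "nat list \<Rightarrow> pauli list \<Rightarrow> real"

definition valid_input_protocol :: "nat \<Rightarrow> nat \<Rightarrow> input_protocol \<Rightarrow> bool" where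
  "valid_input_protocol n N T \<longleftrightarrow>
     (\<forall>k<N. 0 < in_ancdim T k) \<and> (\<forall>k\<le>N. 0 < in_memdim T k) \<and>
     in_memdim T 0 = 1 \<and> in_memdim T N = 1 \<and>
     (\<forall>k<N. \<forall>h \<in> records (in_nout T) k.
        density (2 ^ n * in_ancdim T k) (in_input T h) \<and>
        instrument (in_memdim T k * (2 ^ n * in_ancdim T k)) (in_memdim T (Suc k))
          {..<in_nout T h} (in_instr T h))"

definition input_reduction_restricted :: "nat \<Rightarrow> nat \<Rightarrow> input_protocol \<Rightarrow> bool" where
  "input_reduction_restricted n N T \<longleftrightarrow>
     (\<forall>k<N. \<forall>h \<in> records (in_nout T) k.
        reduction_criterion (2 ^ n) (in_ancdim T k) (in_input T h))"

text \<open>Unnormalised memory state on \<open>W\<^sub>k\<close> after the first \<open>k\<close> outcomes of \<open>h\<close>; its trace is the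
  probability of these outcomes.\<close>

primrec input_memory ::
  "nat \<Rightarrow> input_protocol \<Rightarrow> (pauli list \<Rightarrow> real) \<Rightarrow> nat list \<Rightarrow> nat \<Rightarrow> complex mat" where
  "input_memory n T p h 0 = 1\<^sub>m 1"
| "input_memory n T p h (Suc k) =
     in_instr T (take k h) (h ! k)
       (local_map (in_memdim T k) (in_ancdim T k) (2 ^ n) (2 ^ n) (pauli_channel n p)
         (kron (input_memory n T p h k) (in_input T (take k h))))"

definition input_prob ::
  "nat \<Rightarrow> nat \<Rightarrow> input_protocol \<Rightarrow> (pauli list \<Rightarrow> real) \<Rightarrow> nat list \<Rightarrow> real" where
  "input_prob n N T p h = Re (mtrace (input_memory n T p h N))"

definition input_protocol_solves :: "nat \<Rightarrow> nat \<Rightarrow> real \<Rightarrow> input_protocol \<Rightarrow> bool" where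
  "input_protocol_solves n N \<epsilon> T \<longleftrightarrow>
     solves_pauli_learning n \<epsilon> (records (in_nout T) N) (input_prob n N T) (in_est T)"


section \<open>Measurement-restricted coherent adaptive model\<close>

text \<open>\<open>ms_povm h\<close> is the POVM of round \<open>length h\<close>; \<open>ms_chan h\<close>, for nonempty \<open>h\<close>, is the channel
  applied to the remaining registers right after the last outcome of \<open>h\<close>.\<close>

record meas_protocol =
  ms_ancdim :: "nat \<Rightarrow> nat"
  ms_init :: "complex mat"
  ms_nout :: "nat list \<Rightarrow> nat"
  ms_povm :: "nat list \<Rightarrow> nat \<Rightarrow> complex mat"
  ms_chan :: "nat list \<Rightarrow> complex mat \<Rightarrow> complex mat"
  ms_est :: "nat list \<Rightarrow> pauli list \<Rightarrow> real"

text \<open>Joint dimension of the registers \<open>S, A\<close> of the rounds \<open>k, \<dots>, N - 1\<close>.\<close>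

definition rest_dim :: "nat \<Rightarrow> nat \<Rightarrow> meas_protocol \<Rightarrow> nat \<Rightarrow> nat" where
  "rest_dim n N T k = (\<Prod>j\<in>{k..<N}. 2 ^ n * ms_ancdim T j)"

definition valid_meas_protocol :: "nat \<Rightarrow> nat \<Rightarrow> meas_protocol \<Rightarrow> bool" where
  "valid_meas_protocol n N T \<longleftrightarrow>
     (\<forall>k<N. 0 < ms_ancdim T k) \<and>
     density (rest_dim n N T 0) (ms_init T) \<and>
     (\<forall>k<N. \<forall>h \<in> records (ms_nout T) k.
        povm (2 ^ n * ms_ancdim T k) {..<ms_nout T h} (ms_povm T h) \<and>
        (\<forall>x<ms_nout T h.
           cptp (rest_dim n N T (Suc k)) (rest_dim n N T (Suc k)) (ms_chan T (h @ [x]))))"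

definition meas_reduction_restricted :: "nat \<Rightarrow> nat \<Rightarrow> meas_protocol \<Rightarrow> bool" where
  "meas_reduction_restricted n N T \<longleftrightarrow>
     (\<forall>k<N. \<forall>h \<in> records (ms_nout T) k.
        povm_reduction_restriction (2 ^ n) (ms_ancdim T k) {..<ms_nout T h} (ms_povm T h))"

text \<open>Unnormalised state of the registers of the rounds \<open>k, \<dots>, N - 1\<close> after the first \<open>k\<close>
  outcomes of \<open>h\<close>.  Outcome \<open>x\<close> of a POVM \<open>E\<close> on \<open>SA\<close>, with \<open>SA\<close> then discarded, leaves
  \<open>Tr\<^sub>S\<^sub>A ((E\<^sub>x \<otimes> I) \<tau>)\<close> on the other registers.\<close>

primrec meas_state ::
  "nat \<Rightarrow> nat \<Rightarrow> meas_protocol \<Rightarrow> (pauli list \<Rightarrow> real) \<Rightarrow> nat list \<Rightarrow> nat \<Rightarrow> complex mat" where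
  "meas_state n N T p h 0 = ms_init T"
| "meas_state n N T p h (Suc k) =
     ms_chan T (take (Suc k) h)
       (ptrace_left (2 ^ n * ms_ancdim T k) (rest_dim n N T (Suc k))
         (kron (ms_povm T (take k h) (h ! k)) (1\<^sub>m (rest_dim n N T (Suc k))) *
          local_map 1 (ms_ancdim T k * rest_dim n N T (Suc k)) (2 ^ n) (2 ^ n)
            (pauli_channel n p) (meas_state n N T p h k)))"

definition meas_prob ::
  "nat \<Rightarrow> nat \<Rightarrow> meas_protocol \<Rightarrow> (pauli list \<Rightarrow> real) \<Rightarrow> nat list \<Rightarrow> real" where
  "meas_prob n N T p h = Re (mtrace (meas_state n N T p h N))"

definition meas_protocol_solves :: "nat \<Rightarrow> nat \<Rightarrow> real \<Rightarrow> meas_protocol \<Rightarrow> bool" where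
  "meas_protocol_solves n N \<epsilon> T \<longleftrightarrow>
     solves_pauli_learning n \<epsilon> (records (ms_nout T) N) (meas_prob n N T) (ms_est T)"

end

theory Submission
  imports "Jordan_Normal_Form.Schur_Decomposition" Defs
begin

text \<open>Compare the uniform Pauli channel with the channels whose eigenvalue is \<open>3 \<epsilon>\<close> at one
  string \<open>P\<close> and \<open>0\<close> at the other nonidentity strings.  A learner tells them apart with advantage
  \<open>1 / 3\<close>, for every \<open>P\<close>.  Exchange the channel uses one at a time, the uniform channel first:
  the disturbed round then starts from a state that does not depend on \<open>P\<close>, and the disturbance
  is governed by \<open>(3 \<epsilon> / 2\<^sup>n) P \<otimes> R\<^sub>P\<close> with \<open>R\<^sub>P = Tr\<^sub>S ((P \<otimes> 1) X)\<close>, where \<open>X\<close> is the fresh input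
  state or the POVM element.  By AM-GM, \<open>P \<otimes> R\<^sub>P \<le> 1 \<otimes> K\<^sub>P\<close> with
  \<open>K\<^sub>P = (t S + R\<^sub>P S' R\<^sub>P / t) / 2\<close>, where \<open>S = Tr\<^sub>S X\<close> and \<open>S'\<close> is its inverse (a multiple of the
  identity is added to \<open>S\<close> first, at the cost of a factor \<open>2\<close>).  Orthogonality of the Pauli
  matrices and the reduction criterion \<open>X \<le> 1 \<otimes> S\<close> give
  \<open>\<Sum>\<^sub>P R\<^sub>P S' R\<^sub>P = 2\<^sup>n Tr\<^sub>S (X (1 \<otimes> S') X) \<le> 2\<^sup>n Tr\<^sub>S X\<close>, so for \<open>t = 2\<^sup>-\<^sup>n\<^sup>/\<^sup>2\<close> the average of \<open>K\<^sub>P\<close>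
  over the \<open>4\<^sup>n\<close> strings is at most \<open>2\<^sup>-\<^sup>n\<^sup>/\<^sup>2 S\<close>.\<close>

section \<open>Kronecker products, partial traces and positivity\<close>

text \<open>Everything after the exchanged round is an arbitrary adaptive strategy, so the
  disturbance has to be measured in a way that no strategy can amplify. Operator domination does
  this: if a positive Z lies above the difference of the two states left by the round, every later
  strategy raises the probability of an event by at most Tr Z. A one-sided bound is enough, and the
  traces of the dominating operators simply add up over outcomes and over strings. The factor 2^n by
  which Tr (1 \<otimes> K_P) exceeds Tr K_P for states, or which Tr_S of the completeness relation
  brings in for POVMs, cancels the prefactor 2^(-n); hence a round contributes on average at most 2
  * 3 \<epsilon> * 2^(-n/2), the leading 2 being the cost of the regularisation. The contributions
  add linearly over the rounds, which is why \<epsilon> appears to the power -1. In the measurement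
  model the state may be entangled across rounds and has no product form to exploit, so the
  disturbance is moved onto the POVM element: Y \<mapsto> Tr (P Y) P is its own adjoint for the
  trace pairing.\<close>

lemma sum_lessThan_mult:
  fixes f :: "nat \<Rightarrow> 'a::comm_monoid_add"
  shows "(\<Sum>i<m * n. f i) = (\<Sum>a<m. \<Sum>b<n. f (a * n + b))"
proof -
  have "(\<Sum>b<n. f (a * n + b)) = sum f {a * n..<a * n + n}" for a
    using sum.shift_bounds_nat_ivl[of f 0 "a * n" n] by (simp add: atLeast0LessThan add.commute)
  then show ?thesis
    by (simp add: sum.nat_group)
qed

lemma prod_index_less:
  fixes a b m n :: nat
  assumes "a < m" "b < n"
  shows "a * n + b < m * n"
proof -
  have "a * n + b < Suc a * n" using assms by simp
  also have "\<dots> \<le> m * n" using assms by (intro mult_right_mono) auto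
  finally show ?thesis .
qed

lemma prod_index_div [simp]: "b < n \<Longrightarrow> (a * n + b) div n = (a::nat)"
  and prod_index_mod [simp]: "b < n \<Longrightarrow> (a * n + b) mod n = (b::nat)"
  by auto

text \<open>Comparison at pair indices: with the two factors named separately, later entry
  computations avoid \<open>div\<close> and \<open>mod\<close>.\<close>

lemma eq_mat_prodI:
  assumes "A \<in> carrier_mat (m * n) (m * n)" "B \<in> carrier_mat (m * n) (m * n)"
    and "\<And>a b a' b'. a < m \<Longrightarrow> a' < m \<Longrightarrow> b < n \<Longrightarrow> b' < n \<Longrightarrow>
      A $$ (a * n + b, a' * n + b') = B $$ (a * n + b, a' * n + b')"
  shows "A = B"
proof (rule eq_matI)
  fix i j assume "i < dim_row B" "j < dim_col B"
  then have ij: "i < m * n" "j < m * n" using assms by auto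
  then have n: "0 < n" by (cases n) auto
  have "A $$ (i div n * n + i mod n, j div n * n + j mod n) =
    B $$ (i div n * n + i mod n, j div n * n + j mod n)"
    using ij n by (intro assms(3)) (auto simp: less_mult_imp_div_less)
  then show "A $$ (i, j) = B $$ (i, j)" by simp
qed (use assms in auto)

lemma index_mult_mat_sum:
  assumes "A \<in> carrier_mat m k" "B \<in> carrier_mat k n" "i < m" "j < n"
  shows "(A * B) $$ (i, j) = (\<Sum>l<k. A $$ (i, l) * B $$ (l, j))"
  using assms by (auto simp: scalar_prod_def atLeast0LessThan intro!: sum.cong)

lemma kron_carrier [simp, intro]:
  assumes "A \<in> carrier_mat k l" "B \<in> carrier_mat m n"
  shows "kron A B \<in> carrier_mat (k * m) (l * n)"
  using assms by (auto simp: kron_def)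

lemma kron_index:
  assumes "A \<in> carrier_mat k l" "B \<in> carrier_mat m n"
    "a < k" "a' < l" "b < m" "b' < n"
  shows "kron A B $$ (a * m + b, a' * n + b') = A $$ (a, a') * B $$ (b, b')"
  using assms prod_index_less[of a k b m] prod_index_less[of a' l b' n]
  by (auto simp: kron_def)

lemma kron_mult:
  assumes "A \<in> carrier_mat k k" "B \<in> carrier_mat m m"
    "C \<in> carrier_mat k k" "D \<in> carrier_mat m m"
  shows "kron A B * kron C D = kron (A * C) (B * D)"
proof (rule eq_mat_prodI[of _ k m])
  fix a b a' b' assume *: "a < k" "a' < k" "b < m" "b' < m"
  have "(kron A B * kron C D) $$ (a * m + b, a' * m + b') =
    (\<Sum>c<k. \<Sum>d<m. (A $$ (a, c) * B $$ (b, d)) * (C $$ (c, a') * D $$ (d, b')))"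
    using assms * prod_index_less[of a k b m] prod_index_less[of a' k b' m]
    by (subst index_mult_mat_sum[of _ "k * m" "k * m" _ "k * m"])
       (auto simp: sum_lessThan_mult kron_index[OF assms(1,2)] kron_index[OF assms(3,4)]
         intro!: sum.cong)
  also have "\<dots> = (\<Sum>c<k. A $$ (a, c) * C $$ (c, a')) * (\<Sum>d<m. B $$ (b, d) * D $$ (d, b'))"
    by (simp add: sum_product algebra_simps)
  also have "\<dots> = kron (A * C) (B * D) $$ (a * m + b, a' * m + b')"
    using assms * by (subst kron_index[of _ k k _ m m])
      (auto simp: index_mult_mat_sum[OF assms(1,3)] index_mult_mat_sum[OF assms(2,4)]
        simp del: index_mult_mat(1))
  finally show "(kron A B * kron C D) $$ (a * m + b, a' * m + b') =
    kron (A * C) (B * D) $$ (a * m + b, a' * m + b')" .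
qed (use assms in \<open>blast intro: kron_carrier mult_carrier_mat\<close>)+

lemma kron_one: "kron (1\<^sub>m k) (1\<^sub>m m) = (1\<^sub>m (k * m) :: complex mat)"
proof (rule eq_mat_prodI[of _ k m])
  fix a b a' b' :: nat assume *: "a < k" "a' < k" "b < m" "b' < m"
  have "a * m + b = a' * m + b' \<longleftrightarrow> a = a' \<and> b = b'"
    using * by (metis prod_index_div prod_index_mod)
  then show "kron (1\<^sub>m k) (1\<^sub>m m) $$ (a * m + b, a' * m + b') = (1\<^sub>m (k * m) :: complex mat) $$ (a * m + b, a' * m + b')"
    using * prod_index_less[of a k b m] prod_index_less[of a' k b' m]
    by (simp add: kron_index[of _ k k _ m m])
qed auto

lemma kron_smult_left: "kron (c \<cdot>\<^sub>m A) B = c \<cdot>\<^sub>m kron A B"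
proof (rule eq_matI)
  fix i j assume "i < dim_row (c \<cdot>\<^sub>m kron A B)" "j < dim_col (c \<cdot>\<^sub>m kron A B)"
  then have ij: "i < dim_row A * dim_row B" "j < dim_col A * dim_col B"
    by (auto simp: kron_def)
  then show "kron (c \<cdot>\<^sub>m A) B $$ (i, j) = (c \<cdot>\<^sub>m kron A B) $$ (i, j)"
    by (auto simp: kron_def less_mult_imp_div_less)
qed (auto simp: kron_def)

lemma kron_smult_right: "kron A (c \<cdot>\<^sub>m B) = c \<cdot>\<^sub>m kron A B"
proof (rule eq_matI)
  fix i j assume "i < dim_row (c \<cdot>\<^sub>m kron A B)" "j < dim_col (c \<cdot>\<^sub>m kron A B)"
  then have ij: "i < dim_row A * dim_row B" "j < dim_col A * dim_col B"
    by (auto simp: kron_def)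
  then have "dim_row B > 0" "dim_col B > 0" by (auto intro: ccontr)
  then show "kron A (c \<cdot>\<^sub>m B) $$ (i, j) = (c \<cdot>\<^sub>m kron A B) $$ (i, j)"
    using ij by (auto simp: kron_def less_mult_imp_div_less)
qed (auto simp: kron_def)

lemma kron_add_right:
  assumes "A \<in> carrier_mat k l" "B \<in> carrier_mat m n" "C \<in> carrier_mat m n"
  shows "kron A (B + C) = kron A B + kron A C"
proof (rule eq_matI)
  fix i j assume "i < dim_row (kron A B + kron A C)" "j < dim_col (kron A B + kron A C)"
  then have ij: "i < k * m" "j < l * n" using assms by (auto simp: kron_def)
  then have "m > 0" "n > 0" by (auto intro: ccontr)
  then show "kron A (B + C) $$ (i, j) = (kron A B + kron A C) $$ (i, j)"
    using assms ij by (auto simp: kron_def less_mult_imp_div_less algebra_simps)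
qed (use assms in \<open>auto simp: kron_def\<close>)

lemma kron_minus_right:
  assumes "A \<in> carrier_mat k l" "B \<in> carrier_mat m n" "C \<in> carrier_mat m n"
  shows "kron A (B - C) = kron A B - kron A C"
proof (rule eq_matI)
  fix i j assume "i < dim_row (kron A B - kron A C)" "j < dim_col (kron A B - kron A C)"
  then have ij: "i < k * m" "j < l * n" using assms by (auto simp: kron_def)
  then have "m > 0" "n > 0" by (auto intro: ccontr)
  then show "kron A (B - C) $$ (i, j) = (kron A B - kron A C) $$ (i, j)"
    using assms ij by (auto simp: kron_def less_mult_imp_div_less algebra_simps)
qed (use assms in \<open>auto simp: kron_def\<close>)

section \<open>Traces and partial traces\<close>

lemma mtrace_carrier: "A \<in> carrier_mat n n \<Longrightarrow> mtrace A = (\<Sum>i<n. A $$ (i, i))"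
  by (auto simp: mtrace_def)

lemma mtrace_one [simp]: "mtrace (1\<^sub>m n) = of_nat n"
  by (simp add: mtrace_def)

lemma mtrace_smult: "A \<in> carrier_mat n n \<Longrightarrow> mtrace (c \<cdot>\<^sub>m A) = c * mtrace A"
  by (auto simp: mtrace_def sum_distrib_left)

lemma mtrace_add:
  "A \<in> carrier_mat n n \<Longrightarrow> B \<in> carrier_mat n n \<Longrightarrow> mtrace (A + B) = mtrace A + mtrace B"
  by (auto simp: mtrace_def sum.distrib)

lemma mtrace_minus:
  "A \<in> carrier_mat n n \<Longrightarrow> B \<in> carrier_mat n n \<Longrightarrow> mtrace (A - B) = mtrace A - mtrace B"
  by (auto simp: mtrace_def sum_subtractf)

lemma mtrace_kron:
  assumes "A \<in> carrier_mat k k" "B \<in> carrier_mat m m"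
  shows "mtrace (kron A B) = mtrace A * mtrace B"
  using assms
  by (simp add: mtrace_carrier[OF kron_carrier[OF assms]] mtrace_carrier[of A k]
    mtrace_carrier[of B m] sum_lessThan_mult kron_index[of _ k k _ m m] sum_product)

lemma ptrace_left_carrier [simp, intro]: "ptrace_left d m X \<in> carrier_mat m m"
  by (simp add: ptrace_left_def)

lemma mtrace_ptrace_left:
  assumes "X \<in> carrier_mat (d * m) (d * m)"
  shows "mtrace (ptrace_left d m X) = mtrace X"
  using assms
  by (auto simp: mtrace_carrier[of _ "d * m"] sum_lessThan_mult mtrace_carrier[of _ m]
    ptrace_left_def intro: sum.swap)

section \<open>Adjoints\<close>

lemma mat_adjoint_dim [simp]: "dim_row (mat_adjoint A) = dim_col A" "dim_col (mat_adjoint A) = dim_row A"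
  by (auto simp: mat_adjoint_def)

lemma mat_adjoint_carrier [simp, intro]: "A \<in> carrier_mat m n \<Longrightarrow> mat_adjoint A \<in> carrier_mat n m"
  by (intro carrier_matI) auto

lemma mat_adjoint_index:
  fixes A :: "complex mat"
  shows "i < dim_col A \<Longrightarrow> j < dim_row A \<Longrightarrow> mat_adjoint A $$ (i, j) = cnj (A $$ (j, i))"
  by (auto simp: mat_adjoint_def mat_of_rows_index)

lemma mat_adjoint_mult:
  fixes A B :: "complex mat"
  assumes "A \<in> carrier_mat m k" "B \<in> carrier_mat k n"
  shows "mat_adjoint (A * B) = mat_adjoint B * mat_adjoint A"
proof (rule eq_matI)
  fix i j assume "i < dim_row (mat_adjoint B * mat_adjoint A)" "j < dim_col (mat_adjoint B * mat_adjoint A)"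
  then have ij: "i < n" "j < m" using assms by auto
  then show "mat_adjoint (A * B) $$ (i, j) = (mat_adjoint B * mat_adjoint A) $$ (i, j)"
    using assms
    by (subst index_mult_mat_sum[of _ n k _ m])
       (auto simp: mat_adjoint_index index_mult_mat_sum[OF assms] mult.commute
         simp del: index_mult_mat(1) intro!: sum.cong)
qed (use assms in auto)

lemma mat_adjoint_minus:
  fixes A B :: "complex mat"
  assumes "A \<in> carrier_mat m n" "B \<in> carrier_mat m n"
  shows "mat_adjoint (A - B) = mat_adjoint A - mat_adjoint B"
  using assms by (intro eq_matI) (auto simp: mat_adjoint_index)

lemma mat_adjoint_smult:
  fixes A :: "complex mat"
  shows "mat_adjoint (c \<cdot>\<^sub>m A) = cnj c \<cdot>\<^sub>m mat_adjoint A"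
  by (intro eq_matI) (auto simp: mat_adjoint_index)

lemma mat_adjoint_one [simp]: "mat_adjoint (1\<^sub>m n) = (1\<^sub>m n :: complex mat)"
  by (intro eq_matI) (auto simp: mat_adjoint_index)

lemma mat_adjoint_kron:
  "mat_adjoint (kron A B) = kron (mat_adjoint A) (mat_adjoint B)"
proof (rule eq_matI)
  fix i j assume "i < dim_row (kron (mat_adjoint A) (mat_adjoint B))"
    "j < dim_col (kron (mat_adjoint A) (mat_adjoint B))"
  then have ij: "i < dim_col A * dim_col B" "j < dim_row A * dim_row B"
    by (auto simp: kron_def)
  then have "dim_row B > 0" "dim_col B > 0" by (auto intro: ccontr)
  then show "mat_adjoint (kron A B) $$ (i, j) = kron (mat_adjoint A) (mat_adjoint B) $$ (i, j)"
    using ij by (auto simp: kron_def less_mult_imp_div_less mat_adjoint_index)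
qed (auto simp: kron_def)

text \<open>The matrix and the test vector are functions on all of \<open>nat\<close>, so that the
  same \<open>a\<close> can be read in dimension \<open>d\<close> and in dimension
  \<open>Suc d\<close>; the factorisation by induction on the dimension rests on this.\<close>

definition qform :: "nat \<Rightarrow> (nat \<Rightarrow> nat \<Rightarrow> complex) \<Rightarrow> (nat \<Rightarrow> complex) \<Rightarrow> complex" where
  "qform d a f = (\<Sum>i<d. \<Sum>j<d. cnj (f i) * a i j * f j)"

lemma psd_iff_qform:
  "psd d A \<longleftrightarrow> A \<in> carrier_mat d d \<and> (\<forall>f. 0 \<le> qform d (\<lambda>i j. A $$ (i, j)) f)"
proof (cases "A \<in> carrier_mat d d")
  case A: True
  have eq: "(A *\<^sub>v v) \<bullet>c v = qform d (\<lambda>i j. A $$ (i, j)) (($) v)" if "v \<in> carrier_vec d" for v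
    using A that
    by (auto simp: qform_def scalar_prod_def atLeast0LessThan sum_distrib_left sum_distrib_right
      algebra_simps intro!: sum.cong)
  have "qform d (\<lambda>i j. A $$ (i, j)) f = qform d (\<lambda>i j. A $$ (i, j)) (($) (vec d f))" for f
    by (auto simp: qform_def intro!: sum.cong)
  then have "(\<forall>v\<in>carrier_vec d. 0 \<le> (A *\<^sub>v v) \<bullet>c v) \<longleftrightarrow>
      (\<forall>f. 0 \<le> qform d (\<lambda>i j. A $$ (i, j)) f)"
    by (metis eq vec_carrier)
  with A show ?thesis by (simp add: psd_def)
qed (simp add: psd_def)

lemma psd_carrier: "psd d A \<Longrightarrow> A \<in> carrier_mat d d"
  by (simp add: psd_def)

lemma psd_add: "psd d A \<Longrightarrow> psd d B \<Longrightarrow> psd d (A + B)"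
  unfolding psd_def
  by (auto simp: add_mult_distrib_mat_vec[of _ d d] add_scalar_prod_distrib[of _ d])

lemma psd_smult:
  assumes "psd d A" "0 \<le> c"
  shows "psd d (c \<cdot>\<^sub>m A)"
proof -
  have A: "A \<in> carrier_mat d d" using assms by (simp add: psd_def)
  have "qform d (\<lambda>i j. (c \<cdot>\<^sub>m A) $$ (i, j)) f = c * qform d (\<lambda>i j. A $$ (i, j)) f" for f
    using A by (auto simp: qform_def sum_distrib_left intro!: sum.cong)
  then show ?thesis using assms A by (simp add: psd_iff_qform)
qed

lemma psd_one: "psd d (1\<^sub>m d)"
  by (auto simp: psd_def conjugate_square_ge_0_vec)

lemma qform_extend:
  assumes "f d = c"
  shows "qform (Suc d) a f = qform d a f + (\<Sum>i<d. cnj (f i) * a i d) * c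
    + cnj c * (\<Sum>j<d. a d j * f j) + cnj c * a d d * c"
  using assms
  by (simp add: qform_def sum.distrib sum_distrib_left sum_distrib_right algebra_simps)

lemma qform_cong: "(\<And>i. i < d \<Longrightarrow> f i = g i) \<Longrightarrow> qform d a f = qform d a g"
  by (auto simp: qform_def intro!: sum.cong)

lemma qform_two:
  assumes "i < d" "j < d" "i \<noteq> j"
  shows "qform d a (\<lambda>k. if k = i then x else if k = j then y else 0) =
    cnj x * a i i * x + cnj x * a i j * y + cnj y * a j i * x + cnj y * a j j * y"
proof -
  let ?f = "\<lambda>k. if k = i then x else if k = j then y else 0"
  have restrict: "(\<Sum>k<d. g k) = g i + g j" if "\<And>k. k \<noteq> i \<Longrightarrow> k \<noteq> j \<Longrightarrow> g k = 0"
    for g :: "nat \<Rightarrow> complex"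
  proof -
    have "sum g {..<d} = sum g {i, j}"
      using assms that by (intro sum.mono_neutral_right) auto
    then show ?thesis using assms by simp
  qed
  show ?thesis
    unfolding qform_def using assms by (simp add: restrict)
qed

lemma qform_one:
  assumes "i < d"
  shows "qform d a (\<lambda>k. if k = i then x else 0) = cnj x * a i i * x"
proof -
  have "(\<Sum>k<d. g k) = g i" if "\<And>k. k \<noteq> i \<Longrightarrow> g k = 0" for g :: "nat \<Rightarrow> complex"
    using assms that sum.mono_neutral_right[of "{..<d}" "{i}" g] by auto
  then show ?thesis unfolding qform_def by simp
qed

lemma qform_nonneg_diag:
  assumes "\<And>f. 0 \<le> qform d a f" "i < d"
  shows "0 \<le> a i i"
  using assms(1)[of "\<lambda>k. if k = i then 1 else 0"] qform_one[OF assms(2), of a 1] by simp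

text \<open>The form is real at e_i + e_j and at e_i + \<i> e_j. The first makes a_ij + a_ji real,
  the second makes a_ij - a_ji purely imaginary.\<close>

lemma qform_nonneg_hermitian:
  assumes pos: "\<And>f. 0 \<le> qform d a f" and ij: "i < d" "j < d"
  shows "a j i = cnj (a i j)"
proof (cases "i = j")
  case True
  then show ?thesis using qform_nonneg_diag[OF pos ij(1)]
    by (simp add: less_eq_complex_def complex_eq_iff)
next
  case False
  have d: "Im (a i i) = 0" "Im (a j j) = 0"
    using qform_nonneg_diag[OF pos ij(1)] qform_nonneg_diag[OF pos ij(2)]
    by (auto simp: less_eq_complex_def)
  show ?thesis
    using pos[of "\<lambda>k. if k = i then 1 else if k = j then 1 else 0"]
      pos[of "\<lambda>k. if k = i then 1 else if k = j then \<i> else 0"] d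
    unfolding qform_two[OF ij False]
    by (auto simp: less_eq_complex_def complex_eq_iff)
qed

lemma psd_adjoint:
  assumes "psd d A"
  shows "mat_adjoint A = A"
proof (rule eq_matI)
  fix i j assume "i < dim_row A" "j < dim_col A"
  moreover from this have "A $$ (i, j) = cnj (A $$ (j, i))"
    using assms unfolding psd_iff_qform
    by (intro qform_nonneg_hermitian[of d "\<lambda>i j. A $$ (i, j)"]) auto
  ultimately show "mat_adjoint A $$ (i, j) = A $$ (i, j)"
    using psd_carrier[OF assms] by (simp add: mat_adjoint_index)
qed (use psd_carrier[OF assms] in auto)

text \<open>Along - t a_ij e_i + e_j the form is a_jj - 2 t |a_ij|^2, because a_ii = 0; if a_ij were
  nonzero, this would be negative for large t.\<close>

lemma qform_nonneg_zero_diag: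
  assumes pos: "\<And>f. 0 \<le> qform d a f" and ij: "i < d" "j < d" and z: "a i i = 0"
  shows "a i j = 0"
proof (cases "i = j")
  case False
  have h: "a j i = cnj (a i j)" by (rule qform_nonneg_hermitian[OF pos ij])
  define s where "s = (cmod (a i j))\<^sup>2"
  have bound: "0 \<le> Re (a j j) - 2 * t * s" for t :: real
    using pos[of "\<lambda>k. if k = i then - (of_real t * a i j) else if k = j then 1 else 0"]
    unfolding qform_two[OF ij False] z h
    by (simp add: less_eq_complex_def s_def cmod_power2)
      (simp add: power2_eq_square algebra_simps)
  have "s = 0"
  proof (rule ccontr)
    assume "s \<noteq> 0"
    \<comment> \<open>This \<open>t\<close> would give the form the value -1.\<close>
    then have "2 * ((Re (a j j) + 1) / (2 * s)) * s = Re (a j j) + 1" by simp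
    with bound[of "(Re (a j j) + 1) / (2 * s)"] show False by linarith
  qed
  then show ?thesis by (simp add: s_def)
qed (use z in auto)

text \<open>Cholesky factorisation by induction on the dimension. The last column, scaled by its
  pivot, gives one rank-one term, and the Schur complement \<open>b\<close> of the pivot is again
  nonnegative. Rank-one terms are the form in which positivity is passed on to tensor products and
  partial traces.\<close>

lemma qform_nonneg_gram:
  assumes "\<And>f. 0 \<le> qform d a f"
  shows "\<exists>e. \<forall>i<d. \<forall>j<d. a i j = (\<Sum>k<d. e k i * cnj (e k j))"
  using assms
proof (induction d arbitrary: a)
  case (Suc d)
  note pos = Suc.prems
  have herm: "a j i = cnj (a i j)" if "i < Suc d" "j < Suc d" for i j
    by (rule qform_nonneg_hermitian[OF pos that])
  \<comment> \<open>For \<open>a d d = 0\<close> the last row vanishes, and the junk value of the division is harmless.\<close>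
  define r where "r = Re (a d d)"
  have r: "a d d = of_real r" "r \<ge> 0"
    using qform_nonneg_diag[OF pos, of d] by (auto simp: r_def less_eq_complex_def complex_eq_iff)
  have r0: "a d i = 0" if "r = 0" "i < Suc d" for i
    using qform_nonneg_zero_diag[OF pos, of d i] that r by simp
  define b where "b i j = a i j - a i d * a d j / a d d" for i j
  have "0 \<le> qform d b f" for f
  proof -
    let ?S = "\<Sum>j<d. a d j * f j"
    have cS: "(\<Sum>i<d. cnj (f i) * a i d) = cnj ?S"
      by (auto simp: herm[of d] mult.commute intro!: sum.cong)
    have "qform d b f = qform d a f - (\<Sum>i<d. \<Sum>j<d. (cnj (f i) * a i d) * (a d j * f j)) / a d d"
      by (simp add: qform_def b_def sum_subtractf sum_divide_distrib algebra_simps)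
    also have "\<dots> = qform d a f - cnj ?S * ?S / a d d"
      by (simp only: sum_product[symmetric] cS)
    \<comment> \<open>For a nonzero pivot the last coordinate \<open>- ?S / a d d\<close> minimises
      the form over all extensions of \<open>f\<close>, and the minimum is the form of the Schur
      complement.\<close>
    also have "\<dots> = qform (Suc d) a (f(d := - ?S / a d d))"
    proof (cases "r = 0")
      case True
      have "?S = 0" by (intro sum.neutral) (simp add: r0 True)
      then show ?thesis by (subst qform_extend) (auto intro!: qform_cong)
    next
      case False
      have "qform (Suc d) a (f(d := - ?S / a d d)) =
          qform d a f - cnj ?S * ?S / a d d - cnj (?S / a d d) * ?S + cnj (?S / a d d) * ?S"
        using False r(1) cS qform_cong[of d "f(d := - ?S / a d d)" f]
        by (subst qform_extend[OF fun_upd_same]) simp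
      then show ?thesis by simp
    qed
    finally show ?thesis using pos by simp
  qed
  from Suc.IH[OF this] obtain e where e: "\<And>i j. i < d \<Longrightarrow> j < d \<Longrightarrow> b i j = (\<Sum>k<d. e k i * cnj (e k j))"
    by blast
  define e' where "e' k i = (if k = d then a i d / of_real (sqrt r) else if i = d then 0 else e k i)" for k i
  have sq: "complex_of_real (sqrt r) * of_real (sqrt r) = of_real r"
    using r(2) by (simp flip: of_real_mult)
  have "a i j = (\<Sum>k<Suc d. e' k i * cnj (e' k j))" if ij: "i < Suc d" "j < Suc d" for i j
  proof -
    have last: "e' d i * cnj (e' d j) = a i d * a d j / a d d"
      using ij herm[of j d] sq r(1) by (simp add: e'_def)
    have "(\<Sum>k<d. e' k i * cnj (e' k j)) = b i j"
    proof (cases "i = d \<or> j = d")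
      case True
      have "b i j = 0"
        using True r0 r(1) ij herm[of d i] by (cases "r = 0") (auto simp: b_def)
      moreover have "(\<Sum>k<d. e' k i * cnj (e' k j)) = 0"
        using True by (intro sum.neutral) (auto simp: e'_def)
      ultimately show ?thesis by simp
    next
      case False
      then show ?thesis using ij e[of i j] by (auto simp: e'_def intro!: sum.cong)
    qed
    then show ?thesis using last by (simp add: b_def)
  qed
  then show ?case by blast
qed auto

lemma psd_gram:
  assumes "psd d A"
  obtains e where "\<And>i j. i < d \<Longrightarrow> j < d \<Longrightarrow> A $$ (i, j) = (\<Sum>k<d. e k i * cnj (e k j))"
  using qform_nonneg_gram[of d "\<lambda>i j. A $$ (i, j)"] assms
  unfolding psd_iff_qform by blast

lemma psd_conj:
  assumes "psd n A" "B \<in> carrier_mat m n"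
  shows "psd m (B * A * mat_adjoint B)"
proof -
  have A: "A \<in> carrier_mat n n" by (rule psd_carrier[OF assms(1)])
  have "qform m (\<lambda>i j. (B * A * mat_adjoint B) $$ (i, j)) f =
    qform n (\<lambda>i j. A $$ (i, j)) (\<lambda>k. \<Sum>j<m. cnj (B $$ (j, k)) * f j)" for f
  proof -
    have "qform m (\<lambda>i j. (B * A * mat_adjoint B) $$ (i, j)) f =
      (\<Sum>i<m. \<Sum>j<m. \<Sum>l<n. \<Sum>k<n. cnj (f i) * B $$ (i, k) * A $$ (k, l) * cnj (B $$ (j, l)) * f j)"
      using assms(2) A
      by (simp add: qform_def index_mult_mat_sum[of _ m n _ m] index_mult_mat_sum[of _ m n _ n]
        mat_adjoint_index sum_distrib_left sum_distrib_right mult.assoc del: index_mult_mat(1))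
    also have "\<dots> = (\<Sum>(i, j, l, k)\<in>{..<m} \<times> {..<m} \<times> {..<n} \<times> {..<n}.
        cnj (f i) * B $$ (i, k) * A $$ (k, l) * cnj (B $$ (j, l)) * f j)"
      by (simp add: sum.cartesian_product)
    also have "\<dots> = (\<Sum>(k, l, i, j)\<in>{..<n} \<times> {..<n} \<times> {..<m} \<times> {..<m}.
        cnj (f i) * B $$ (i, k) * A $$ (k, l) * cnj (B $$ (j, l)) * f j)"
      by (rule sum.reindex_bij_witness[of _ "\<lambda>(k, l, i, j). (i, j, l, k)" "\<lambda>(i, j, l, k). (k, l, i, j)"]) auto
    also have "\<dots> = (\<Sum>k<n. \<Sum>l<n. \<Sum>i<m. \<Sum>j<m.
        cnj (f i) * B $$ (i, k) * A $$ (k, l) * cnj (B $$ (j, l)) * f j)"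
      by (simp add: sum.cartesian_product)
    also have "\<dots> = qform n (\<lambda>i j. A $$ (i, j)) (\<lambda>k. \<Sum>j<m. cnj (B $$ (j, k)) * f j)"
      by (simp add: qform_def sum_distrib_left sum_distrib_right mult_ac)
    finally show ?thesis .
  qed
  then show ?thesis
    using assms A by (auto simp: psd_iff_qform)
qed

text \<open>With A written as a sum of rank-one terms, the form of A \<otimes> B at f is the sum
  over k of the forms of B at f contracted with e_k on the first factor.\<close>

lemma psd_kron:
  assumes "psd m A" "psd n B"
  shows "psd (m * n) (kron A B)"
proof -
  have A: "A \<in> carrier_mat m m" and B: "B \<in> carrier_mat n n"
    using assms by (auto intro: psd_carrier)
  obtain e where e: "\<And>i j. i < m \<Longrightarrow> j < m \<Longrightarrow> A $$ (i, j) = (\<Sum>k<m. e k i * cnj (e k j))"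
    using psd_gram[OF assms(1)] by blast
  have "0 \<le> qform (m * n) (\<lambda>i j. kron A B $$ (i, j)) f" for f
  proof -
    have "qform (m * n) (\<lambda>i j. kron A B $$ (i, j)) f =
      (\<Sum>a<m. \<Sum>b<n. \<Sum>a'<m. \<Sum>b'<n. \<Sum>k<m. cnj (f (a * n + b)) * e k a * cnj (e k a') *
        B $$ (b, b') * f (a' * n + b'))"
      unfolding qform_def sum_lessThan_mult
      by (intro sum.cong refl)
         (simp add: kron_index[OF A B] e sum_distrib_left sum_distrib_right mult.assoc)
    also have "\<dots> = (\<Sum>(a, b, a', b', k)\<in>{..<m} \<times> {..<n} \<times> {..<m} \<times> {..<n} \<times> {..<m}.
        cnj (f (a * n + b)) * e k a * cnj (e k a') * B $$ (b, b') * f (a' * n + b'))"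
      by (simp add: sum.cartesian_product)
    also have "\<dots> = (\<Sum>(k, b, b', a, a')\<in>{..<m} \<times> {..<n} \<times> {..<n} \<times> {..<m} \<times> {..<m}.
        cnj (f (a * n + b)) * e k a * cnj (e k a') * B $$ (b, b') * f (a' * n + b'))"
      by (rule sum.reindex_bij_witness[of _ "\<lambda>(k, b, b', a, a'). (a, b, a', b', k)"
            "\<lambda>(a, b, a', b', k). (k, b, b', a, a')"]) auto
    also have "\<dots> = (\<Sum>k<m. \<Sum>b<n. \<Sum>b'<n. \<Sum>a<m. \<Sum>a'<m.
        cnj (f (a * n + b)) * e k a * cnj (e k a') * B $$ (b, b') * f (a' * n + b'))"
      by (simp add: sum.cartesian_product)
    also have "\<dots> = (\<Sum>k<m. qform n (\<lambda>i j. B $$ (i, j)) (\<lambda>b. \<Sum>a<m. cnj (e k a) * f (a * n + b)))"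
      by (simp add: qform_def sum_distrib_left sum_distrib_right mult_ac)
    also have "\<dots> \<ge> 0"
      using assms(2) by (intro sum_nonneg) (simp add: psd_iff_qform)
    finally show ?thesis .
  qed
  then show ?thesis using A B by (simp add: psd_iff_qform kron_carrier)
qed

lemma ptrace_left_kron_mult_index:
  assumes "E \<in> carrier_mat d d" "Y \<in> carrier_mat (d * m) (d * m)" "c < m" "c' < m"
  shows "ptrace_left d m (kron E (1\<^sub>m m) * Y) $$ (c, c') =
    (\<Sum>i<d. \<Sum>j<d. E $$ (i, j) * Y $$ (j * m + c, i * m + c'))"
  using assms prod_index_less[of _ d _ m]
  by (simp add: ptrace_left_def index_mult_mat_sum[of _ "d * m" "d * m" _ "d * m"]
    kron_carrier sum_lessThan_mult kron_index[of _ d d _ m m] del: index_mult_mat(1))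
    (simp add: if_distrib[of "\<lambda>x. _ * x"] if_distrib[of "\<lambda>x. x * _"] sum.delta cong: if_cong)

text \<open>With E written as a sum of rank-one terms, the form at f is the sum over k of the forms
  of Y at e_k \<otimes> f. The product of E \<otimes> 1 and Y itself need not be Hermitian; the
  partial trace restores positivity.\<close>

lemma psd_ptrace_left_kron_mult:
  assumes "psd d E" "psd (d * m) Y"
  shows "psd m (ptrace_left d m (kron E (1\<^sub>m m) * Y))"
proof -
  have E: "E \<in> carrier_mat d d" and Y: "Y \<in> carrier_mat (d * m) (d * m)"
    using assms by (auto intro: psd_carrier)
  obtain e where e: "\<And>i j. i < d \<Longrightarrow> j < d \<Longrightarrow> E $$ (i, j) = (\<Sum>k<d. e k i * cnj (e k j))"
    using psd_gram[OF assms(1)] by blast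
  have "0 \<le> qform m (\<lambda>i j. ptrace_left d m (kron E (1\<^sub>m m) * Y) $$ (i, j)) f" for f
  proof -
    have "qform m (\<lambda>i j. ptrace_left d m (kron E (1\<^sub>m m) * Y) $$ (i, j)) f =
      (\<Sum>c<m. \<Sum>c'<m. \<Sum>i<d. \<Sum>j<d. \<Sum>k<d. cnj (f c) * e k i * cnj (e k j) *
        Y $$ (j * m + c, i * m + c') * f c')"
      unfolding qform_def
      by (intro sum.cong refl)
         (simp add: ptrace_left_kron_mult_index[OF E Y] e sum_distrib_left sum_distrib_right mult.assoc)
    also have "\<dots> = (\<Sum>(c, c', i, j, k)\<in>{..<m} \<times> {..<m} \<times> {..<d} \<times> {..<d} \<times> {..<d}.
        cnj (f c) * e k i * cnj (e k j) * Y $$ (j * m + c, i * m + c') * f c')"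
      by (simp add: sum.cartesian_product)
    also have "\<dots> = (\<Sum>(k, j, c, i, c')\<in>{..<d} \<times> {..<d} \<times> {..<m} \<times> {..<d} \<times> {..<m}.
        cnj (f c) * e k i * cnj (e k j) * Y $$ (j * m + c, i * m + c') * f c')"
      by (rule sum.reindex_bij_witness[of _ "\<lambda>(k, j, c, i, c'). (c, c', i, j, k)"
            "\<lambda>(c, c', i, j, k). (k, j, c, i, c')"]) auto
    also have "\<dots> = (\<Sum>k<d. \<Sum>j<d. \<Sum>c<m. \<Sum>i<d. \<Sum>c'<m.
        cnj (f c) * e k i * cnj (e k j) * Y $$ (j * m + c, i * m + c') * f c')"
      by (simp add: sum.cartesian_product)
    also have "\<dots> = (\<Sum>k<d. qform (d * m) (\<lambda>i j. Y $$ (i, j)) (\<lambda>x. e k (x div m) * f (x mod m)))"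
      unfolding qform_def sum_lessThan_mult
      by (intro sum.cong refl) (simp add: mult_ac)
    also have "\<dots> \<ge> 0"
      using assms(2) by (intro sum_nonneg) (simp add: psd_iff_qform)
    finally show ?thesis .
  qed
  then show ?thesis by (simp add: psd_iff_qform)
qed

lemma psd_ptrace_left:
  assumes "psd (d * m) X"
  shows "psd m (ptrace_left d m X)"
  using psd_ptrace_left_kron_mult[OF psd_one assms] psd_carrier[OF assms]
  by (simp add: kron_one)

lemma psd_mtrace_nonneg:
  assumes "psd d A"
  shows "0 \<le> mtrace A"
proof -
  have "0 \<le> A $$ (i, i)" if "i < d" for i
    using qform_nonneg_diag[of d "\<lambda>i j. A $$ (i, j)" i] assms that by (simp add: psd_iff_qform)
  then show ?thesis
    unfolding mtrace_carrier[OF psd_carrier[OF assms]] by (intro sum_nonneg) auto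
qed

text \<open>The form of A + \<delta> 1 is at least \<delta> |v|^2, so the kernel is trivial. The
  inverse G is selfadjoint by uniqueness of inverses, and positive because G = G (A + \<delta> 1)
  G.\<close>

lemma psd_add_multiple_one_inverse:
  assumes "psd m A" "0 < \<delta>"
  obtains G where "psd m G" "G * (A + of_real \<delta> \<cdot>\<^sub>m 1\<^sub>m m) = 1\<^sub>m m"
    "(A + of_real \<delta> \<cdot>\<^sub>m 1\<^sub>m m) * G = 1\<^sub>m m"
proof -
  let ?M = "A + of_real \<delta> \<cdot>\<^sub>m 1\<^sub>m m"
  have A: "A \<in> carrier_mat m m" by (rule psd_carrier[OF assms(1)])
  then have M: "?M \<in> carrier_mat m m" by simp
  have psdM: "psd m ?M" using assms by (intro psd_add psd_smult psd_one) (auto simp: less_eq_complex_def)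
  have "det ?M \<noteq> 0"
  proof
    assume "det ?M = 0"
    then obtain v where v: "v \<in> carrier_vec m" "v \<noteq> 0\<^sub>v m" "?M *\<^sub>v v = 0\<^sub>v m"
      using det_0_iff_vec_prod_zero[OF M] by auto
    have "?M *\<^sub>v v = A *\<^sub>v v + of_real \<delta> \<cdot>\<^sub>v v"
      using A v(1) by (subst add_mult_distrib_mat_vec[of _ m m]) auto
    then have "0\<^sub>v m \<bullet>c v = (A *\<^sub>v v + of_real \<delta> \<cdot>\<^sub>v v) \<bullet>c v"
      unfolding v(3) by (rule arg_cong)
    then have "0 = (A *\<^sub>v v) \<bullet>c v + of_real \<delta> * (v \<bullet>c v)"
      using v(1) A by (simp add: add_scalar_prod_distrib[of _ m])
    moreover have "0 \<le> (A *\<^sub>v v) \<bullet>c v" using assms(1) v(1) by (simp add: psd_def)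
    moreover have "0 < of_real \<delta> * (v \<bullet>c v)"
      using assms(2) conjugate_square_greater_0_vec[OF v(1)] v(2)
      by (auto simp: less_complex_def)
    ultimately show False
      by (metis add_nonneg_pos less_irrefl)
  qed
  then obtain G where G: "G \<in> carrier_mat m m" "G * ?M = 1\<^sub>m m" "?M * G = 1\<^sub>m m"
    using det_non_zero_imp_unit[OF M] by (auto simp: Units_def ring_mat_def)
  have Ga: "mat_adjoint G = G"
  proof -
    have "mat_adjoint G * ?M = 1\<^sub>m m"
      using mat_adjoint_mult[OF M G(1)] psd_adjoint[OF psdM] G(3) by simp
    then have "mat_adjoint G * ?M * G = G" using G(1) by simp
    then show ?thesis using G(1,3) M assoc_mult_mat[of "mat_adjoint G" m m ?M m G m] by simp
  qed
  have "psd m (G * ?M * mat_adjoint G)" by (rule psd_conj[OF psdM G(1)])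
  then have "psd m G" using G(1,2) Ga by simp
  then show ?thesis using that G by blast
qed

text \<open>Here G is the inverse of S. The identity X - X G X = (1 - X G) X (1 - G X) + X G (S - X)
  G X displays the difference as a sum of two conjugated positive operators, which replaces an
  argument with square roots or operator monotonicity.\<close>

lemma psd_minus_sandwich:
  assumes X: "psd n X" and S: "psd n (S - X)" and G: "psd n G"
    and SC: "S \<in> carrier_mat n n" and inv: "G * S = 1\<^sub>m n"
  shows "psd n (X - X * G * X)"
proof -
  note XC = psd_carrier[OF X] and GC = psd_carrier[OF G]
  let ?I = "1\<^sub>m n :: complex mat"
  have GS: "G * (S * (G * X)) = G * X"
    using XC GC SC inv by (simp flip: assoc_mult_mat[of G n n S n "G * X" n])
  note [simp] = minus_carrier_mat assoc_mult_mat[of _ n n _ n _ n] minus_mult_distrib_mat[of _ n n _ _ n]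
    mult_minus_distrib_mat[of _ n n _ n]
  have "mat_adjoint (?I - X * G) = ?I - G * X" "mat_adjoint (X * G) = G * X"
    using XC GC by (simp_all add: mat_adjoint_minus[of _ n n] mat_adjoint_mult[of _ n n _ n]
      psd_adjoint[OF X] psd_adjoint[OF G])
  then have "psd n ((?I - X * G) * X * (?I - G * X) + X * G * (S - X) * (G * X))"
    using XC GC psd_conj[OF X, of "?I - X * G" n] psd_conj[OF S, of "X * G" n] by (auto intro!: psd_add)
  moreover have "(?I - X * G) * X * (?I - G * X) + X * G * (S - X) * (G * X) = X - X * G * X"
  proof -
    \<comment> \<open>\<open>U\<close> is X G X and \<open>V\<close> is X G X G X.\<close>
    have "(X - U) - (U - V) + (U - V) = X - U"
      if "U \<in> carrier_mat n n" "V \<in> carrier_mat n n" for U V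
      using XC that by (intro eq_matI) auto
    then show ?thesis using XC GC SC GS by simp
  qed
  ultimately show ?thesis by simp
qed

section \<open>Finite sums of matrices\<close>

lemma msum_carrier [simp, intro]: "msum d S f \<in> carrier_mat d d"
  by (simp add: msum_def)

lemma msum_index [simp]: "i < d \<Longrightarrow> j < d \<Longrightarrow> msum d S f $$ (i, j) = (\<Sum>x\<in>S. f x $$ (i, j))"
  by (simp add: msum_def)

lemma msum_dim [simp]: "dim_row (msum d S f) = d" "dim_col (msum d S f) = d"
  by (simp_all add: msum_def)

lemma smult_mat_index:
  "A \<in> carrier_mat m n \<Longrightarrow> i < m \<Longrightarrow> j < n \<Longrightarrow> (c \<cdot>\<^sub>m A) $$ (i, j) = c * A $$ (i, j)"
  by auto

lemma msum_cong: "(\<And>x. x \<in> S \<Longrightarrow> f x = g x) \<Longrightarrow> msum d S f = msum d S g"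
  by (simp add: msum_def cong: sum.cong)

lemma msum_add:
  assumes "\<And>x. x \<in> S \<Longrightarrow> f x \<in> carrier_mat d d" "\<And>x. x \<in> S \<Longrightarrow> g x \<in> carrier_mat d d"
  shows "msum d S (\<lambda>x. f x + g x) = msum d S f + msum d S g"
proof (rule eq_matI)
  fix i j assume "i < dim_row (msum d S f + msum d S g)" "j < dim_col (msum d S f + msum d S g)"
  then have ij: "i < d" "j < d" by auto
  have "(f x + g x) $$ (i, j) = f x $$ (i, j) + g x $$ (i, j)" if "x \<in> S" for x
    using assms(1,2)[OF that] ij by auto
  then show "msum d S (\<lambda>x. f x + g x) $$ (i, j) = (msum d S f + msum d S g) $$ (i, j)"
    using ij by (simp add: sum.distrib)
qed auto

lemma msum_smult:
  assumes "\<And>x. x \<in> S \<Longrightarrow> f x \<in> carrier_mat d d"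
  shows "msum d S (\<lambda>x. c \<cdot>\<^sub>m f x) = c \<cdot>\<^sub>m msum d S f"
proof (rule eq_matI)
  fix i j assume "i < dim_row (c \<cdot>\<^sub>m msum d S f)" "j < dim_col (c \<cdot>\<^sub>m msum d S f)"
  then have ij: "i < d" "j < d" by auto
  then show "msum d S (\<lambda>x. c \<cdot>\<^sub>m f x) $$ (i, j) = (c \<cdot>\<^sub>m msum d S f) $$ (i, j)"
    by (simp add: smult_mat_index[OF assms] sum_distrib_left)
qed auto

lemma psd_msum:
  assumes "\<And>x. x \<in> S \<Longrightarrow> psd d (f x)"
  shows "psd d (msum d S f)"
proof -
  have "qform d (\<lambda>i j. msum d S f $$ (i, j)) g = (\<Sum>x\<in>S. qform d (\<lambda>i j. f x $$ (i, j)) g)" for g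
  proof -
    have "qform d (\<lambda>i j. msum d S f $$ (i, j)) g =
        (\<Sum>i<d. \<Sum>j<d. \<Sum>x\<in>S. cnj (g i) * f x $$ (i, j) * g j)"
      by (simp add: qform_def sum_distrib_left sum_distrib_right)
    also have "\<dots> = (\<Sum>i<d. \<Sum>x\<in>S. \<Sum>j<d. cnj (g i) * f x $$ (i, j) * g j)"
      by (intro sum.cong refl sum.swap)
    also have "\<dots> = (\<Sum>x\<in>S. \<Sum>i<d. \<Sum>j<d. cnj (g i) * f x $$ (i, j) * g j)"
      by (rule sum.swap)
    finally show ?thesis by (simp add: qform_def)
  qed
  then show ?thesis
    using assms by (auto simp: psd_iff_qform intro!: sum_nonneg)
qed

lemma mtrace_msum:
  assumes "\<And>x. x \<in> S \<Longrightarrow> f x \<in> carrier_mat d d"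
  shows "mtrace (msum d S f) = (\<Sum>x\<in>S. mtrace (f x))"
  using assms by (simp add: mtrace_carrier[OF msum_carrier] mtrace_carrier[of _ d] sum.swap[of _ S])

lemma mtrace_mult_commute:
  assumes "A \<in> carrier_mat m n" "B \<in> carrier_mat n m"
  shows "mtrace (A * B) = mtrace (B * A)"
proof -
  have "mtrace (A * B) = (\<Sum>i<m. \<Sum>j<n. A $$ (i, j) * B $$ (j, i))"
    using assms by (simp add: mtrace_def index_mult_mat_sum[OF assms] del: index_mult_mat(1))
  also have "\<dots> = (\<Sum>j<n. \<Sum>i<m. B $$ (j, i) * A $$ (i, j))"
    by (subst sum.swap) (simp add: mult.commute)
  also have "\<dots> = mtrace (B * A)"
    using assms by (simp add: mtrace_def index_mult_mat_sum[OF assms(2,1)] del: index_mult_mat(1))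
  finally show ?thesis .
qed

section \<open>Pauli strings\<close>

lemma UNIV_pauli: "(UNIV :: pauli set) = {PauliI, PauliX, PauliY, PauliZ}"
  using pauli.nchotomy by auto

lemma finite_pauli [simp]: "finite (A :: pauli set)"
  by (rule finite_subset[OF subset_UNIV]) (simp add: UNIV_pauli)

lemma card_pauli_strings: "card (pauli_strings n) = 4 ^ n"
proof -
  have "card (UNIV :: pauli set) = 4" by (simp add: UNIV_pauli)
  then show ?thesis
    using card_lists_length_eq[of "UNIV :: pauli set" n] by (simp add: pauli_strings_def)
qed

lemma finite_pauli_strings [simp]: "finite (pauli_strings n)"
  using finite_lists_length_eq[of "UNIV :: pauli set" n] by (simp add: pauli_strings_def)

lemma pauli_strings_0: "pauli_strings 0 = {[]}"
  by (auto simp: pauli_strings_def)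

lemma sum_pauli_strings_Suc:
  "(\<Sum>P\<in>pauli_strings (Suc n). f P) = (\<Sum>a\<in>UNIV. \<Sum>P\<in>pauli_strings n. f (a # P))"
proof -
  have "(\<Sum>a\<in>UNIV. \<Sum>P\<in>pauli_strings n. f (a # P)) =
      (\<Sum>(a, P)\<in>UNIV \<times> pauli_strings n. f (a # P))"
    by (simp add: sum.cartesian_product)
  also have "\<dots> = (\<Sum>P\<in>pauli_strings (Suc n). f P)"
    by (rule sum.reindex_bij_witness[of _ "\<lambda>P. (hd P, tl P)" "\<lambda>(a, P). a # P"])
       (auto simp: pauli_strings_def length_Suc_conv)
  finally show ?thesis by simp
qed

lemma smult_smult_mat: "a \<cdot>\<^sub>m (b \<cdot>\<^sub>m A) = (a * b :: complex) \<cdot>\<^sub>m A"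
  by (intro eq_matI) auto

lemma pauli_mat_carrier [simp, intro]: "pauli_mat a \<in> carrier_mat 2 2"
  by (cases a) (auto simp: mat_of_rows_list_def)

lemma pauli_op_Cons: "pauli_op (a # P) = kron (pauli_mat a) (pauli_op P)"
  by (simp add: pauli_op_def)

lemma pauli_op_Nil: "pauli_op [] = 1\<^sub>m 1"
  by (simp add: pauli_op_def)

lemma pauli_op_carrier: "P \<in> pauli_strings n \<Longrightarrow> pauli_op P \<in> carrier_mat (2 ^ n) (2 ^ n)"
proof (induction P arbitrary: n)
  case (Cons a P)
  then show ?case
    by (cases n) (auto simp: pauli_strings_def pauli_op_Cons)
qed (auto simp: pauli_strings_def pauli_op_Nil)

lemma eq_mat_2I:
  assumes "A \<in> carrier_mat 2 2" "B \<in> carrier_mat 2 2"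
    "A $$ (0, 0) = B $$ (0, 0)" "A $$ (0, Suc 0) = B $$ (0, Suc 0)"
    "A $$ (Suc 0, 0) = B $$ (Suc 0, 0)" "A $$ (Suc 0, Suc 0) = B $$ (Suc 0, Suc 0)"
  shows "A = B"
  using assms by (intro eq_matI) (auto simp: less_2_cases_iff)

lemma pauli_mat_index:
  "pauli_mat a $$ (0, 0) = (case a of PauliI \<Rightarrow> 1 | PauliX \<Rightarrow> 0 | PauliY \<Rightarrow> 0 | PauliZ \<Rightarrow> 1)"
  "pauli_mat a $$ (0, Suc 0) = (case a of PauliI \<Rightarrow> 0 | PauliX \<Rightarrow> 1 | PauliY \<Rightarrow> - \<i> | PauliZ \<Rightarrow> 0)"
  "pauli_mat a $$ (Suc 0, 0) = (case a of PauliI \<Rightarrow> 0 | PauliX \<Rightarrow> 1 | PauliY \<Rightarrow> \<i> | PauliZ \<Rightarrow> 0)"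
  "pauli_mat a $$ (Suc 0, Suc 0) = (case a of PauliI \<Rightarrow> 1 | PauliX \<Rightarrow> 0 | PauliY \<Rightarrow> 0 | PauliZ \<Rightarrow> - 1)"
  by (cases a; simp add: mat_of_rows_list_def)+

lemma pauli_mat_dim [simp]: "dim_row (pauli_mat a) = 2" "dim_col (pauli_mat a) = 2"
  using carrier_matD[OF pauli_mat_carrier[of a]] by auto

lemma index_mult_mat_2:
  assumes "A \<in> carrier_mat 2 2" "B \<in> carrier_mat 2 2" "i < 2" "j < 2"
  shows "(A * B) $$ (i, j) = A $$ (i, 0) * B $$ (0, j) + A $$ (i, Suc 0) * B $$ (Suc 0, j)"
  using index_mult_mat_sum[OF assms] by (simp add: numeral_2_eq_2)

declare pauli_mat.simps [simp del]

lemma pauli_mat_adjoint: "mat_adjoint (pauli_mat a) = pauli_mat a"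
  by (rule eq_mat_2I) (auto simp: mat_adjoint_index pauli_mat_index split: pauli.split)

text \<open>The sign is 1 when the two matrices commute and -1 when they anticommute.\<close>

fun pauli_sign :: "pauli \<Rightarrow> pauli \<Rightarrow> real" where
  "pauli_sign PauliI b = 1"
| "pauli_sign a PauliI = 1"
| "pauli_sign a b = (if a = b then 1 else - 1)"

lemma pauli_mat_conj: "pauli_mat a * pauli_mat b * pauli_mat a = of_real (pauli_sign a b) \<cdot>\<^sub>m pauli_mat b"
  by (rule eq_mat_2I; cases a; cases b)
     (auto simp: index_mult_mat_2 mult_carrier_mat[of _ 2 2 _ 2] pauli_mat_index simp del: index_mult_mat(1))

lemma pauli_mat_square: "pauli_mat a * pauli_mat a = 1\<^sub>m 2"
  by (rule eq_mat_2I; cases a)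
     (auto simp: index_mult_mat_2 mult_carrier_mat[of _ 2 2 _ 2] pauli_mat_index simp del: index_mult_mat(1))

text \<open>In operator terms, the sum of \<sigma> \<otimes> \<sigma> over the four Pauli matrices
  is twice the swap.\<close>

lemma pauli_mat_orthogonality:
  assumes "i < 2" "j < 2" "k < 2" "l < 2"
  shows "(\<Sum>a\<in>UNIV. pauli_mat a $$ (i, j) * pauli_mat a $$ (k, l)) = (if i = l \<and> j = k then 2 else 0)"
  using assms by (auto simp: UNIV_pauli less_2_cases_iff pauli_mat_index)

lemma mtrace_pauli_mat: "mtrace (pauli_mat a) = (if a = PauliI then 2 else 0)"
  using pauli_mat_index[of a] by (cases a) (auto simp: mtrace_def numeral_2_eq_2)

lemma pauli_op_adjoint: "mat_adjoint (pauli_op P) = pauli_op P"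
  by (induction P) (simp_all add: pauli_op_Nil pauli_op_Cons mat_adjoint_kron pauli_mat_adjoint)

lemma pauli_op_square: "P \<in> pauli_strings n \<Longrightarrow> pauli_op P * pauli_op P = 1\<^sub>m (2 ^ n)"
proof (induction P arbitrary: n)
  case (Cons a P)
  then obtain m where m: "n = Suc m" "P \<in> pauli_strings m" by (cases n) (auto simp: pauli_strings_def)
  then show ?case
    using Cons.IH[OF m(2)] pauli_op_carrier[OF m(2)]
    by (simp add: pauli_op_Cons kron_mult[of _ 2 _ "2 ^ m"] pauli_mat_square kron_one)
qed (auto simp: pauli_strings_def pauli_op_Nil)

definition pauli_string_sign :: "pauli list \<Rightarrow> pauli list \<Rightarrow> real" where
  "pauli_string_sign P Q = (\<Prod>(a, b)\<leftarrow>zip P Q. pauli_sign a b)"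

lemma pauli_op_conj:
  "P \<in> pauli_strings n \<Longrightarrow> Q \<in> pauli_strings n \<Longrightarrow>
    pauli_op P * pauli_op Q * pauli_op P = of_real (pauli_string_sign P Q) \<cdot>\<^sub>m pauli_op Q"
proof (induction n arbitrary: P Q)
  case (Suc n)
  then obtain a P' b Q' where PQ: "P = a # P'" "Q = b # Q'" "P' \<in> pauli_strings n" "Q' \<in> pauli_strings n"
    by (auto simp: pauli_strings_def length_Suc_conv)
  note c = pauli_op_carrier[OF PQ(3)] pauli_op_carrier[OF PQ(4)]
  have "pauli_op P * pauli_op Q * pauli_op P =
      kron (pauli_mat a * pauli_mat b * pauli_mat a) (pauli_op P' * pauli_op Q' * pauli_op P')"
    using c by (simp add: PQ pauli_op_Cons kron_mult[of _ 2 _ "2 ^ n"] mult_carrier_mat[of _ 2 2] mult_carrier_mat[of _ "2 ^ n" "2 ^ n"])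
  then show ?case
    by (simp add: pauli_mat_conj Suc.IH[OF PQ(3,4)] kron_smult_left kron_smult_right PQ(1,2)
      pauli_string_sign_def pauli_op_Cons smult_smult_mat mult.commute)
qed (auto simp: pauli_strings_def pauli_op_Nil pauli_string_sign_def)

lemma abs_pauli_string_sign: "\<bar>pauli_string_sign P Q\<bar> = 1"
proof -
  have "\<bar>pauli_sign a b\<bar> = 1" for a b by (cases a; cases b) auto
  then show ?thesis
    unfolding pauli_string_sign_def
    by (induction P Q rule: list_induct2') (auto simp: abs_mult)
qed

text \<open>The sum factorises over the positions. Where the entry of P is not I, two of the four
  Pauli matrices commute with it and two anticommute, so that factor is 0.\<close>

lemma sum_pauli_string_sign:
  "P \<in> pauli_strings n \<Longrightarrow> P \<noteq> replicate n PauliI \<Longrightarrow>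
    (\<Sum>Q\<in>pauli_strings n. pauli_string_sign P Q) = 0"
proof (induction n arbitrary: P)
  case (Suc n)
  then obtain a P' where P: "P = a # P'" "P' \<in> pauli_strings n"
    by (auto simp: pauli_strings_def length_Suc_conv)
  have "(\<Sum>Q\<in>pauli_strings (Suc n). pauli_string_sign P Q) =
      (\<Sum>b\<in>UNIV. pauli_sign a b) * (\<Sum>Q\<in>pauli_strings n. pauli_string_sign P' Q)"
    by (simp add: sum_pauli_strings_Suc P(1) pauli_string_sign_def sum_product)
  moreover have "(\<Sum>b\<in>UNIV. pauli_sign a b) = 0" if "a \<noteq> PauliI"
    using that by (cases a) (auto simp: UNIV_pauli)
  ultimately show ?case using Suc.IH[OF P(2)] Suc.prems(2) P(1) by (cases "a = PauliI") auto
qed (auto simp: pauli_strings_def)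

lemma mtrace_pauli_op:
  "P \<in> pauli_strings n \<Longrightarrow> P \<noteq> replicate n PauliI \<Longrightarrow> mtrace (pauli_op P) = 0"
proof (induction n arbitrary: P)
  case (Suc n)
  then obtain a P' where P: "P = a # P'" "P' \<in> pauli_strings n"
    by (auto simp: pauli_strings_def length_Suc_conv)
  then show ?case
    using Suc.IH[OF P(2)] Suc.prems(2)
    by (auto simp: pauli_op_Cons mtrace_kron[OF pauli_mat_carrier pauli_op_carrier[OF P(2)]] mtrace_pauli_mat)
qed (auto simp: pauli_strings_def)

text \<open>The sum of Q \<otimes> Q over all strings is 2^n times the swap. Both the twirl and the
  sum over the marginals R_P come from this identity. In the induction \<open>q\<close> is the
  leading bit of an index and \<open>r\<close> the remainder.\<close>

lemma pauli_op_orthogonality: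
  assumes "i < 2 ^ n" "j < 2 ^ n" "k < 2 ^ n" "l < 2 ^ n"
  shows "(\<Sum>P\<in>pauli_strings n. pauli_op P $$ (i, j) * pauli_op P $$ (k, l)) =
    (if i = l \<and> j = k then 2 ^ n else 0)"
  using assms
proof (induction n arbitrary: i j k l)
  case 0
  then show ?case by (simp add: pauli_strings_0 pauli_op_Nil)
next
  case (Suc n)
  let ?m = "2 ^ n :: nat"
  define r where "r i = i mod ?m" for i
  define q where "q i = i div ?m" for i
  have split: "i = q i * ?m + r i" for i unfolding q_def r_def by (rule div_mult_mod_eq[symmetric])
  have r: "r i < ?m" for i by (simp add: r_def)
  have q: "q i < 2" if "i < 2 ^ Suc n" for i
    using that by (simp add: q_def less_mult_imp_div_less)
  have eq: "i = l \<longleftrightarrow> q i = q l \<and> r i = r l" for i l using split by metis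
  have entry: "pauli_op (a # P) $$ (i, j) = pauli_mat a $$ (q i, q j) * pauli_op P $$ (r i, r j)"
    if "P \<in> pauli_strings n" "i < 2 ^ Suc n" "j < 2 ^ Suc n" for a P i j
    using kron_index[OF pauli_mat_carrier pauli_op_carrier[OF that(1)], of "q i" "q j" "r i" "r j" a]
      that(2,3) q r by (simp add: pauli_op_Cons flip: split)
  have "(\<Sum>P\<in>pauli_strings (Suc n). pauli_op P $$ (i, j) * pauli_op P $$ (k, l)) =
    (\<Sum>a\<in>UNIV. pauli_mat a $$ (q i, q j) * pauli_mat a $$ (q k, q l)) *
    (\<Sum>P\<in>pauli_strings n. pauli_op P $$ (r i, r j) * pauli_op P $$ (r k, r l))"
    using Suc.prems by (simp add: sum_pauli_strings_Suc entry sum_product mult_ac)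
  also have "\<dots> = (if i = l \<and> j = k then 2 ^ Suc n else 0)"
    using q[OF Suc.prems(1)] q[OF Suc.prems(2)] q[OF Suc.prems(3)] q[OF Suc.prems(4)]
    by (simp add: pauli_mat_orthogonality Suc.IH r eq[of i l] eq[of j k])
  finally show ?case .
qed

text \<open>In the sum over Q of Q_ik X_kl Q_lj the orthogonality relation forces i = j and k = l,
  so that only the trace of X survives.\<close>

lemma pauli_twirl:
  assumes "X \<in> carrier_mat (2 ^ n) (2 ^ n)" "i < 2 ^ n" "j < 2 ^ n"
  shows "(\<Sum>Q\<in>pauli_strings n. (pauli_op Q * X * pauli_op Q) $$ (i, j)) =
    (if i = j then 2 ^ n * mtrace X else 0)"
proof -
  have "(\<Sum>Q\<in>pauli_strings n. (pauli_op Q * X * pauli_op Q) $$ (i, j)) =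
    (\<Sum>Q\<in>pauli_strings n. \<Sum>l<2^n. \<Sum>k<2^n.
      X $$ (k, l) * (pauli_op Q $$ (i, k) * pauli_op Q $$ (l, j)))"
  proof (rule sum.cong[OF refl])
    fix Q assume "Q \<in> pauli_strings n"
    note Q = pauli_op_carrier[OF this]
    show "(pauli_op Q * X * pauli_op Q) $$ (i, j) = (\<Sum>l<2^n. \<Sum>k<2^n.
        X $$ (k, l) * (pauli_op Q $$ (i, k) * pauli_op Q $$ (l, j)))"
      using assms Q
      by (subst index_mult_mat_sum[of _ "2^n" "2^n" _ "2^n"])
        (auto simp: index_mult_mat_sum[of _ "2^n" "2^n" X "2^n"] sum_distrib_right sum_distrib_left mult_ac
          simp del: index_mult_mat(1) intro!: sum.cong)
  qed
  also have "\<dots> = (\<Sum>l<2^n. \<Sum>k<2^n. X $$ (k, l) *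
      (\<Sum>Q\<in>pauli_strings n. pauli_op Q $$ (i, k) * pauli_op Q $$ (l, j)))"
    by (simp add: sum_distrib_left sum.swap[of _ _ "pauli_strings n"])
  also have "\<dots> = (\<Sum>l<2^n. \<Sum>k<2^n. if k = l then (if i = j then X $$ (k, l) * 2 ^ n else 0) else 0)"
    using assms by (intro sum.cong refl) (auto simp: pauli_op_orthogonality)
  also have "\<dots> = (if i = j then 2 ^ n * mtrace X else 0)"
    by (simp add: sum_distrib_left mtrace_carrier[OF assms(1)] mult.commute)
  finally show ?thesis .
qed

section \<open>Pauli channels\<close>

lemma pauli_channel_carrier [simp, intro]: "pauli_channel n p X \<in> carrier_mat (2 ^ n) (2 ^ n)"
  by (simp add: pauli_channel_def)

lemma pauli_channel_index:
  assumes "i < 2 ^ n" "j < 2 ^ n"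
  shows "pauli_channel n p X $$ (i, j) =
    (\<Sum>Q\<in>pauli_strings n. of_real (p Q) * (pauli_op Q * X * pauli_op Q) $$ (i, j))"
proof -
  have "pauli_op Q * X * pauli_op Q \<in> carrier_mat (2 ^ n) (2 ^ n)" if "Q \<in> pauli_strings n" for Q
    using carrier_matD[OF pauli_op_carrier[OF that]] by (intro carrier_matI) auto
  then show ?thesis
    unfolding pauli_channel_def msum_index[OF assms]
    using assms by (intro sum.cong refl smult_mat_index)
qed

lemma pauli_channel_dim [simp]:
  "dim_row (pauli_channel n p X) = 2 ^ n" "dim_col (pauli_channel n p X) = 2 ^ n"
  using carrier_matD[OF pauli_channel_carrier] by auto

section \<open>The test channels\<close>

definition uniform_pauli :: "nat \<Rightarrow> pauli list \<Rightarrow> real" where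
  "uniform_pauli n Q = 1 / 4 ^ n"

text \<open>The signs are the characters that relate Pauli probabilities to Pauli eigenvalues. For a
  nonidentity P this is the inverse transform of the spectrum with 1 at the identity, a at P and 0
  elsewhere.\<close>

definition biased_pauli :: "nat \<Rightarrow> real \<Rightarrow> pauli list \<Rightarrow> pauli list \<Rightarrow> real" where
  "biased_pauli n a P Q = (1 + a * pauli_string_sign P Q) / 4 ^ n"

lemma pauli_distribution_uniform: "pauli_distribution n (uniform_pauli n)"
  by (simp add: pauli_distribution_def uniform_pauli_def card_pauli_strings)

lemma pauli_distribution_biased:
  assumes "P \<in> pauli_strings n" "P \<noteq> replicate n PauliI" "\<bar>a\<bar> \<le> 1"
  shows "pauli_distribution n (biased_pauli n a P)"
proof -
  have "0 \<le> 1 + a * pauli_string_sign P Q" for Q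
  proof -
    have "\<bar>a * pauli_string_sign P Q\<bar> \<le> 1"
      using assms(3) by (simp add: abs_mult abs_pauli_string_sign)
    then show ?thesis by linarith
  qed
  moreover have "(\<Sum>Q\<in>pauli_strings n. 1 + a * pauli_string_sign P Q) = 4 ^ n"
    using sum_pauli_string_sign[OF assms(1,2)]
    by (simp add: sum.distrib card_pauli_strings flip: sum_distrib_left)
  ultimately show ?thesis
    by (simp add: pauli_distribution_def biased_pauli_def flip: sum_divide_distrib)
qed

lemma pow_4: "(4::'a::comm_semiring_1) ^ n = 2 ^ n * 2 ^ n"
  by (simp flip: power_mult_distrib)

lemma pauli_channel_uniform_index:
  assumes "X \<in> carrier_mat (2 ^ n) (2 ^ n)" "i < 2 ^ n" "j < 2 ^ n"
  shows "pauli_channel n (uniform_pauli n) X $$ (i, j) = (if i = j then mtrace X / 2 ^ n else 0)"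
  using pauli_twirl[OF assms]
  by (simp add: pauli_channel_index[OF assms(2,3)] uniform_pauli_def pow_4 flip: sum_divide_distrib)

text \<open>The signs turn the twirl of \<open>X\<close> into the twirl of \<open>P X\<close>, because
  \<open>pauli_string_sign P Q\<close> times \<open>Q\<close> equals \<open>P Q P\<close>.\<close>

lemma pauli_channel_biased_index:
  assumes P: "P \<in> pauli_strings n" and X: "X \<in> carrier_mat (2 ^ n) (2 ^ n)"
    and ij: "i < 2 ^ n" "j < 2 ^ n"
  shows "pauli_channel n (biased_pauli n a P) X $$ (i, j) =
    pauli_channel n (uniform_pauli n) X $$ (i, j) +
    of_real a / 2 ^ n * mtrace (pauli_op P * X) * pauli_op P $$ (i, j)"
proof -
  let ?d = "2 ^ n :: nat"
  note PC = pauli_op_carrier[OF P]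
  have PX: "pauli_op P * X \<in> carrier_mat ?d ?d" using PC X by simp
  have "of_real (pauli_string_sign P Q) * (pauli_op Q * X * pauli_op Q) $$ (i, j) =
      (\<Sum>k<?d. pauli_op P $$ (i, k) * (pauli_op Q * (pauli_op P * X) * pauli_op Q) $$ (k, j))"
    if Q: "Q \<in> pauli_strings n" for Q
  proof -
    note QC = pauli_op_carrier[OF Q]
    note [simp] = assoc_mult_mat[of _ ?d ?d _ ?d _ ?d] mult_carrier_mat[of _ ?d ?d _ ?d]
    have "of_real (pauli_string_sign P Q) * (pauli_op Q * X * pauli_op Q) $$ (i, j) =
        (of_real (pauli_string_sign P Q) \<cdot>\<^sub>m pauli_op Q * (X * pauli_op Q)) $$ (i, j)"
      using X QC ij by (subst mult_smult_assoc_mat[of _ ?d ?d _ ?d]) auto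
    also have "\<dots> = (pauli_op P * (pauli_op Q * (pauli_op P * X) * pauli_op Q)) $$ (i, j)"
      unfolding pauli_op_conj[OF P Q, symmetric] using X PC QC by simp
    also have "\<dots> = (\<Sum>k<?d. pauli_op P $$ (i, k) * (pauli_op Q * (pauli_op P * X) * pauli_op Q) $$ (k, j))"
      using X PC QC ij by (intro index_mult_mat_sum[of _ ?d _ _ ?d]) auto
    finally show ?thesis .
  qed
  then have "(\<Sum>Q\<in>pauli_strings n. of_real (pauli_string_sign P Q) * (pauli_op Q * X * pauli_op Q) $$ (i, j)) =
      (\<Sum>k<?d. pauli_op P $$ (i, k) *
        (\<Sum>Q\<in>pauli_strings n. (pauli_op Q * (pauli_op P * X) * pauli_op Q) $$ (k, j)))"
    by (simp add: sum_distrib_left sum.swap[of _ _ "pauli_strings n"])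
  also have "\<dots> = pauli_op P $$ (i, j) * (2 ^ n * mtrace (pauli_op P * X))"
    using ij by (simp add: pauli_twirl[OF PX] if_distrib[of "\<lambda>x. _ * x"] cong: if_cong)
  finally have sgn: "(\<Sum>Q\<in>pauli_strings n. of_real (pauli_string_sign P Q) *
      (pauli_op Q * X * pauli_op Q) $$ (i, j)) = pauli_op P $$ (i, j) * (2 ^ n * mtrace (pauli_op P * X))" .
  have "pauli_channel n (biased_pauli n a P) X $$ (i, j) =
    pauli_channel n (uniform_pauli n) X $$ (i, j) + of_real a / 4 ^ n *
    (\<Sum>Q\<in>pauli_strings n. of_real (pauli_string_sign P Q) * (pauli_op Q * X * pauli_op Q) $$ (i, j))"
    by (simp add: pauli_channel_index[OF ij] biased_pauli_def uniform_pauli_def add_divide_distrib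
      sum_distrib_left algebra_simps sum.distrib)
  then show ?thesis by (simp add: sgn pow_4 field_simps)
qed

lemma pauli_eigenvalueI:
  assumes P: "P \<in> pauli_strings n" and "pauli_channel n p (pauli_op P) = of_real l \<cdot>\<^sub>m pauli_op P"
  shows "pauli_eigenvalue n p P = l"
  unfolding pauli_eigenvalue_def
proof (rule the_equality)
  fix l' assume "pauli_channel n p (pauli_op P) = of_real l' \<cdot>\<^sub>m pauli_op P"
  \<comment> \<open>Since P squares to 1, right multiplication by P turns both sides into multiples
    of the identity, and the eigenvalue can be read off one entry.\<close>
  then have "of_real l \<cdot>\<^sub>m pauli_op P * pauli_op P = of_real l' \<cdot>\<^sub>m pauli_op P * pauli_op P"
    using assms(2) by simp
  then have "of_real l \<cdot>\<^sub>m 1\<^sub>m (2 ^ n) = (of_real l' \<cdot>\<^sub>m 1\<^sub>m (2 ^ n) :: complex mat)"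
    using pauli_op_carrier[OF P] by (simp add: mult_smult_assoc_mat[of _ "2^n" "2^n" _ "2^n"] pauli_op_square[OF P])
  then have "(of_real l \<cdot>\<^sub>m 1\<^sub>m (2 ^ n)) $$ (0, 0) = (of_real l' \<cdot>\<^sub>m 1\<^sub>m (2 ^ n) :: complex mat) $$ (0, 0)"
    by simp
  then show "l' = l" by simp
qed (rule assms(2))

lemma pauli_eigenvalue_uniform:
  assumes "P \<in> pauli_strings n" "P \<noteq> replicate n PauliI"
  shows "pauli_eigenvalue n (uniform_pauli n) P = 0"
  using pauli_op_carrier[OF assms(1)] mtrace_pauli_op[OF assms]
  by (intro pauli_eigenvalueI[OF assms(1)] eq_matI)
     (auto simp: pauli_channel_uniform_index)

lemma pauli_eigenvalue_biased:
  assumes "P \<in> pauli_strings n" "P \<noteq> replicate n PauliI"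
  shows "pauli_eigenvalue n (biased_pauli n a P) P = a"
  using pauli_op_carrier[OF assms(1)] mtrace_pauli_op[OF assms]
  by (intro pauli_eigenvalueI[OF assms(1)] eq_matI)
     (auto simp: pauli_channel_biased_index[OF assms(1)] pauli_channel_uniform_index
       pauli_op_square[OF assms(1)])

section \<open>Pauli channels acting on one tensor factor\<close>

definition pauli_on :: "nat \<Rightarrow> nat \<Rightarrow> pauli list \<Rightarrow> complex mat" where
  "pauli_on l r Q = kron (kron (1\<^sub>m l) (pauli_op Q)) (1\<^sub>m r)"

lemma pauli_on_carrier [simp, intro]:
  "Q \<in> pauli_strings n \<Longrightarrow> pauli_on l r Q \<in> carrier_mat (l * 2 ^ n * r) (l * 2 ^ n * r)"
  unfolding pauli_on_def by (intro kron_carrier pauli_op_carrier one_carrier_mat)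

lemma pauli_on_adjoint: "mat_adjoint (pauli_on l r Q) = pauli_on l r Q"
  by (simp add: pauli_on_def mat_adjoint_kron pauli_op_adjoint)

lemma pauli_on_square:
  assumes "Q \<in> pauli_strings n"
  shows "pauli_on l r Q * pauli_on l r Q = 1\<^sub>m (l * 2 ^ n * r)"
  using pauli_op_carrier[OF assms]
  by (simp add: pauli_on_def kron_mult[of _ "l * 2 ^ n" _ r] kron_mult[of _ l _ "2 ^ n"]
    kron_carrier pauli_op_square[OF assms] kron_one)

lemma triple_index_less:
  fixes a b c l m r :: nat
  assumes "a < l" "b < m" "c < r"
  shows "(a * m + b) * r + c < l * m * r"
  using assms by (intro prod_index_less)

lemma eq_mat_tripleI:
  assumes "A \<in> carrier_mat (l * m * r) (l * m * r)" "B \<in> carrier_mat (l * m * r) (l * m * r)"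
    and "\<And>a b c a' b' c'. a < l \<Longrightarrow> a' < l \<Longrightarrow> b < m \<Longrightarrow> b' < m \<Longrightarrow> c < r \<Longrightarrow> c' < r \<Longrightarrow>
      A $$ ((a * m + b) * r + c, (a' * m + b') * r + c') = B $$ ((a * m + b) * r + c, (a' * m + b') * r + c')"
  shows "A = B"
proof (rule eq_mat_prodI[OF assms(1,2)])
  fix x c x' c' assume *: "x < l * m" "x' < l * m" "c < r" "c' < r"
  then have "m > 0" by (cases m) auto
  then show "A $$ (x * r + c, x' * r + c') = B $$ (x * r + c, x' * r + c')"
    using assms(3)[of "x div m" "x' div m" "x mod m" "x' mod m" c c'] *
    by (simp add: less_mult_imp_div_less)
qed

lemma local_map_carrier [simp, intro]: "local_map l r d e \<Phi> X \<in> carrier_mat (l * e * r) (l * e * r)"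
  by (simp add: local_map_def)

lemma local_map_index:
  assumes "a < l" "a' < l" "b < e" "b' < e" "c < r" "c' < r"
  shows "local_map l r d e \<Phi> X $$ ((a * e + b) * r + c, (a' * e + b') * r + c') =
    \<Phi> (mat d d (\<lambda>(s, t). X $$ ((a * d + s) * r + c, (a' * d + t) * r + c'))) $$ (b, b')"
proof -
  have "((x * e + y) * r + z) div (e * r) = x" "((x * e + y) * r + z) div r mod e = y"
    if "y < e" "z < r" for x y z
  proof -
    have "(x * e + y) * r + z = x * (e * r) + (y * r + z)" by (simp add: algebra_simps)
    then show "((x * e + y) * r + z) div (e * r) = x"
      using prod_index_div[OF prod_index_less[OF that], of x] by (simp only:)
  qed (use that in simp)
  then show ?thesis
    using assms triple_index_less[of a l b e c r] triple_index_less[of a' l b' e c' r]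
    by (simp add: local_map_def)
qed

lemma pauli_on_index:
  assumes "Q \<in> pauli_strings n" "a < l" "a' < l" "b < 2 ^ n" "b' < 2 ^ n" "c < r" "c' < r"
  shows "pauli_on l r Q $$ ((a * 2 ^ n + b) * r + c, (a' * 2 ^ n + b') * r + c') =
    (if a = a' \<and> c = c' then pauli_op Q $$ (b, b') else 0)"
  using assms pauli_op_carrier[OF assms(1)] prod_index_less[of a l b "2 ^ n"] prod_index_less[of a' l b' "2 ^ n"]
  by (simp add: pauli_on_def kron_index[of _ "l * 2 ^ n" "l * 2 ^ n" _ r r] kron_index[of _ l l _ "2 ^ n" "2 ^ n"] kron_carrier)

text \<open>The blockwise extension becomes a Kraus sum with the operators 1 \<otimes> Q \<otimes>
  1. Positivity, trace preservation and linearity of the extended channel are read off from this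
  form.\<close>

lemma local_map_pauli_channel:
  assumes X: "X \<in> carrier_mat (l * 2 ^ n * r) (l * 2 ^ n * r)"
  shows "local_map l r (2 ^ n) (2 ^ n) (pauli_channel n p) X =
    msum (l * 2 ^ n * r) (pauli_strings n) (\<lambda>Q. of_real (p Q) \<cdot>\<^sub>m (pauli_on l r Q * X * pauli_on l r Q))"
proof (rule eq_mat_tripleI)
  let ?d = "2 ^ n :: nat"
  fix a b c a' b' c' :: nat
  assume *: "a < l" "a' < l" "b < ?d" "b' < ?d" "c < r" "c' < r"
  define i where "i = (a * ?d + b) * r + c"
  define j where "j = (a' * ?d + b') * r + c'"
  have ij: "i < l * ?d * r" "j < l * ?d * r"
    unfolding i_def j_def by (intro triple_index_less *)+
  let ?Y = "mat ?d ?d (\<lambda>(s, t). X $$ ((a * ?d + s) * r + c, (a' * ?d + t) * r + c'))"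
  have eq: "(pauli_op Q * ?Y * pauli_op Q) $$ (b, b') = (pauli_on l r Q * X * pauli_on l r Q) $$ (i, j)"
    if Q: "Q \<in> pauli_strings n" for Q
  proof -
    note U = pauli_on_carrier[OF Q, of l r] and QC = pauli_op_carrier[OF Q]
    have left: "(pauli_on l r Q * X) $$ (i, y) = (\<Sum>s<?d. pauli_op Q $$ (b, s) * X $$ ((a * ?d + s) * r + c, y))"
      if "y < l * ?d * r" for y
    proof -
      have "(pauli_on l r Q * X) $$ (i, y) = (\<Sum>x<l. \<Sum>s<?d. \<Sum>z<r.
          if a = x then (if c = z then pauli_op Q $$ (b, s) * X $$ ((x * ?d + s) * r + z, y) else 0) else 0)"
        unfolding index_mult_mat_sum[OF U X ij(1) that] sum_lessThan_mult
        unfolding i_def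
        by (intro sum.cong refl) (simp add: pauli_on_index[OF Q] *)
      also have "\<dots> = (\<Sum>x<l. if a = x then
          (\<Sum>s<?d. pauli_op Q $$ (b, s) * X $$ ((x * ?d + s) * r + c, y)) else 0)"
        using * by (intro sum.cong refl) simp
      finally show ?thesis using * by simp
    qed
    have "(pauli_on l r Q * X * pauli_on l r Q) $$ (i, j) = (\<Sum>x<l. \<Sum>t<?d. \<Sum>z<r.
        if a' = x then (if c' = z then (pauli_on l r Q * X) $$ (i, (x * ?d + t) * r + z) * pauli_op Q $$ (t, b') else 0) else 0)"
      unfolding index_mult_mat_sum[OF mult_carrier_mat[OF U X] U ij] sum_lessThan_mult
      unfolding j_def
      by (intro sum.cong refl) (auto simp: pauli_on_index[OF Q] *)
    also have "\<dots> = (\<Sum>x<l. if a' = x then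
        (\<Sum>t<?d. (pauli_on l r Q * X) $$ (i, (x * ?d + t) * r + c') * pauli_op Q $$ (t, b')) else 0)"
      using * by (intro sum.cong refl) simp
    also have "\<dots> = (\<Sum>t<?d. (pauli_on l r Q * X) $$ (i, (a' * ?d + t) * r + c') * pauli_op Q $$ (t, b'))"
      using * by simp
    also have "\<dots> = (\<Sum>t<?d. (\<Sum>s<?d. pauli_op Q $$ (b, s) *
        X $$ ((a * ?d + s) * r + c, (a' * ?d + t) * r + c')) * pauli_op Q $$ (t, b'))"
      using * by (intro sum.cong refl arg_cong2[of _ _ _ _ "(*)"] left triple_index_less) auto
    also have "\<dots> = (\<Sum>t<?d. (pauli_op Q * ?Y) $$ (b, t) * pauli_op Q $$ (t, b'))"
      using * QC by (intro sum.cong refl arg_cong2[of _ _ _ _ "(*)"])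
        (subst index_mult_mat_sum[of _ ?d ?d _ ?d], auto)
    also have "\<dots> = (pauli_op Q * ?Y * pauli_op Q) $$ (b, b')"
      using * QC by (subst index_mult_mat_sum[of "pauli_op Q * ?Y" ?d ?d _ ?d])
        (auto intro!: mult_carrier_mat[of _ ?d ?d] simp del: index_mult_mat(1))
    finally show ?thesis by simp
  qed
  have "local_map l r ?d ?d (pauli_channel n p) X $$ (i, j) =
      (\<Sum>Q\<in>pauli_strings n. of_real (p Q) * (pauli_op Q * ?Y * pauli_op Q) $$ (b, b'))"
    unfolding i_def j_def using * by (simp add: local_map_index pauli_channel_index del: index_mult_mat(1))
  also have "\<dots> = (\<Sum>Q\<in>pauli_strings n. (of_real (p Q) \<cdot>\<^sub>m (pauli_on l r Q * X * pauli_on l r Q)) $$ (i, j))"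
  proof (intro sum.cong refl)
    fix Q assume Q: "Q \<in> pauli_strings n"
    have "pauli_on l r Q * X * pauli_on l r Q \<in> carrier_mat (l * ?d * r) (l * ?d * r)"
      using pauli_on_carrier[OF Q, of l r] X by (meson mult_carrier_mat)
    then show "of_real (p Q) * (pauli_op Q * ?Y * pauli_op Q) $$ (b, b') =
        (of_real (p Q) \<cdot>\<^sub>m (pauli_on l r Q * X * pauli_on l r Q)) $$ (i, j)"
      using ij by (simp only: eq[OF Q]) (auto dest!: carrier_matD simp del: index_mult_mat)
  qed
  finally show "local_map l r ?d ?d (pauli_channel n p) X $$ ((a * ?d + b) * r + c, (a' * ?d + b') * r + c') =
      msum (l * ?d * r) (pauli_strings n) (\<lambda>Q. of_real (p Q) \<cdot>\<^sub>m (pauli_on l r Q * X * pauli_on l r Q))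
        $$ ((a * ?d + b) * r + c, (a' * ?d + b') * r + c')"
    unfolding i_def[symmetric] j_def[symmetric] using ij by simp
qed auto

lemma psd_local_map_pauli_channel:
  assumes "psd (l * 2 ^ n * r) X" "pauli_distribution n p"
  shows "psd (l * 2 ^ n * r) (local_map l r (2 ^ n) (2 ^ n) (pauli_channel n p) X)"
  unfolding local_map_pauli_channel[OF psd_carrier[OF assms(1)]]
proof (intro psd_msum psd_smult)
  fix Q assume Q: "Q \<in> pauli_strings n"
  show "psd (l * 2 ^ n * r) (pauli_on l r Q * X * pauli_on l r Q)"
    using psd_conj[OF assms(1) pauli_on_carrier[OF Q]] by (simp add: pauli_on_adjoint)
  show "0 \<le> complex_of_real (p Q)"
    using assms(2) Q by (simp add: pauli_distribution_def less_eq_complex_def)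
qed

lemma mtrace_local_map_pauli_channel:
  assumes X: "X \<in> carrier_mat (l * 2 ^ n * r) (l * 2 ^ n * r)" and "pauli_distribution n p"
  shows "mtrace (local_map l r (2 ^ n) (2 ^ n) (pauli_channel n p) X) = mtrace X"
proof -
  let ?N = "l * 2 ^ n * r"
  have C: "pauli_on l r Q * X * pauli_on l r Q \<in> carrier_mat ?N ?N"
    and T: "mtrace (pauli_on l r Q * X * pauli_on l r Q) = mtrace X" if Q: "Q \<in> pauli_strings n" for Q
  proof -
    note U = pauli_on_carrier[OF Q, of l r]
    show "pauli_on l r Q * X * pauli_on l r Q \<in> carrier_mat ?N ?N"
      using U X by (meson mult_carrier_mat)
    have "mtrace (pauli_on l r Q * X * pauli_on l r Q) = mtrace (pauli_on l r Q * (pauli_on l r Q * X))"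
      by (rule mtrace_mult_commute[OF mult_carrier_mat[OF U X] U])
    also have "pauli_on l r Q * (pauli_on l r Q * X) = X"
      using X by (simp add: assoc_mult_mat[OF U U X, symmetric] pauli_on_square[OF Q])
    finally show "mtrace (pauli_on l r Q * X * pauli_on l r Q) = mtrace X" .
  qed
  have "mtrace (local_map l r (2 ^ n) (2 ^ n) (pauli_channel n p) X) =
      (\<Sum>Q\<in>pauli_strings n. of_real (p Q) * mtrace X)"
    unfolding local_map_pauli_channel[OF X]
    by (subst mtrace_msum) (auto simp: C T mtrace_smult[OF C] intro!: sum.cong)
  also have "\<dots> = of_real (\<Sum>Q\<in>pauli_strings n. p Q) * mtrace X"
    by (simp add: sum_distrib_right)
  also have "(\<Sum>Q\<in>pauli_strings n. p Q) = 1"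
    using assms(2) by (simp add: pauli_distribution_def)
  finally show ?thesis by simp
qed

lemma linear_map_local_map_pauli_channel:
  "linear_map (l * 2 ^ n * r) (l * 2 ^ n * r) (local_map l r (2 ^ n) (2 ^ n) (pauli_channel n p))"
proof -
  let ?N = "l * 2 ^ n * r"
  have add: "pauli_on l r Q * (X + Y) * pauli_on l r Q =
      pauli_on l r Q * X * pauli_on l r Q + pauli_on l r Q * Y * pauli_on l r Q"
    and smult: "pauli_on l r Q * (c \<cdot>\<^sub>m X) * pauli_on l r Q = c \<cdot>\<^sub>m (pauli_on l r Q * X * pauli_on l r Q)"
    and C: "pauli_on l r Q * X * pauli_on l r Q \<in> carrier_mat ?N ?N"
    if Q: "Q \<in> pauli_strings n" and X: "X \<in> carrier_mat ?N ?N" and Y: "Y \<in> carrier_mat ?N ?N" for Q X Y c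
  proof -
    note U = pauli_on_carrier[OF Q, of l r]
    show "pauli_on l r Q * (X + Y) * pauli_on l r Q =
      pauli_on l r Q * X * pauli_on l r Q + pauli_on l r Q * Y * pauli_on l r Q"
      using mult_add_distrib_mat[OF U X Y] add_mult_distrib_mat[OF mult_carrier_mat[OF U X] mult_carrier_mat[OF U Y] U]
      by simp
    show "pauli_on l r Q * (c \<cdot>\<^sub>m X) * pauli_on l r Q = c \<cdot>\<^sub>m (pauli_on l r Q * X * pauli_on l r Q)"
      using mult_smult_distrib[OF U X] mult_smult_assoc_mat[OF mult_carrier_mat[OF U X] U] by simp
    show "pauli_on l r Q * X * pauli_on l r Q \<in> carrier_mat ?N ?N"
      using U X by (meson mult_carrier_mat)
  qed
  show ?thesis
    unfolding linear_map_def
  proof (intro conjI ballI allI)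
    fix X Y :: "complex mat" and c assume X: "X \<in> carrier_mat ?N ?N"
    show "local_map l r (2 ^ n) (2 ^ n) (pauli_channel n p) X \<in> carrier_mat ?N ?N" by simp
    show "local_map l r (2 ^ n) (2 ^ n) (pauli_channel n p) (c \<cdot>\<^sub>m X) =
        c \<cdot>\<^sub>m local_map l r (2 ^ n) (2 ^ n) (pauli_channel n p) X"
      using X C[OF _ X X]
      by (simp add: local_map_pauli_channel smult[OF _ X X] smult_smult_mat mult.commute
        cong: msum_cong flip: msum_smult)
    assume Y: "Y \<in> carrier_mat ?N ?N"
    show "local_map l r (2 ^ n) (2 ^ n) (pauli_channel n p) (X + Y) =
        local_map l r (2 ^ n) (2 ^ n) (pauli_channel n p) X + local_map l r (2 ^ n) (2 ^ n) (pauli_channel n p) Y"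
      using X Y C[OF _ X X] C[OF _ Y Y]
      by (simp add: local_map_pauli_channel add[OF _ X Y] add_smult_distrib_left_mat[OF C[OF _ X X] C[OF _ Y Y]]
        cong: msum_cong flip: msum_add)
  qed
qed

text \<open>On each block Y obtained by fixing the outer indices, the two channels differ by
  \<alpha> / 2^n Tr (P Y) P; the double sum is that trace.\<close>

lemma local_map_biased_minus_uniform_index:
  assumes P: "P \<in> pauli_strings n"
    and *: "a < l" "a' < l" "b < 2 ^ n" "b' < 2 ^ n" "c < r" "c' < r"
  shows "local_map l r (2 ^ n) (2 ^ n) (pauli_channel n (biased_pauli n \<alpha> P)) X
        $$ ((a * 2 ^ n + b) * r + c, (a' * 2 ^ n + b') * r + c') =
      local_map l r (2 ^ n) (2 ^ n) (pauli_channel n (uniform_pauli n)) X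
        $$ ((a * 2 ^ n + b) * r + c, (a' * 2 ^ n + b') * r + c') +
      of_real \<alpha> / 2 ^ n * pauli_op P $$ (b, b') *
        (\<Sum>s<2^n. \<Sum>t<2^n. pauli_op P $$ (s, t) * X $$ ((a * 2 ^ n + t) * r + c, (a' * 2 ^ n + s) * r + c'))"
proof -
  let ?Y = "mat (2 ^ n) (2 ^ n) (\<lambda>(s, t). X $$ ((a * 2 ^ n + s) * r + c, (a' * 2 ^ n + t) * r + c'))"
  have "mtrace (pauli_op P * ?Y) =
      (\<Sum>s<2^n. \<Sum>t<2^n. pauli_op P $$ (s, t) * X $$ ((a * 2 ^ n + t) * r + c, (a' * 2 ^ n + s) * r + c'))"
    using pauli_op_carrier[OF P]
    by (simp add: mtrace_carrier[of _ "2 ^ n"] mult_carrier_mat[of _ "2 ^ n" "2 ^ n"]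
      index_mult_mat_sum[of _ "2 ^ n" "2 ^ n" _ "2 ^ n"] del: index_mult_mat(1))
  then show ?thesis
    using * by (simp add: local_map_index pauli_channel_biased_index[OF P])
qed

section \<open>Consequences of the reduction criterion\<close>

lemma ptrace_left_index:
  "i < m \<Longrightarrow> j < m \<Longrightarrow> ptrace_left d m X $$ (i, j) = (\<Sum>s<d. X $$ (s * m + i, s * m + j))"
  by (simp add: ptrace_left_def)

lemma ptrace_left_minus:
  assumes "X \<in> carrier_mat (d * m) (d * m)" "Y \<in> carrier_mat (d * m) (d * m)"
  shows "ptrace_left d m (X - Y) = ptrace_left d m X - ptrace_left d m Y"
  using assms prod_index_less[of _ d _ m]
  by (intro eq_matI) (auto simp: ptrace_left_def sum_subtractf)

text \<open>This is R_P = Tr_S ((P \<otimes> 1) X), with S as the leading factor of the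
  index.\<close>

definition pauli_marginal :: "nat \<Rightarrow> nat \<Rightarrow> pauli list \<Rightarrow> complex mat \<Rightarrow> complex mat" where
  "pauli_marginal n m P X = mat m m (\<lambda>(i, j).
     \<Sum>s<2^n. \<Sum>t<2^n. pauli_op P $$ (s, t) * X $$ (t * m + i, s * m + j))"

lemma pauli_marginal_carrier [simp, intro]: "pauli_marginal n m P X \<in> carrier_mat m m"
  by (simp add: pauli_marginal_def)

lemma pauli_marginal_dim [simp]:
  "dim_row (pauli_marginal n m P X) = m" "dim_col (pauli_marginal n m P X) = m"
  by (simp_all add: pauli_marginal_def)

lemma pauli_marginal_adjoint:
  assumes "psd (2 ^ n * m) X" "P \<in> pauli_strings n"
  shows "mat_adjoint (pauli_marginal n m P X) = pauli_marginal n m P X"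
proof (rule eq_matI)
  fix i j assume "i < dim_row (pauli_marginal n m P X)" "j < dim_col (pauli_marginal n m P X)"
  then have ij: "i < m" "j < m" by auto
  have X: "cnj (X $$ (x, y)) = X $$ (y, x)" if "x < 2 ^ n * m" "y < 2 ^ n * m" for x y
    using psd_adjoint[OF assms(1)] psd_carrier[OF assms(1)] that mat_adjoint_index[of y X x] by auto
  have P: "cnj (pauli_op P $$ (s, t)) = pauli_op P $$ (t, s)" if "s < 2 ^ n" "t < 2 ^ n" for s t
    using pauli_op_adjoint[of P] pauli_op_carrier[OF assms(2)] that mat_adjoint_index[of t "pauli_op P" s] by auto
  have "mat_adjoint (pauli_marginal n m P X) $$ (i, j) =
      (\<Sum>s<2^n. \<Sum>t<2^n. pauli_op P $$ (t, s) * X $$ (s * m + i, t * m + j))"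
    using ij by (simp add: mat_adjoint_index pauli_marginal_def X P prod_index_less)
  also have "\<dots> = pauli_marginal n m P X $$ (i, j)"
    using ij by (subst sum.swap) (simp add: pauli_marginal_def)
  finally show "mat_adjoint (pauli_marginal n m P X) $$ (i, j) = pauli_marginal n m P X $$ (i, j)" .
qed auto

text \<open>Orthogonality of the Pauli strings joins the two pairs of S-indices crosswise (s = t', t
  = s'), so the two traces over S merge into one contraction of X with X.\<close>

lemma sum_pauli_marginal_products:
  assumes "i < m" "j < m" "k < m" "l < m"
  shows "(\<Sum>P\<in>pauli_strings n. pauli_marginal n m P X $$ (i, k) * pauli_marginal n m P X $$ (l, j)) =
    2 ^ n * (\<Sum>s<2^n. \<Sum>t<2^n. X $$ (t * m + i, s * m + k) * X $$ (s * m + l, t * m + j))"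
proof -
  let ?x = "\<lambda>s t. X $$ (t * m + i, s * m + k)" and ?y = "\<lambda>s t. X $$ (t * m + l, s * m + j)"
  have "(\<Sum>P\<in>pauli_strings n. pauli_marginal n m P X $$ (i, k) * pauli_marginal n m P X $$ (l, j)) =
      (\<Sum>P\<in>pauli_strings n. \<Sum>s'<2^n. \<Sum>t'<2^n. \<Sum>s<2^n. \<Sum>t<2^n.
        ?x s t * ?y s' t' * (pauli_op P $$ (s, t) * pauli_op P $$ (s', t')))"
    using assms
    by (simp add: pauli_marginal_def sum_distrib_left sum_distrib_right, intro sum.cong refl)
      (simp add: mult_ac)
  also have "\<dots> = (\<Sum>s'<2^n. \<Sum>t'<2^n. \<Sum>s<2^n. \<Sum>t<2^n.
        ?x s t * ?y s' t' * (\<Sum>P\<in>pauli_strings n. pauli_op P $$ (s, t) * pauli_op P $$ (s', t')))"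
    by (simp add: sum_distrib_left sum.swap[of _ _ "pauli_strings n"])
  also have "\<dots> = (\<Sum>s'<2^n. \<Sum>t'<2^n. \<Sum>s<2^n. \<Sum>t<2^n.
        if s = t' then (if t = s' then ?x s t * ?y s' t' * 2 ^ n else 0) else 0)"
    by (intro sum.cong refl) (simp add: pauli_op_orthogonality)
  also have "\<dots> = (\<Sum>s'<2^n. \<Sum>t'<2^n. \<Sum>s<2^n. if s = t' then ?x s s' * ?y s' t' * 2 ^ n else 0)"
    by (intro sum.cong refl) simp
  also have "\<dots> = (\<Sum>s'<2^n. \<Sum>t'<2^n. ?x t' s' * ?y s' t' * 2 ^ n)"
    by simp
  also have "\<dots> = (\<Sum>s<2^n. \<Sum>t<2^n. ?x s t * ?y t s * 2 ^ n)"
    by (rule sum.swap)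
  finally show ?thesis by (simp add: sum_distrib_left mult_ac)
qed

text \<open>After the sum over P the S-indices of the two copies of X are contracted as in an
  ordinary product followed by the trace over S, and G joins the A-indices in between. All 4^n
  strings are summed, the identity included.\<close>

lemma msum_pauli_marginal_sandwich:
  assumes X: "X \<in> carrier_mat (2 ^ n * m) (2 ^ n * m)" and G: "G \<in> carrier_mat m m"
  shows "msum m (pauli_strings n) (\<lambda>P. pauli_marginal n m P X * G * pauli_marginal n m P X) =
    2 ^ n \<cdot>\<^sub>m ptrace_left (2 ^ n) m (X * kron (1\<^sub>m (2 ^ n)) G * X)"
proof (rule eq_matI)
  fix i j assume "i < dim_row (2 ^ n \<cdot>\<^sub>m ptrace_left (2 ^ n) m (X * kron (1\<^sub>m (2 ^ n)) G * X))"
    "j < dim_col (2 ^ n \<cdot>\<^sub>m ptrace_left (2 ^ n) m (X * kron (1\<^sub>m (2 ^ n)) G * X))"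
  then have ij: "i < m" "j < m" by (auto simp: ptrace_left_def)
  let ?d = "2 ^ n :: nat" and ?R = "\<lambda>P. pauli_marginal n m P X"
  let ?S = "\<lambda>k l. \<Sum>s<?d. \<Sum>t<?d. X $$ (t * m + i, s * m + k) * X $$ (s * m + l, t * m + j)"
  have "msum m (pauli_strings n) (\<lambda>P. ?R P * G * ?R P) $$ (i, j) =
      (\<Sum>P\<in>pauli_strings n. \<Sum>l<m. \<Sum>k<m. G $$ (k, l) * (?R P $$ (i, k) * ?R P $$ (l, j)))"
    using ij G
    by (simp add: index_mult_mat_sum[of _ m m _ m] sum_distrib_right sum_distrib_left mult_carrier_mat[of _ m m]
      mult_ac del: index_mult_mat(1))
  also have "\<dots> = (\<Sum>l<m. \<Sum>k<m. G $$ (k, l) * (\<Sum>P\<in>pauli_strings n. ?R P $$ (i, k) * ?R P $$ (l, j)))"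
    by (simp add: sum_distrib_left sum.swap[of _ _ "pauli_strings n"])
  also have "\<dots> = (\<Sum>l<m. \<Sum>k<m. G $$ (k, l) * (2 ^ n * ?S k l))"
    using ij by (intro sum.cong refl) (simp add: sum_pauli_marginal_products)
  also have "\<dots> = 2 ^ n * (\<Sum>l<m. \<Sum>k<m. \<Sum>s<?d. \<Sum>t<?d.
      X $$ (t * m + i, s * m + k) * G $$ (k, l) * X $$ (s * m + l, t * m + j))"
    by (simp add: sum_distrib_left mult_ac)
  also have "(\<Sum>l<m. \<Sum>k<m. \<Sum>s<?d. \<Sum>t<?d.
      X $$ (t * m + i, s * m + k) * G $$ (k, l) * X $$ (s * m + l, t * m + j)) =
      (\<Sum>(l, k, s, t)\<in>{..<m} \<times> {..<m} \<times> {..<?d} \<times> {..<?d}.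
      X $$ (t * m + i, s * m + k) * G $$ (k, l) * X $$ (s * m + l, t * m + j))"
    by (simp add: sum.cartesian_product)
  also have "\<dots> = (\<Sum>(t, s, l, k)\<in>{..<?d} \<times> {..<?d} \<times> {..<m} \<times> {..<m}.
      X $$ (t * m + i, s * m + k) * G $$ (k, l) * X $$ (s * m + l, t * m + j))"
    by (rule sum.reindex_bij_witness[of _ "\<lambda>(t, s, l, k). (l, k, s, t)" "\<lambda>(l, k, s, t). (t, s, l, k)"]) auto
  also have "\<dots> = (\<Sum>t<?d. \<Sum>s<?d. \<Sum>l<m. \<Sum>k<m.
      X $$ (t * m + i, s * m + k) * G $$ (k, l) * X $$ (s * m + l, t * m + j))"
    by (simp add: sum.cartesian_product)
  also have "\<dots> = ptrace_left ?d m (X * kron (1\<^sub>m ?d) G * X) $$ (i, j)"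
  proof -
    have XG: "(X * kron (1\<^sub>m ?d) G) $$ (x, s * m + l) = (\<Sum>k<m. X $$ (x, s * m + k) * G $$ (k, l))"
      if "x < ?d * m" "s < ?d" "l < m" for x s l
    proof -
      have "(X * kron (1\<^sub>m ?d) G) $$ (x, s * m + l) =
          (\<Sum>u<?d. \<Sum>k<m. if u = s then X $$ (x, u * m + k) * G $$ (k, l) else 0)"
        using that X G prod_index_less[OF that(2,3)]
        by (simp add: index_mult_mat_sum[of _ "?d * m" "?d * m" _ "?d * m"] kron_carrier
          sum_lessThan_mult del: index_mult_mat(1))
          (intro sum.cong refl, simp add: kron_index[of _ ?d ?d _ m m])
      also have "\<dots> = (\<Sum>u<?d. if u = s then (\<Sum>k<m. X $$ (x, u * m + k) * G $$ (k, l)) else 0)"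
        by (intro sum.cong refl) simp
      finally show ?thesis using that by simp
    qed
    have "X * kron (1\<^sub>m ?d) G \<in> carrier_mat (?d * m) (?d * m)"
      using X G by (meson mult_carrier_mat kron_carrier one_carrier_mat)
    then have "(X * kron (1\<^sub>m ?d) G * X) $$ (t * m + i, t * m + j) = (\<Sum>s<?d. \<Sum>l<m. \<Sum>k<m.
        X $$ (t * m + i, s * m + k) * G $$ (k, l) * X $$ (s * m + l, t * m + j))" if "t < ?d" for t
      using that ij X prod_index_less[OF that, of _ m]
      by (simp add: index_mult_mat_sum[of _ "?d * m" "?d * m" _ "?d * m"] sum_lessThan_mult XG
        sum_distrib_right del: index_mult_mat(1))
    then show ?thesis using ij by (simp add: ptrace_left_index)
  qed
  finally show "msum m (pauli_strings n) (\<lambda>P. ?R P * G * ?R P) $$ (i, j) =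
      (2 ^ n \<cdot>\<^sub>m ptrace_left ?d m (X * kron (1\<^sub>m ?d) G * X)) $$ (i, j)"
    using ij by (simp add: ptrace_left_def)
qed (auto simp: ptrace_left_def)

text \<open>Weighted AM-GM: the difference of the two sides is
  \<open>(t P \<otimes> S - 1 \<otimes> R) (1 \<otimes> S\<^sup>-\<^sup>1) (t P \<otimes> S - 1 \<otimes> R) / (2 t)\<close>.\<close>

lemma psd_kron_pauli_bound:
  fixes t :: real
  assumes P: "P \<in> pauli_strings n" and t: "0 < t"
    and S: "psd m S" and G: "psd m G" and inv: "G * S = 1\<^sub>m m" "S * G = 1\<^sub>m m"
    and R: "R \<in> carrier_mat m m" "mat_adjoint R = R"
  shows "psd (2 ^ n * m) (kron (1\<^sub>m (2 ^ n)) (of_real (t / 2) \<cdot>\<^sub>m S + of_real (1 / (2 * t)) \<cdot>\<^sub>m (R * G * R))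
    - kron (pauli_op P) R)"
proof -
  let ?d = "2 ^ n :: nat"
  let ?N = "?d * m"
  let ?I = "1\<^sub>m ?d :: complex mat"
  define B where "B = of_real t \<cdot>\<^sub>m kron (pauli_op P) S - kron ?I R"
  note PC = pauli_op_carrier[OF P] and SC = psd_carrier[OF S] and GC = psd_carrier[OF G]
  have RG: "R * G \<in> carrier_mat m m" "R * G * R \<in> carrier_mat m m" using R GC by (meson mult_carrier_mat)+
  have RGS: "R * G * S = R" using R GC SC inv by simp
  have kc: "kron (pauli_op P) S \<in> carrier_mat ?N ?N" "kron ?I R \<in> carrier_mat ?N ?N"
    "kron ?I G \<in> carrier_mat ?N ?N" "kron (pauli_op P) (1\<^sub>m m) \<in> carrier_mat ?N ?N"
    "kron ?I (R * G) \<in> carrier_mat ?N ?N" "kron (pauli_op P) R \<in> carrier_mat ?N ?N"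
    "kron ?I S \<in> carrier_mat ?N ?N" "kron ?I (R * G * R) \<in> carrier_mat ?N ?N"
    using PC SC GC R RG by (blast intro: kron_carrier one_carrier_mat)+
  have BC: "B \<in> carrier_mat ?N ?N" unfolding B_def using kc by (intro minus_carrier_mat)
  have "mat_adjoint B = B"
    unfolding B_def using kc
    by (simp add: mat_adjoint_minus[of _ ?N ?N] mat_adjoint_smult mat_adjoint_kron pauli_op_adjoint
      psd_adjoint[OF S] R(2))
  then have "psd ?N (of_real (1 / (2 * t)) \<cdot>\<^sub>m (B * kron ?I G * B))"
    using psd_conj[OF psd_kron[OF psd_one[of ?d] G] BC] t
    by (intro psd_smult) (auto simp: less_eq_complex_def)
  \<comment> \<open>The middle factor cancels S in the first term of \<open>B\<close>. In the full
    product P squares to 1 and R G S is R, so both cross terms equal t P \<otimes> R.\<close>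
  moreover have "B * kron ?I G = of_real t \<cdot>\<^sub>m kron (pauli_op P) (1\<^sub>m m) - kron ?I (R * G)"
    unfolding B_def using kc PC SC GC R
    by (simp add: minus_mult_distrib_mat[of _ ?N ?N _ _ ?N] mult_smult_assoc_mat[of _ ?N ?N _ ?N]
      kron_mult[of _ ?d _ m] inv(2))
  then have "B * kron ?I G * B = of_real t \<cdot>\<^sub>m (of_real t \<cdot>\<^sub>m kron ?I S - kron (pauli_op P) R) -
      (of_real t \<cdot>\<^sub>m kron (pauli_op P) R - kron ?I (R * G * R))"
    unfolding B_def using kc PC SC GC R RG(1)
    by (simp add: minus_mult_distrib_mat[of _ ?N ?N _ _ ?N] mult_minus_distrib_mat[of _ ?N ?N _ ?N]
      mult_smult_assoc_mat[of _ ?N ?N _ ?N] mult_smult_distrib[of _ ?N ?N _ ?N] minus_carrier_mat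
      kron_mult[of _ ?d _ m] pauli_op_square[OF P] RGS del: assoc_mult_mat)
  moreover have "of_real (1 / (2 * t)) \<cdot>\<^sub>m (of_real t \<cdot>\<^sub>m (of_real t \<cdot>\<^sub>m A - C) - (of_real t \<cdot>\<^sub>m C - D)) =
      (of_real (t / 2) \<cdot>\<^sub>m A + of_real (1 / (2 * t)) \<cdot>\<^sub>m D) - C"
    if "A \<in> carrier_mat ?N ?N" "C \<in> carrier_mat ?N ?N" "D \<in> carrier_mat ?N ?N" for A C D :: "complex mat"
    using that t by (intro eq_matI) (auto simp: field_simps)
  moreover have "kron ?I (of_real (t / 2) \<cdot>\<^sub>m S + of_real (1 / (2 * t)) \<cdot>\<^sub>m (R * G * R)) =
      of_real (t / 2) \<cdot>\<^sub>m kron ?I S + of_real (1 / (2 * t)) \<cdot>\<^sub>m kron ?I (R * G * R)"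
    using SC RG(2) by (subst kron_add_right[of _ ?d ?d _ m m]) (auto simp: kron_smult_right)
  ultimately show ?thesis using kc by simp
qed

text \<open>X stands for a fresh input state or for a POVM element. The K_P are controlled through
  their sum, as the average over the test channels requires, and \<delta> stays free because the two
  models normalise it differently.\<close>

lemma reduction_criterion_pauli_bound:
  fixes \<delta> :: real
  assumes X: "psd (2 ^ n * m) X"
    and red: "psd (2 ^ n * m) (kron (1\<^sub>m (2 ^ n)) (ptrace_left (2 ^ n) m X) - X)" and \<delta>: "0 < \<delta>"
  obtains K where "\<And>P. P \<in> pauli_strings n \<Longrightarrow> psd m (K P)"
    "\<And>P. P \<in> pauli_strings n \<Longrightarrow>
      psd (2 ^ n * m) (kron (1\<^sub>m (2 ^ n)) (K P) - kron (pauli_op P) (pauli_marginal n m P X))"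
    "psd m (of_real (2 ^ n * sqrt (2 ^ n)) \<cdot>\<^sub>m (ptrace_left (2 ^ n) m X + of_real \<delta> \<cdot>\<^sub>m 1\<^sub>m m)
      - msum m (pauli_strings n) K)"
proof -
  let ?d = "2 ^ n :: nat"
  let ?N = "?d * m"
  let ?I = "1\<^sub>m ?d :: complex mat"
  let ?R = "\<lambda>P. pauli_marginal n m P X"
  define \<sigma> where "\<sigma> = ptrace_left ?d m X"
  define S where "S = \<sigma> + of_real \<delta> \<cdot>\<^sub>m 1\<^sub>m m"
  have \<sigma>: "psd m \<sigma>" unfolding \<sigma>_def by (rule psd_ptrace_left[OF X])
  have \<sigma>C: "\<sigma> \<in> carrier_mat m m" by (rule psd_carrier[OF \<sigma>])
  have S: "psd m S"
    unfolding S_def using \<delta> by (intro psd_add psd_smult psd_one \<sigma>) (auto simp: less_eq_complex_def)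
  obtain G where G: "psd m G" and inv: "G * S = 1\<^sub>m m" "S * G = 1\<^sub>m m"
    using psd_add_multiple_one_inverse[OF \<sigma> \<delta>] unfolding S_def by blast
  note XC = psd_carrier[OF X] and SC = psd_carrier[OF S] and GC = psd_carrier[OF G]
  have IS: "kron ?I S \<in> carrier_mat ?N ?N" and IG: "kron ?I G \<in> carrier_mat ?N ?N"
    using SC GC by (blast intro: kron_carrier one_carrier_mat)+
  \<comment> \<open>This value balances the two halves of AM-GM: summed over the 4^n strings, the
    first has coefficient 4^n t / 2 and the second 2^n / (2 t), and both equal 2^n sqrt(2^n) /
    2.\<close>
  define t where "t = 1 / sqrt (2 ^ n)"
  have t: "0 < t" by (simp add: t_def)
  define K where "K P = of_real (t / 2) \<cdot>\<^sub>m S + of_real (1 / (2 * t)) \<cdot>\<^sub>m (?R P * G * ?R P)" for P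
  have RC: "?R P * G * ?R P \<in> carrier_mat m m" for P
    using GC by (meson mult_carrier_mat pauli_marginal_carrier)
  show ?thesis
  proof
    fix P assume P: "P \<in> pauli_strings n"
    note adj = pauli_marginal_adjoint[OF X P]
    show "psd m (K P)"
      unfolding K_def using psd_conj[OF G pauli_marginal_carrier[of n m P X]] adj t
      by (intro psd_add psd_smult S) (auto simp: less_eq_complex_def)
    show "psd ?N (kron ?I (K P) - kron (pauli_op P) (?R P))"
      unfolding K_def by (rule psd_kron_pauli_bound[OF P t S G inv pauli_marginal_carrier adj])
  next
    let ?W = "X * kron ?I G * X"
    have WC: "?W \<in> carrier_mat ?N ?N" using XC IG by (meson mult_carrier_mat)
    \<comment> \<open>Adding a multiple of the identity enlarges the upper bound, so the reduction
      criterion passes from \<sigma> to S.\<close>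
    have "kron ?I S - X = (kron ?I \<sigma> - X) + of_real \<delta> \<cdot>\<^sub>m 1\<^sub>m ?N"
    proof -
      have "kron ?I S = kron ?I \<sigma> + of_real \<delta> \<cdot>\<^sub>m 1\<^sub>m ?N"
        unfolding S_def using \<sigma>C by (subst kron_add_right[of _ ?d ?d _ m m]) (auto simp: kron_smult_right kron_one)
      moreover have "kron ?I \<sigma> \<in> carrier_mat ?N ?N" using \<sigma>C by (blast intro: kron_carrier one_carrier_mat)
      ultimately show ?thesis using XC by (intro eq_matI) auto
    qed
    then have "psd ?N (kron ?I S - X)"
      using red \<delta> by (auto simp: less_eq_complex_def \<sigma>_def intro!: psd_add psd_smult psd_one)
    moreover have "kron ?I G * kron ?I S = 1\<^sub>m ?N"
      using GC SC by (simp add: kron_mult[of _ ?d _ m] inv kron_one)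
    ultimately have "psd ?N (X - ?W)"
      using psd_minus_sandwich[OF X _ psd_kron[OF psd_one G] IS] by blast
    from psd_ptrace_left[OF this] have W: "psd m (\<sigma> - ptrace_left ?d m ?W)"
      by (simp add: ptrace_left_minus[OF XC WC] \<sigma>_def)
    let ?c = "2 ^ n * sqrt (2 ^ n) / 2"
    have "psd m (of_real ?c \<cdot>\<^sub>m ((\<sigma> - ptrace_left ?d m ?W) + of_real \<delta> \<cdot>\<^sub>m 1\<^sub>m m))"
      using \<delta> by (intro psd_add psd_smult psd_one W) (auto simp: less_eq_complex_def)
    \<comment> \<open>With c half of the claimed constant, the sum of the K_P is c S + c Tr_S W, so
      the slack is 2 c S - c S - c Tr_S W = c (S - Tr_S W).\<close>
    moreover have "of_real ?c \<cdot>\<^sub>m ((\<sigma> - ptrace_left ?d m ?W) + of_real \<delta> \<cdot>\<^sub>m 1\<^sub>m m) =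
      of_real (2 ^ n * sqrt (2 ^ n)) \<cdot>\<^sub>m S - msum m (pauli_strings n) K"
    proof -
      have "msum m (pauli_strings n) K =
          msum m (pauli_strings n) (\<lambda>P. of_real (t / 2) \<cdot>\<^sub>m S) +
          of_real (1 / (2 * t)) \<cdot>\<^sub>m msum m (pauli_strings n) (\<lambda>P. ?R P * G * ?R P)"
        unfolding K_def using SC RC by (subst msum_add) (auto simp: msum_smult)
      also have "msum m (pauli_strings n) (\<lambda>P. of_real (t / 2) \<cdot>\<^sub>m S) = of_real ?c \<cdot>\<^sub>m S"
      proof -
        have "2 ^ n * (2 ^ n * t) = 2 ^ n * sqrt (2 ^ n)"
          using real_sqrt_mult_self[of "2 ^ n"] by (simp add: t_def field_simps)
        then have "4 ^ n * (t / 2) = ?c" by (simp add: pow_4)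
        then have "4 ^ n * complex_of_real (t / 2) = of_real ?c"
          by (metis of_real_mult of_real_numeral of_real_power)
        then show ?thesis
          using SC by (intro eq_matI) (auto simp: card_pauli_strings simp flip: mult.assoc)
      qed
      also have "msum m (pauli_strings n) (\<lambda>P. ?R P * G * ?R P) = 2 ^ n \<cdot>\<^sub>m ptrace_left ?d m ?W"
        by (rule msum_pauli_marginal_sandwich[OF XC GC])
      finally have "msum m (pauli_strings n) K =
          of_real ?c \<cdot>\<^sub>m S + of_real ?c \<cdot>\<^sub>m ptrace_left ?d m ?W"
        by (simp add: smult_smult_mat t_def field_simps)
      moreover have "of_real ?c \<cdot>\<^sub>m ((\<sigma> - Y) + of_real \<delta> \<cdot>\<^sub>m 1\<^sub>m m) =
          of_real (2 * ?c) \<cdot>\<^sub>m S - (of_real ?c \<cdot>\<^sub>m S + of_real ?c \<cdot>\<^sub>m Y)" if "Y \<in> carrier_mat m m" for Y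
        using that \<sigma>C by (intro eq_matI) (auto simp: S_def algebra_simps)
      ultimately show ?thesis by simp
    qed
    ultimately show "psd m (of_real (2 ^ n * sqrt (2 ^ n)) \<cdot>\<^sub>m (ptrace_left ?d m X + of_real \<delta> \<cdot>\<^sub>m 1\<^sub>m m)
      - msum m (pauli_strings n) K)"
      by (simp add: S_def \<sigma>_def)
  qed
qed

section \<open>The hybrid argument\<close>

lemma records_0 [simp]: "records nout 0 = {[]}"
  by (auto simp: records_def)

lemma snoc_in_records_iff:
  assumes "length h = k"
  shows "h @ [x] \<in> records nout (Suc k) \<longleftrightarrow> h \<in> records nout k \<and> x < nout h"
  using assms by (auto simp: records_def nth_append less_Suc_eq)

lemma length_records: "h \<in> records nout k \<Longrightarrow> length h = k"
  by (simp add: records_def)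

lemma records_Suc:
  "records nout (Suc k) = (\<lambda>(h, x). h @ [x]) ` (SIGMA h:records nout k. {..<nout h})"
proof (intro equalityI subsetI)
  fix h assume h: "h \<in> records nout (Suc k)"
  then obtain h' x where h': "h = h' @ [x]" "length h' = k"
    using length_records[OF h] by (metis length_Suc_conv_rev)
  then show "h \<in> (\<lambda>(h, x). h @ [x]) ` (SIGMA h:records nout k. {..<nout h})"
    using h snoc_in_records_iff[OF h'(2)] by force
qed (auto simp: snoc_in_records_iff length_records)

lemma finite_records [simp]: "finite (records nout k)"
  by (induction k) (auto simp: records_Suc)

lemma sum_records_Suc:
  "(\<Sum>h\<in>records nout (Suc k). f h) = (\<Sum>h\<in>records nout k. \<Sum>x<nout h. f (h @ [x]))"
proof -
  have "inj_on (\<lambda>(h, x). h @ [x]) (SIGMA h:records nout k. {..<nout h})"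
    by (auto simp: inj_on_def)
  then show ?thesis
    unfolding records_Suc by (subst sum.reindex) (auto simp: sum.Sigma case_prod_unfold)
qed

text \<open>Both models are instances of a process whose state after the outcomes \<open>h\<close> is an
  unnormalised density matrix of dimension \<open>D (length h)\<close>, with \<open>st h x\<close> the effect of
  the next outcome \<open>x\<close>.\<close>

definition valid_process ::
  "(nat \<Rightarrow> nat) \<Rightarrow> nat \<Rightarrow> (nat list \<Rightarrow> nat) \<Rightarrow> (nat list \<Rightarrow> nat \<Rightarrow> complex mat \<Rightarrow> complex mat) \<Rightarrow> bool" where
  "valid_process D N nout st \<longleftrightarrow> (\<forall>k<N. \<forall>h\<in>records nout k.
     (\<forall>x<nout h. linear_map (D k) (D (Suc k)) (st h x) \<and>
        (\<forall>X. psd (D k) X \<longrightarrow> psd (D (Suc k)) (st h x X))) \<and>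
     (\<forall>X\<in>carrier_mat (D k) (D k). (\<Sum>x<nout h. mtrace (st h x X)) = mtrace X))"

text \<open>Only the first k outcomes of the record are read, so a record can be extended without
  changing the states of its prefixes.\<close>

primrec run ::
  "(nat list \<Rightarrow> nat \<Rightarrow> complex mat \<Rightarrow> complex mat) \<Rightarrow> complex mat \<Rightarrow> nat list \<Rightarrow> nat \<Rightarrow> complex mat" where
  "run st X0 h 0 = X0"
| "run st X0 h (Suc k) = st (take k h) (h ! k) (run st X0 h k)"

lemma run_append: "k \<le> length h \<Longrightarrow> run st X0 (h @ g) k = run st X0 h k"
  by (induction k) (auto simp: nth_append)

lemma run_snoc:
  "length h = k \<Longrightarrow> run st X0 (h @ [x]) (Suc k) = st h x (run st X0 h k)"
  by (auto simp: run_append)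

lemma linear_map_minus:
  assumes "linear_map d e \<Phi>" "X \<in> carrier_mat d d" "Y \<in> carrier_mat d d"
  shows "\<Phi> (X - Y) = \<Phi> X - \<Phi> Y"
proof -
  have "X - Y = X + (- 1) \<cdot>\<^sub>m Y" using assms(2,3) by (intro eq_matI) auto
  moreover have "(- 1) \<cdot>\<^sub>m Y \<in> carrier_mat d d" using assms(3) by simp
  ultimately have "\<Phi> (X - Y) = \<Phi> X + (- 1) \<cdot>\<^sub>m \<Phi> Y"
    using assms unfolding linear_map_def by metis
  moreover have "\<Phi> X \<in> carrier_mat e e" "\<Phi> Y \<in> carrier_mat e e"
    using assms by (auto simp: linear_map_def)
  ultimately show ?thesis by (auto intro!: eq_matI)
qed

lemma valid_processD:
  assumes "valid_process D N nout st" "k < N" "h \<in> records nout k"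
  shows "x < nout h \<Longrightarrow> linear_map (D k) (D (Suc k)) (st h x)"
    "x < nout h \<Longrightarrow> psd (D k) X \<Longrightarrow> psd (D (Suc k)) (st h x X)"
    "X \<in> carrier_mat (D k) (D k) \<Longrightarrow> (\<Sum>x<nout h. mtrace (st h x X)) = mtrace X"
    "x < nout h \<Longrightarrow> X \<in> carrier_mat (D k) (D k) \<Longrightarrow> st h x X \<in> carrier_mat (D (Suc k)) (D (Suc k))"
  using assms unfolding valid_process_def by (auto simp: linear_map_def)

lemma psd_run:
  assumes "valid_process D N nout st" "psd (D 0) X0" "k \<le> N" "h \<in> records nout k"
  shows "psd (D k) (run st X0 h k)"
  using assms(3,4)
proof (induction k arbitrary: h)
  case (Suc k)
  then obtain h' x where h: "h = h' @ [x]" "h' \<in> records nout k" "x < nout h'"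
    by (auto simp: records_Suc)
  then show ?case
    using Suc.IH[OF _ h(2)] Suc.prems(1) valid_processD(2)[OF assms(1) _ h(2,3)]
    by (simp only: h(1) run_snoc[OF length_records[OF h(2)]])
qed (use assms in simp)

lemma sum_mtrace_run:
  assumes "valid_process D N nout st" "psd (D 0) X0" "k \<le> N"
  shows "(\<Sum>h\<in>records nout k. mtrace (run st X0 h k)) = mtrace X0"
  using assms(3)
proof (induction k)
  case (Suc k)
  have "(\<Sum>h\<in>records nout (Suc k). mtrace (run st X0 h (Suc k))) =
      (\<Sum>h\<in>records nout k. \<Sum>x<nout h. mtrace (st h x (run st X0 h k)))"
    unfolding sum_records_Suc by (intro sum.cong refl arg_cong[of _ _ mtrace] run_snoc length_records)
  also have "\<dots> = (\<Sum>h\<in>records nout k. mtrace (run st X0 h k))"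
  proof (rule sum.cong[OF refl])
    fix h assume h: "h \<in> records nout k"
    have "psd (D k) (run st X0 h k)"
      using Suc.prems by (intro psd_run[OF assms(1,2) _ h]) simp
    then show "(\<Sum>x<nout h. mtrace (st h x (run st X0 h k))) = mtrace (run st X0 h k)"
      using Suc.prems by (intro valid_processD(3)[OF assms(1) _ h] psd_carrier) auto
  qed
  finally show ?case using Suc by simp
qed simp

text \<open>The probability that the record h is continued to one in E, when r rounds remain and X
  is the current unnormalised state. It plays the part of X \<mapsto> Tr (M X) for an effect 0 \<le>
  M \<le> 1 without an explicit M: the next two lemmas supply the bounds and the compatibility with
  subtraction.\<close>

primrec future_prob ::
  "(nat list \<Rightarrow> nat \<Rightarrow> complex mat \<Rightarrow> complex mat) \<Rightarrow> (nat list \<Rightarrow> nat) \<Rightarrow> nat list set \<Rightarrow> nat \<Rightarrow>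
     nat list \<Rightarrow> complex mat \<Rightarrow> real" where
  "future_prob st nout E 0 h X = (if h \<in> E then Re (mtrace X) else 0)"
| "future_prob st nout E (Suc r) h X = (\<Sum>x<nout h. future_prob st nout E r (h @ [x]) (st h x X))"

lemma future_prob_bounds:
  assumes "valid_process D N nout st" "h \<in> records nout k" "k + r = N" "psd (D k) X"
  shows "0 \<le> future_prob st nout E r h X \<and> future_prob st nout E r h X \<le> Re (mtrace X)"
  using assms(2-)
proof (induction r arbitrary: k h X)
  case 0
  then show ?case using psd_mtrace_nonneg[of "D k" X] by (auto simp: less_eq_complex_def)
next
  case (Suc r)
  have k: "k < N" using Suc.prems by simp
  note v = valid_processD[OF assms(1) k Suc.prems(1)]
  have IH: "0 \<le> future_prob st nout E r (h @ [x]) (st h x X) \<and>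
      future_prob st nout E r (h @ [x]) (st h x X) \<le> Re (mtrace (st h x X))" if "x < nout h" for x
    using Suc.prems that v(2)
    by (intro Suc.IH[of _ "Suc k"]) (auto simp: snoc_in_records_iff length_records)
  have "future_prob st nout E (Suc r) h X \<le> (\<Sum>x<nout h. Re (mtrace (st h x X)))"
    using IH by (auto intro: sum_mono)
  also have "\<dots> = Re (mtrace X)"
    using v(3)[OF psd_carrier[OF Suc.prems(3)]] by (metis Re_sum)
  finally show ?case using IH by (auto intro: sum_nonneg)
qed

lemma future_prob_minus:
  assumes "valid_process D N nout st" "h \<in> records nout k" "k + r = N"
    "X \<in> carrier_mat (D k) (D k)" "Y \<in> carrier_mat (D k) (D k)"
  shows "future_prob st nout E r h (X - Y) = future_prob st nout E r h X - future_prob st nout E r h Y"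
  using assms(2-)
proof (induction r arbitrary: k h X Y)
  case 0
  then show ?case by (simp add: mtrace_minus[of _ "D k"])
next
  case (Suc r)
  have k: "k < N" using Suc.prems by simp
  note v = valid_processD[OF assms(1) k Suc.prems(1)]
  have "future_prob st nout E r (h @ [x]) (st h x (X - Y)) =
      future_prob st nout E r (h @ [x]) (st h x X) - future_prob st nout E r (h @ [x]) (st h x Y)"
    if "x < nout h" for x
    unfolding linear_map_minus[OF v(1)[OF that] Suc.prems(3,4)]
    using Suc.prems that v(4)
    by (intro Suc.IH[of _ "Suc k"]) (auto simp: snoc_in_records_iff length_records)
  then show ?case by (simp add: sum_subtractf)
qed

text \<open>The left side does not change with k: unfolding \<open>future_prob\<close> once produces
  the states of \<open>run\<close> one round later. At r = 0 it is the probability of E.\<close>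

lemma sum_future_prob_run:
  assumes "k + r = N"
  shows "(\<Sum>h\<in>records nout k. future_prob st nout E r h (run st X0 h k)) =
    (\<Sum>h\<in>records nout N \<inter> E. Re (mtrace (run st X0 h N)))"
  using assms
proof (induction r arbitrary: k)
  case 0
  then show ?case by (simp add: sum.inter_restrict)
next
  case (Suc r)
  have "(\<Sum>h\<in>records nout k. future_prob st nout E (Suc r) h (run st X0 h k)) =
      (\<Sum>h\<in>records nout (Suc k). future_prob st nout E r h (run st X0 h (Suc k)))"
    unfolding sum_records_Suc future_prob.simps
    by (intro sum.cong refl) (simp add: run_snoc[OF length_records] del: run.simps)
  then show ?case using Suc.IH[of "Suc k"] Suc.prems by simp
qed

text \<open>The hybrid \<open>?S k\<close> follows \<open>sq\<close> for \<open>k\<close> rounds and \<open>sp\<close> afterwards.\<close>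

lemma hybrid_bound:
  assumes vp: "valid_process D N nout sp" and vq: "valid_process D N nout sq" and X0: "psd (D 0) X0"
    and Z: "\<And>k h x. k < N \<Longrightarrow> h \<in> records nout k \<Longrightarrow> x < nout h \<Longrightarrow> psd (D (Suc k)) (Z h x)"
    and ZD: "\<And>k h x. k < N \<Longrightarrow> h \<in> records nout k \<Longrightarrow> x < nout h \<Longrightarrow>
      psd (D (Suc k)) (Z h x - (sp h x (run sq X0 h k) - sq h x (run sq X0 h k)))"
  shows "(\<Sum>h\<in>records nout N \<inter> E. Re (mtrace (run sp X0 h N))) -
      (\<Sum>h\<in>records nout N \<inter> E. Re (mtrace (run sq X0 h N))) \<le>
    (\<Sum>k<N. \<Sum>h\<in>records nout k. \<Sum>x<nout h. Re (mtrace (Z h x)))"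
proof -
  let ?V = "future_prob sp nout E"
  let ?S = "\<lambda>k. \<Sum>h\<in>records nout k. ?V (N - k) h (run sq X0 h k)"
  \<comment> \<open>Neighbouring hybrids share the first k rounds, run with \<open>sq\<close>, and
    all rounds after the disturbed one, run with \<open>sp\<close>; only the step taken in round k
    differs.\<close>
  have step: "?S k - ?S (Suc k) \<le> (\<Sum>h\<in>records nout k. \<Sum>x<nout h. Re (mtrace (Z h x)))"
    if k: "k < N" for k
  proof -
    have r: "N - k = Suc (N - Suc k)" "Suc k + (N - Suc k) = N" using k by auto
    have "?S k - ?S (Suc k) = (\<Sum>h\<in>records nout k. \<Sum>x<nout h.
        ?V (N - Suc k) (h @ [x]) (sp h x (run sq X0 h k)) -
        ?V (N - Suc k) (h @ [x]) (sq h x (run sq X0 h k)))"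
      unfolding sum_records_Suc sum_subtractf r(1) future_prob.simps
      by (simp add: run_snoc[OF length_records] del: run.simps cong: sum.cong)
    also have "\<dots> \<le> (\<Sum>h\<in>records nout k. \<Sum>x<nout h. Re (mtrace (Z h x)))"
    proof (intro sum_mono)
      fix h x assume h: "h \<in> records nout k" and "x \<in> {..<nout h}"
      then have x: "x < nout h" by simp
      have hx: "h @ [x] \<in> records nout (Suc k)"
        using h x by (simp add: snoc_in_records_iff length_records)
      have Q: "run sq X0 h k \<in> carrier_mat (D k) (D k)"
        using k by (intro psd_carrier psd_run[OF vq X0 _ h]) simp
      let ?A = "sp h x (run sq X0 h k)" and ?B = "sq h x (run sq X0 h k)"
      have A: "?A \<in> carrier_mat (D (Suc k)) (D (Suc k))" by (rule valid_processD(4)[OF vp k h x Q])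
      have B: "?B \<in> carrier_mat (D (Suc k)) (D (Suc k))" by (rule valid_processD(4)[OF vq k h x Q])
      note m = future_prob_minus[OF vp hx r(2)]
      \<comment> \<open>With V the probability of success in the future, positivity at Z - (A - B)
        gives V(A) - V(B) \<le> V(Z), and V(Z) \<le> Tr Z. The future enters through these two
        inequalities only.\<close>
      have "0 \<le> ?V (N - Suc k) (h @ [x]) (Z h x - (?A - ?B))"
        using future_prob_bounds[OF vp hx r(2) ZD[OF k h x]] by blast
      also have "\<dots> = ?V (N - Suc k) (h @ [x]) (Z h x) - (?V (N - Suc k) (h @ [x]) ?A - ?V (N - Suc k) (h @ [x]) ?B)"
        using A B psd_carrier[OF Z[OF k h x]] by (simp add: m minus_carrier_mat)
      finally show "?V (N - Suc k) (h @ [x]) ?A - ?V (N - Suc k) (h @ [x]) ?B \<le> Re (mtrace (Z h x))"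
        using future_prob_bounds[OF vp hx r(2) Z[OF k h x], of E] by linarith
    qed
    finally show ?thesis .
  qed
  \<comment> \<open>Telescoping: \<open>?S 0\<close> uses \<open>sp\<close> in every round and
    \<open>?S N\<close> uses \<open>sq\<close> in every round.\<close>
  have "?S 0 - ?S N = (\<Sum>k<N. ?S k - ?S (Suc k))"
    by (rule sum_lessThan_telescope'[symmetric])
  also have "\<dots> \<le> (\<Sum>k<N. \<Sum>h\<in>records nout k. \<Sum>x<nout h. Re (mtrace (Z h x)))"
    by (intro sum_mono step) simp
  finally have "?S 0 - ?S N \<le> \<dots>" .
  moreover have "?S 0 = (\<Sum>h\<in>records nout N \<inter> E. Re (mtrace (run sp X0 h N)))"
    using sum_future_prob_run[of 0 N N sp nout E X0] by simp
  moreover have "?S N = (\<Sum>h\<in>records nout N \<inter> E. Re (mtrace (run sq X0 h N)))"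
    by (simp add: sum.inter_restrict)
  ultimately show ?thesis by simp
qed

text \<open>Success bounds the largest error, hence the error at P; nonnegativity of the
  probabilities allows the passage to this larger event.\<close>

lemma estimate_event_prob:
  assumes solves: "solves_pauli_learning n \<epsilon> (records nout N) prob est"
    and p: "pauli_distribution n p" and P: "P \<in> pauli_strings n"
    and nonneg: "\<And>h. h \<in> records nout N \<Longrightarrow> 0 \<le> prob p h"
  shows "2 / 3 \<le> (\<Sum>h\<in>records nout N \<inter> {h. \<bar>est h P - pauli_eigenvalue n p P\<bar> \<le> \<epsilon>}. prob p h)"
proof -
  let ?F = "{h \<in> records nout N. (MAX P \<in> pauli_strings n. \<bar>est h P - pauli_eigenvalue n p P\<bar>) \<le> \<epsilon>}"
  have "2 / 3 \<le> (\<Sum>h\<in>?F. prob p h)"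
    using solves p by (simp add: solves_pauli_learning_def)
  also have "\<dots> \<le> (\<Sum>h\<in>records nout N \<inter> {h. \<bar>est h P - pauli_eigenvalue n p P\<bar> \<le> \<epsilon>}. prob p h)"
  proof (rule sum_mono2)
    show "?F \<subseteq> records nout N \<inter> {h. \<bar>est h P - pauli_eigenvalue n p P\<bar> \<le> \<epsilon>}"
    proof safe
      fix h assume "(MAX P \<in> pauli_strings n. \<bar>est h P - pauli_eigenvalue n p P\<bar>) \<le> \<epsilon>"
      moreover have "\<bar>est h P - pauli_eigenvalue n p P\<bar> \<le> (MAX P \<in> pauli_strings n. \<bar>est h P - pauli_eigenvalue n p P\<bar>)"
        using P by (intro Max_ge) auto
      ultimately show "\<bar>est h P - pauli_eigenvalue n p P\<bar> \<le> \<epsilon>" by simp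
    qed
  qed (use nonneg in auto)
  finally show ?thesis .
qed

text \<open>Apart from bookkeeping, a model enters through \<open>advantage\<close>: in one round,
  started from an arbitrary X, the dominating operators have total trace of order \<epsilon>
  2^(3n/2) Tr X over all outcomes and strings. Per string this is \<epsilon> 2^(-n/2) Tr X, to be
  compared with the gap 1/3.\<close>

lemma pauli_learning_lower_bound:
  fixes \<epsilon> :: real
  assumes n: "1 \<le> n" and \<epsilon>: "0 < \<epsilon>" "\<epsilon> \<le> 1 / 3"
    and valid: "\<And>p. pauli_distribution n p \<Longrightarrow> valid_process D N nout (st p)"
    and X0: "psd (D 0) X0" "mtrace X0 = 1"
    and solves: "solves_pauli_learning n \<epsilon> (records nout N) prob est"
    and prob: "\<And>p h. h \<in> records nout N \<Longrightarrow> prob p h = Re (mtrace (run (st p) X0 h N))"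
    and advantage: "\<And>k h X. k < N \<Longrightarrow> h \<in> records nout k \<Longrightarrow> psd (D k) X \<Longrightarrow>
      \<exists>Z. (\<forall>P\<in>pauli_strings n. \<forall>x<nout h. psd (D (Suc k)) (Z P x) \<and>
          psd (D (Suc k)) (Z P x - (st (biased_pauli n (3 * \<epsilon>) P) h x X - st (uniform_pauli n) h x X))) \<and>
        (\<Sum>P\<in>pauli_strings n. \<Sum>x<nout h. Re (mtrace (Z P x))) \<le>
          2 * (3 * \<epsilon>) * (2 ^ n * sqrt (2 ^ n)) * Re (mtrace X)"
  shows "real N \<ge> 1 / 24 * (1 / \<epsilon>) * 2 powr (real n / 2)"
proof -
  let ?q = "uniform_pauli n" and ?p = "biased_pauli n (3 * \<epsilon>)"
  let ?c = "2 * (3 * \<epsilon>) * (2 ^ n * sqrt (2 ^ n))"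
  let ?rho = "\<lambda>h k. run (st ?q) X0 h k"
  \<comment> \<open>The identity string is left out: its eigenvalue is 1 for every Pauli
    channel.\<close>
  define S where "S = pauli_strings n - {replicate n PauliI}"
  note vq = valid[OF pauli_distribution_uniform]
  \<comment> \<open>The bound \<epsilon> \<le> 1/3 keeps the bias 3 \<epsilon> at most 1, so the
    biased weights are nonnegative.\<close>
  have dp: "pauli_distribution n (?p P)" if "P \<in> S" for P
    using that \<epsilon> by (intro pauli_distribution_biased) (auto simp: S_def)
  have nonneg: "0 \<le> Re (mtrace (run (st p) X0 h N))"
    if "pauli_distribution n p" "h \<in> records nout N" for p h
    using psd_mtrace_nonneg[OF psd_run[OF valid[OF that(1)] X0(1) _ that(2)]]
    by (simp add: less_eq_complex_def)
  \<comment> \<open>The window of radius \<epsilon> around 3 \<epsilon> misses the one around 0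
    because 3 \<epsilon> > 2 \<epsilon>; under the uniform channel it therefore has probability at
    most 1/3.\<close>
  define E where "E P = {h. \<bar>est h P - 3 * \<epsilon>\<bar> \<le> \<epsilon>}" for P
  have gap: "1 / 3 \<le> (\<Sum>h\<in>records nout N \<inter> E P. Re (mtrace (run (st (?p P)) X0 h N))) -
      (\<Sum>h\<in>records nout N \<inter> E P. Re (mtrace (?rho h N)))" if P: "P \<in> S" for P
  proof -
    have P': "P \<in> pauli_strings n" "P \<noteq> replicate n PauliI" using P by (auto simp: S_def)
    have "2 / 3 \<le> (\<Sum>h\<in>records nout N \<inter> E P. prob (?p P) h)"
      using estimate_event_prob[OF solves dp[OF P] P'(1)] nonneg[OF dp[OF P]]
      by (simp add: pauli_eigenvalue_biased[OF P'] E_def prob)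
    then have biased: "2 / 3 \<le> (\<Sum>h\<in>records nout N \<inter> E P. Re (mtrace (run (st (?p P)) X0 h N)))"
      by (simp add: prob)
    let ?F = "{h. \<bar>est h P\<bar> \<le> \<epsilon>}"
    have "2 / 3 \<le> (\<Sum>h\<in>records nout N \<inter> ?F. prob ?q h)"
      using estimate_event_prob[OF solves pauli_distribution_uniform P'(1)]
        nonneg[OF pauli_distribution_uniform]
      by (simp add: pauli_eigenvalue_uniform[OF P'] prob)
    then have "2 / 3 + (\<Sum>h\<in>records nout N \<inter> E P. Re (mtrace (?rho h N))) \<le>
        (\<Sum>h\<in>records nout N \<inter> ?F. Re (mtrace (?rho h N))) + (\<Sum>h\<in>records nout N \<inter> E P. Re (mtrace (?rho h N)))"
      by (simp add: prob)
    also have "\<dots> = (\<Sum>h\<in>(records nout N \<inter> ?F) \<union> (records nout N \<inter> E P). Re (mtrace (?rho h N)))"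
    proof (rule sum.union_disjoint[symmetric])
      show "records nout N \<inter> ?F \<inter> (records nout N \<inter> E P) = {}"
        using \<epsilon>(1) by (auto simp: E_def)
    qed auto
    also have "\<dots> \<le> (\<Sum>h\<in>records nout N. Re (mtrace (?rho h N)))"
      using nonneg[OF pauli_distribution_uniform] by (intro sum_mono2) auto
    also have "\<dots> = 1"
      using sum_mtrace_run[OF vq X0(1), of N] X0(2) by (metis Re_sum le_refl one_complex.sel(1))
    finally show ?thesis using biased by simp
  qed
  \<comment> \<open>The state of the uniform run is inserted for X. It does not depend on P, so one
    application of \<open>advantage\<close> serves all strings, with the trace bound on their sum.
    Writing \<open>length h\<close> for the round makes Z a function of the record.\<close>
  have "\<exists>Z. (\<forall>P\<in>pauli_strings n. \<forall>x<nout h. psd (D (Suc (length h))) (Z P x) \<and>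
          psd (D (Suc (length h))) (Z P x - (st (?p P) h x (?rho h (length h)) - st ?q h x (?rho h (length h))))) \<and>
        (\<Sum>P\<in>pauli_strings n. \<Sum>x<nout h. Re (mtrace (Z P x))) \<le> ?c * Re (mtrace (?rho h (length h)))"
    if "length h < N" "h \<in> records nout (length h)" for h
    using that by (intro advantage psd_run[OF vq X0(1)]) auto
  then obtain Z where Z: "\<And>h. length h < N \<Longrightarrow> h \<in> records nout (length h) \<Longrightarrow>
      (\<forall>P\<in>pauli_strings n. \<forall>x<nout h. psd (D (Suc (length h))) (Z h P x) \<and>
          psd (D (Suc (length h))) (Z h P x - (st (?p P) h x (?rho h (length h)) - st ?q h x (?rho h (length h))))) \<and>
        (\<Sum>P\<in>pauli_strings n. \<Sum>x<nout h. Re (mtrace (Z h P x))) \<le> ?c * Re (mtrace (?rho h (length h)))"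
    by metis
  have Zk: "\<forall>P\<in>pauli_strings n. \<forall>x<nout h. psd (D (Suc k)) (Z h P x) \<and>
          psd (D (Suc k)) (Z h P x - (st (?p P) h x (?rho h k) - st ?q h x (?rho h k)))"
    and Zs: "(\<Sum>P\<in>pauli_strings n. \<Sum>x<nout h. Re (mtrace (Z h P x))) \<le> ?c * Re (mtrace (?rho h k))"
    if "k < N" "h \<in> records nout k" for k h
    using Z[of h] that length_records[OF that(2)] by auto
  have "real (card S) / 3 \<le> (\<Sum>P\<in>S. \<Sum>k<N. \<Sum>h\<in>records nout k. \<Sum>x<nout h. Re (mtrace (Z h P x)))"
  proof -
    have "real (card S) / 3 = (\<Sum>P\<in>S. 1 / 3)" by simp
    also have "\<dots> \<le> (\<Sum>P\<in>S. \<Sum>k<N. \<Sum>h\<in>records nout k. \<Sum>x<nout h. Re (mtrace (Z h P x)))"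
    proof (rule sum_mono)
      fix P assume P: "P \<in> S"
      then have P': "P \<in> pauli_strings n" by (simp add: S_def)
      note gap[OF P]
      also have "(\<Sum>h\<in>records nout N \<inter> E P. Re (mtrace (run (st (?p P)) X0 h N))) -
          (\<Sum>h\<in>records nout N \<inter> E P. Re (mtrace (?rho h N))) \<le>
          (\<Sum>k<N. \<Sum>h\<in>records nout k. \<Sum>x<nout h. Re (mtrace (Z h P x)))"
        using Zk P' by (intro hybrid_bound[OF valid[OF dp[OF P]] vq X0(1)]) blast+
      finally show "1 / 3 \<le> (\<Sum>k<N. \<Sum>h\<in>records nout k. \<Sum>x<nout h. Re (mtrace (Z h P x)))" .
    qed
    finally show ?thesis .
  qed
  \<comment> \<open>The identity string is added back; its terms are nonnegative.\<close>
  also have "\<dots> \<le> (\<Sum>P\<in>pauli_strings n. \<Sum>k<N. \<Sum>h\<in>records nout k. \<Sum>x<nout h. Re (mtrace (Z h P x)))"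
  proof (rule sum_mono2)
    show "0 \<le> (\<Sum>k<N. \<Sum>h\<in>records nout k. \<Sum>x<nout h. Re (mtrace (Z h P x)))"
      if "P \<in> pauli_strings n - S" for P
    proof (intro sum_nonneg)
      fix k h x assume "k \<in> {..<N}" "h \<in> records nout k" "x \<in> {..<nout h}"
      then have "psd (D (Suc k)) (Z h P x)" using Zk[of k h] that by auto
      then show "0 \<le> Re (mtrace (Z h P x))"
        using psd_mtrace_nonneg by (auto simp: less_eq_complex_def)
    qed
  qed (auto simp: S_def)
  also have "\<dots> = (\<Sum>k<N. \<Sum>h\<in>records nout k. \<Sum>P\<in>pauli_strings n. \<Sum>x<nout h. Re (mtrace (Z h P x)))"
    by (simp add: sum.swap[of _ _ "pauli_strings n"])
  also have "\<dots> \<le> (\<Sum>k<N. \<Sum>h\<in>records nout k. ?c * Re (mtrace (?rho h k)))"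
    by (intro sum_mono Zs) auto
  also have "\<dots> = (\<Sum>k<N. ?c * 1)"
  proof (intro sum.cong refl)
    fix k assume "k \<in> {..<N}"
    then have "(\<Sum>h\<in>records nout k. Re (mtrace (?rho h k))) = 1"
      using sum_mtrace_run[OF vq X0(1), of k] X0(2) by (metis Re_sum lessThan_iff less_imp_le one_complex.sel(1))
    then show "(\<Sum>h\<in>records nout k. ?c * Re (mtrace (?rho h k))) = ?c * 1"
      by (simp only: sum_distrib_left[symmetric])
  qed
  also have "\<dots> = N * ?c" by simp
  finally have main: "real (card S) / 3 \<le> N * ?c" .
  have "replicate n PauliI \<in> pauli_strings n" by (simp add: pauli_strings_def)
  then have "card S = 4 ^ n - 1"
    unfolding S_def by (simp add: card_Diff_singleton card_pauli_strings)
  then have "real (card S) = 4 ^ n - 1" by (simp add: of_nat_diff)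
  moreover have "4 \<le> (4::real) ^ n" using power_increasing[of 1 n "4::real"] n by simp
  \<comment> \<open>Since 4^n \<ge> 4, (4^n - 1) / 3 is at least 4^n / 4. With s = 2^(n/2) the
    result reads s^4 / 4 \<le> 6 \<epsilon> s^3 N, whence the constant 1/24.\<close>
  ultimately have bound: "4 ^ n / 4 \<le> N * ?c" using main by linarith
  define s :: real where "s = sqrt (2 ^ n)"
  have s: "2 ^ n = s * s" "0 < s" by (auto simp: s_def)
  have "(4::real) ^ n = (s * s) * (s * s)" unfolding pow_4 s(1) ..
  moreover have "?c = 6 * \<epsilon> * (s * s * s)" by (simp add: s_def)
  ultimately have "(s * s * s) * s / 4 \<le> N * (6 * \<epsilon> * (s * s * s))"
    using bound by (simp only: mult.assoc)
  then have "(s * s * s) * s \<le> (s * s * s) * (24 * \<epsilon> * N)"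
    by (simp add: mult_ac)
  then have "s \<le> 24 * \<epsilon> * N"
    using s(2) mult_le_cancel_left_pos[of "s * s * s"] by simp
  moreover have "2 powr (real n / 2) = s"
    by (simp add: s_def powr_half_sqrt[symmetric] powr_powr flip: powr_realpow)
  ultimately show ?thesis using \<epsilon>(1) by (simp add: field_simps)
qed

section \<open>Input-restricted protocols\<close>

lemma kron_add_left:
  assumes "A \<in> carrier_mat k l" "B \<in> carrier_mat k l" "C \<in> carrier_mat m n"
  shows "kron (A + B) C = kron A C + kron B C"
  using assms by (intro eq_matI) (auto simp: kron_def less_mult_imp_div_less algebra_simps)

lemma linear_map_kron_right:
  assumes "B \<in> carrier_mat m m"
  shows "linear_map k (k * m) (\<lambda>X. kron X B)"
  using assms unfolding linear_map_def by (simp add: kron_carrier kron_add_left kron_smult_left)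

lemma linear_map_compose:
  assumes "linear_map d e \<Phi>" "linear_map e f \<Psi>"
  shows "linear_map d f (\<lambda>X. \<Psi> (\<Phi> X))"
  using assms unfolding linear_map_def by simp

text \<open>Complete positivity with a trivial reference system, k = 1.\<close>

lemma completely_positive_psd:
  assumes "completely_positive d e \<Phi>" "psd d X"
  shows "psd e (\<Phi> X)"
proof -
  have X: "X \<in> carrier_mat d d" by (rule psd_carrier[OF assms(2)])
  then have \<Phi>: "\<Phi> X \<in> carrier_mat e e"
    using assms(1) by (simp add: completely_positive_def linear_map_def)
  have "mat d d (\<lambda>(s, t). X $$ (s, t)) = X" using X by (intro eq_matI) auto
  then have "local_map 1 1 d e \<Phi> X = \<Phi> X"
    using \<Phi> by (intro eq_matI) (auto simp: local_map_def)
  moreover have "psd (1 * e) (local_map 1 1 d e \<Phi> X)"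
    using assms(1) unfolding completely_positive_def by (metis assms(2) mult_1)
  ultimately show ?thesis by simp
qed

lemma completely_positive_linear: "completely_positive d e \<Phi> \<Longrightarrow> linear_map d e \<Phi>"
  by (simp add: completely_positive_def)

lemma linear_map_carrier: "linear_map d e \<Phi> \<Longrightarrow> X \<in> carrier_mat d d \<Longrightarrow> \<Phi> X \<in> carrier_mat e e"
  by (simp add: linear_map_def)

lemma instrument_trace:
  assumes "instrument d e S J" "X \<in> carrier_mat d d"
  shows "(\<Sum>x\<in>S. mtrace (J x X)) = mtrace X"
proof -
  have "J x X \<in> carrier_mat e e" if "x \<in> S" for x
    using assms that by (auto simp: instrument_def intro: linear_map_carrier[OF completely_positive_linear])
  then show ?thesis
    using assms mtrace_msum[of S "\<lambda>x. J x X" e]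
    by (simp add: instrument_def trace_preserving_def)
qed

text \<open>The fresh input is in a product state with the memory, so the trace against P acts on
  \<rho> alone and leaves the memory X as a tensor factor.\<close>

lemma local_map_biased_minus_uniform_kron:
  assumes P: "P \<in> pauli_strings n" and X: "X \<in> carrier_mat M M"
    and \<rho>: "\<rho> \<in> carrier_mat (2 ^ n * A) (2 ^ n * A)"
  shows "local_map M A (2 ^ n) (2 ^ n) (pauli_channel n (biased_pauli n \<alpha> P)) (kron X \<rho>) -
      local_map M A (2 ^ n) (2 ^ n) (pauli_channel n (uniform_pauli n)) (kron X \<rho>) =
    kron X (of_real (\<alpha> / 2 ^ n) \<cdot>\<^sub>m kron (pauli_op P) (pauli_marginal n A P \<rho>))"
    (is "?L = ?R")
proof (rule eq_mat_tripleI[of _ M "2 ^ n" A])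
  let ?d = "2 ^ n :: nat"
  let ?PR = "of_real (\<alpha> / 2 ^ n) \<cdot>\<^sub>m kron (pauli_op P) (pauli_marginal n A P \<rho>)"
  have k: "kron (pauli_op P) (pauli_marginal n A P \<rho>) \<in> carrier_mat (?d * A) (?d * A)"
    by (intro kron_carrier pauli_op_carrier[OF P] pauli_marginal_carrier)
  then have PR: "?PR \<in> carrier_mat (?d * A) (?d * A)" by simp
  show "?L \<in> carrier_mat (M * ?d * A) (M * ?d * A)" by (intro minus_carrier_mat local_map_carrier)
  show "?R \<in> carrier_mat (M * ?d * A) (M * ?d * A)" using kron_carrier[OF X PR] by (simp add: mult.assoc)
  fix a b c a' b' c' :: nat
  assume *: "a < M" "a' < M" "b < ?d" "b' < ?d" "c < A" "c' < A"
  \<comment> \<open>The channel groups the registers as (W S) A, the state X \<otimes> \<rho> as W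
    (S A).\<close>
  have assoc: "(x * ?d + y) * A + z = x * (?d * A) + (y * A + z)" for x y z
    by (simp add: algebra_simps)
  have krho: "kron X \<rho> $$ ((a * ?d + t) * A + c, (a' * ?d + s) * A + c') =
      X $$ (a, a') * \<rho> $$ (t * A + c, s * A + c')" if "s < ?d" "t < ?d" for s t
    unfolding assoc using * that by (intro kron_index[OF X \<rho>] prod_index_less)
  have "?L $$ ((a * ?d + b) * A + c, (a' * ?d + b') * A + c') =
      of_real \<alpha> / 2 ^ n * pauli_op P $$ (b, b') * (\<Sum>s<?d. \<Sum>t<?d. pauli_op P $$ (s, t) *
        (X $$ (a, a') * \<rho> $$ (t * A + c, s * A + c')))"
    using * triple_index_less[of a M b ?d c A] triple_index_less[of a' M b' ?d c' A]
    by (simp add: local_map_biased_minus_uniform_index[OF P] krho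
      carrier_matD[OF local_map_carrier])
  also have "\<dots> = X $$ (a, a') * (of_real (\<alpha> / 2 ^ n) * (pauli_op P $$ (b, b') * pauli_marginal n A P \<rho> $$ (c, c')))"
    using * by (simp add: pauli_marginal_def sum_distrib_left mult_ac)
  also have "\<dots> = X $$ (a, a') * ?PR $$ (b * A + c, b' * A + c')"
    using * by (simp add: smult_mat_index[OF k] prod_index_less
      kron_index[OF pauli_op_carrier[OF P] pauli_marginal_carrier])
  also have "\<dots> = ?R $$ ((a * ?d + b) * A + c, (a' * ?d + b') * A + c')"
    unfolding assoc using * by (intro kron_index[OF X PR, symmetric] prod_index_less)
  finally show "?L $$ ((a * ?d + b) * A + c, (a' * ?d + b') * A + c') =
      ?R $$ ((a * ?d + b) * A + c, (a' * ?d + b') * A + c')" .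
qed

section \<open>Input-restricted protocols as processes\<close>

definition input_step ::
  "nat \<Rightarrow> input_protocol \<Rightarrow> (pauli list \<Rightarrow> real) \<Rightarrow> nat list \<Rightarrow> nat \<Rightarrow> complex mat \<Rightarrow> complex mat" where
  "input_step n T p h x X = in_instr T h x
     (local_map (in_memdim T (length h)) (in_ancdim T (length h)) (2 ^ n) (2 ^ n) (pauli_channel n p)
       (kron X (in_input T h)))"

lemma run_input_step:
  "k \<le> length h \<Longrightarrow> run (input_step n T p) (1\<^sub>m 1) h k = input_memory n T p h k"
  by (induction k) (auto simp: input_step_def min_def)

lemma valid_process_input:
  assumes T: "valid_input_protocol n N T" and p: "pauli_distribution n p"
  shows "valid_process (in_memdim T) N (in_nout T) (input_step n T p)"
  unfolding valid_process_def
proof (intro allI impI ballI conjI)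
  fix k h assume k: "k < N" and h: "h \<in> records (in_nout T) k"
  let ?M = "in_memdim T k" and ?A = "in_ancdim T k"
  let ?E = "local_map ?M ?A (2 ^ n) (2 ^ n) (pauli_channel n p)"
  have \<rho>: "density (2 ^ n * ?A) (in_input T h)"
    and J: "instrument (?M * (2 ^ n * ?A)) (in_memdim T (Suc k)) {..<in_nout T h} (in_instr T h)"
    using T k h by (auto simp: valid_input_protocol_def)
  have \<rho>C: "in_input T h \<in> carrier_mat (2 ^ n * ?A) (2 ^ n * ?A)" and \<rho>psd: "psd (2 ^ n * ?A) (in_input T h)"
    using \<rho> by (auto simp: density_def intro: psd_carrier)
  have st: "input_step n T p h x X = in_instr T h x (?E (kron X (in_input T h)))" for x X
    by (simp add: input_step_def length_records[OF h])
  note assoc = mult.assoc[of ?M "2 ^ n" ?A]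
  have E: "linear_map (?M * (2 ^ n * ?A)) (?M * (2 ^ n * ?A)) ?E"
    using linear_map_local_map_pauli_channel[of ?M n ?A p] unfolding assoc .
  note lin = linear_map_compose[OF linear_map_kron_right[OF \<rho>C, of ?M] E]
  {
    fix x assume x: "x < in_nout T h"
    then have cp: "completely_positive (?M * (2 ^ n * ?A)) (in_memdim T (Suc k)) (in_instr T h x)"
      using J by (simp add: instrument_def)
    show "linear_map ?M (in_memdim T (Suc k)) (input_step n T p h x)"
      using linear_map_compose[OF lin completely_positive_linear[OF cp]] by (simp add: st[abs_def])
    fix X assume X: "psd ?M X"
    have "psd (?M * (2 ^ n * ?A)) (?E (kron X (in_input T h)))"
      using psd_local_map_pauli_channel[of ?M n ?A, OF _ p] psd_kron[OF X \<rho>psd] unfolding assoc by blast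
    then show "psd (in_memdim T (Suc k)) (input_step n T p h x X)"
      unfolding st by (rule completely_positive_psd[OF cp])
  }
  fix X :: "complex mat" assume X: "X \<in> carrier_mat ?M ?M"
  have "(\<Sum>x<in_nout T h. mtrace (input_step n T p h x X)) = mtrace (?E (kron X (in_input T h)))"
    unfolding st by (rule instrument_trace[OF J linear_map_carrier[OF lin X]])
  also have "\<dots> = mtrace (kron X (in_input T h))"
    using kron_carrier[OF X \<rho>C] p by (intro mtrace_local_map_pauli_channel) (simp_all add: assoc)
  also have "\<dots> = mtrace X"
    using \<rho> by (simp add: mtrace_kron[OF X \<rho>C] density_def)
  finally show "(\<Sum>x<in_nout T h. mtrace (input_step n T p h x X)) = mtrace X" .
qed

text \<open>The domination of P \<otimes> R_P by 1 \<otimes> K_P survives tensoring with the memory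
  and the instrument. As the instrument preserves the trace in total, all outcomes together cost
  \<alpha> Tr X Tr K_P per string.\<close>

lemma input_step_advantage:
  assumes T: "valid_input_protocol n N T" and red: "input_reduction_restricted n N T"
    and \<alpha>: "0 \<le> \<alpha>" and k: "k < N" and h: "h \<in> records (in_nout T) k" and X: "psd (in_memdim T k) X"
  shows "\<exists>Z. (\<forall>P\<in>pauli_strings n. \<forall>x<in_nout T h. psd (in_memdim T (Suc k)) (Z P x) \<and>
      psd (in_memdim T (Suc k)) (Z P x -
        (input_step n T (biased_pauli n \<alpha> P) h x X - input_step n T (uniform_pauli n) h x X))) \<and>
    (\<Sum>P\<in>pauli_strings n. \<Sum>x<in_nout T h. Re (mtrace (Z P x))) \<le>
      2 * \<alpha> * (2 ^ n * sqrt (2 ^ n)) * Re (mtrace X)"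
proof -
  let ?M = "in_memdim T k" and ?A = "in_ancdim T k" and ?e = "in_memdim T (Suc k)"
  let ?d = "2 ^ n :: nat" and ?\<rho> = "in_input T h"
  let ?I = "1\<^sub>m ?d :: complex mat"
  have \<rho>: "density (?d * ?A) ?\<rho>"
    and J: "instrument (?M * (?d * ?A)) ?e {..<in_nout T h} (in_instr T h)" and A: "0 < ?A"
    using T k h by (auto simp: valid_input_protocol_def)
  have \<rho>psd: "psd (?d * ?A) ?\<rho>" and \<rho>tr: "mtrace ?\<rho> = 1" using \<rho> by (auto simp: density_def)
  note \<rho>C = psd_carrier[OF \<rho>psd] and XC = psd_carrier[OF X]
  have "psd (?d * ?A) (kron ?I (ptrace_left ?d ?A ?\<rho>) - ?\<rho>)"
    using red k h by (auto simp: input_reduction_restricted_def reduction_criterion_def loewner_le_def)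
  \<comment> \<open>With \<delta> = 1 / dim A the added multiple of the identity has trace 1, as
    much as the marginal of \<rho>; this is the origin of the factor 2.\<close>
  moreover have "0 < 1 / real ?A" using A by simp
  ultimately obtain K where K: "\<And>P. P \<in> pauli_strings n \<Longrightarrow> psd ?A (K P)"
    and KR: "\<And>P. P \<in> pauli_strings n \<Longrightarrow>
      psd (?d * ?A) (kron ?I (K P) - kron (pauli_op P) (pauli_marginal n ?A P ?\<rho>))"
    and KS: "psd ?A (of_real (2 ^ n * sqrt (2 ^ n)) \<cdot>\<^sub>m (ptrace_left ?d ?A ?\<rho> + of_real (1 / real ?A) \<cdot>\<^sub>m 1\<^sub>m ?A)
      - msum ?A (pauli_strings n) K)"
    using reduction_criterion_pauli_bound[OF \<rho>psd] by metis
  let ?s = "complex_of_real (\<alpha> / 2 ^ n)"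
  have s: "0 \<le> ?s" using \<alpha> by (simp add: less_eq_complex_def)
  define Y where "Y P = kron X (?s \<cdot>\<^sub>m kron ?I (K P))" for P
  define Z where "Z P x = in_instr T h x (Y P)" for P x
  have cp: "completely_positive (?M * (?d * ?A)) ?e (in_instr T h x)" if "x < in_nout T h" for x
    using J that by (simp add: instrument_def)
  have Y: "psd (?M * (?d * ?A)) (Y P)" if "P \<in> pauli_strings n" for P
    unfolding Y_def by (intro psd_kron psd_smult psd_one X K that s)
  have tr: "(\<Sum>x<in_nout T h. Re (mtrace (Z P x))) = \<alpha> * Re (mtrace X) * Re (mtrace (K P))"
    if P: "P \<in> pauli_strings n" for P
  proof -
    note KC = psd_carrier[OF K[OF P]]
    have IK: "kron ?I (K P) \<in> carrier_mat (?d * ?A) (?d * ?A)" using KC by (intro kron_carrier) auto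
    have "(\<Sum>x<in_nout T h. mtrace (Z P x)) = mtrace (Y P)"
      unfolding Z_def by (rule instrument_trace[OF J psd_carrier[OF Y[OF P]]])
    \<comment> \<open>The trace 2^n of the identity on S cancels the denominator of \<alpha> /
      2^n.\<close>
    also have "\<dots> = mtrace X * (?s * (of_nat ?d * mtrace (K P)))"
      by (simp only: Y_def mtrace_kron[OF XC smult_carrier_mat[OF IK]] mtrace_smult[OF IK]
        mtrace_kron[OF one_carrier_mat KC] mtrace_one)
    finally have "(\<Sum>x<in_nout T h. mtrace (Z P x)) = of_real \<alpha> * mtrace X * mtrace (K P)" by simp
    moreover have "Im (mtrace X) = 0"
      using psd_mtrace_nonneg[OF X] by (simp add: less_eq_complex_def)
    ultimately show ?thesis by (simp flip: Re_sum)
  qed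
  have trK: "(\<Sum>P\<in>pauli_strings n. Re (mtrace (K P))) \<le> 2 * (2 ^ n * sqrt (2 ^ n))"
  proof -
    let ?\<sigma> = "ptrace_left ?d ?A ?\<rho> + of_real (1 / real ?A) \<cdot>\<^sub>m 1\<^sub>m ?A"
    have "mtrace ?\<sigma> = 2"
      using A \<rho>tr by (simp add: mtrace_add[of _ ?A] mtrace_smult[of _ ?A] mtrace_ptrace_left[OF \<rho>C])
    moreover have "0 \<le> mtrace (of_real (2 ^ n * sqrt (2 ^ n)) \<cdot>\<^sub>m ?\<sigma> - msum ?A (pauli_strings n) K)"
      by (rule psd_mtrace_nonneg[OF KS])
    moreover have "mtrace (msum ?A (pauli_strings n) K) = (\<Sum>P\<in>pauli_strings n. mtrace (K P))"
      using K psd_carrier by (intro mtrace_msum) blast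
    ultimately have "0 \<le> of_real (2 ^ n * sqrt (2 ^ n)) * 2 - (\<Sum>P\<in>pauli_strings n. mtrace (K P))"
      by (simp add: mtrace_minus[of _ ?A] mtrace_smult[of _ ?A])
    then have "0 \<le> Re (of_real (2 ^ n * sqrt (2 ^ n)) * 2 - (\<Sum>P\<in>pauli_strings n. mtrace (K P)))"
      by (simp add: less_eq_complex_def)
    then show ?thesis by simp
  qed
  show ?thesis
  proof (intro exI[of _ Z] conjI ballI allI impI)
    fix P x assume P: "P \<in> pauli_strings n" and x: "x < in_nout T h"
    note KC = psd_carrier[OF K[OF P]]
    let ?PR = "kron (pauli_op P) (pauli_marginal n ?A P ?\<rho>)"
    have IK: "kron ?I (K P) \<in> carrier_mat (?d * ?A) (?d * ?A)" using KC by (intro kron_carrier) auto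
    have PR: "?PR \<in> carrier_mat (?d * ?A) (?d * ?A)"
      by (intro kron_carrier pauli_op_carrier[OF P] pauli_marginal_carrier)
    note lin = completely_positive_linear[OF cp[OF x]]
    show "psd ?e (Z P x)"
      unfolding Z_def by (rule completely_positive_psd[OF cp[OF x] Y[OF P]])
    let ?E = "\<lambda>p. local_map ?M ?A ?d ?d (pauli_channel n p) (kron X ?\<rho>)"
    have EC: "?E p \<in> carrier_mat (?M * (?d * ?A)) (?M * (?d * ?A))" for p
      using local_map_carrier[of ?M ?A ?d ?d] by (simp add: mult.assoc)
    have "Y P - (?E (biased_pauli n \<alpha> P) - ?E (uniform_pauli n)) = kron X (?s \<cdot>\<^sub>m (kron ?I (K P) - ?PR))"
    proof -
      have "?s \<cdot>\<^sub>m (kron ?I (K P) - ?PR) = ?s \<cdot>\<^sub>m kron ?I (K P) - ?s \<cdot>\<^sub>m ?PR"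
        using IK PR by (intro eq_matI) (auto simp: algebra_simps)
      then show ?thesis
        by (simp only: local_map_biased_minus_uniform_kron[OF P XC \<rho>C] Y_def
          kron_minus_right[OF XC smult_carrier_mat[OF IK] smult_carrier_mat[OF PR]])
    qed
    moreover have "psd (?M * (?d * ?A)) (kron X (?s \<cdot>\<^sub>m (kron ?I (K P) - ?PR)))"
      by (intro psd_kron psd_smult X KR P s)
    ultimately have "psd ?e (in_instr T h x (Y P - (?E (biased_pauli n \<alpha> P) - ?E (uniform_pauli n))))"
      using completely_positive_psd[OF cp[OF x]] by simp
    moreover have "in_instr T h x (Y P - (?E (biased_pauli n \<alpha> P) - ?E (uniform_pauli n))) =
        Z P x - (input_step n T (biased_pauli n \<alpha> P) h x X - input_step n T (uniform_pauli n) h x X)"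
      using EC psd_carrier[OF Y[OF P]] minus_carrier_mat[OF EC]
      by (simp add: linear_map_minus[OF lin] Z_def input_step_def length_records[OF h])
    ultimately show "psd ?e (Z P x -
        (input_step n T (biased_pauli n \<alpha> P) h x X - input_step n T (uniform_pauli n) h x X))"
      by simp
  next
    have "(\<Sum>P\<in>pauli_strings n. \<Sum>x<in_nout T h. Re (mtrace (Z P x))) =
        \<alpha> * Re (mtrace X) * (\<Sum>P\<in>pauli_strings n. Re (mtrace (K P)))"
      by (simp add: tr sum_distrib_left)
    also have "\<dots> \<le> \<alpha> * Re (mtrace X) * (2 * (2 ^ n * sqrt (2 ^ n)))"
      using \<alpha> psd_mtrace_nonneg[OF X] trK by (intro mult_left_mono) (auto simp: less_eq_complex_def)
    finally show "(\<Sum>P\<in>pauli_strings n. \<Sum>x<in_nout T h. Re (mtrace (Z P x))) \<le>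
        2 * \<alpha> * (2 ^ n * sqrt (2 ^ n)) * Re (mtrace X)" by (simp add: mult_ac)
  qed
qed

lemma input_lower_bound:
  assumes "1 \<le> n" "0 < \<epsilon>" "\<epsilon> \<le> 1 / 3" and T: "valid_input_protocol n N T"
    and "input_reduction_restricted n N T" and "input_protocol_solves n N \<epsilon> T"
  shows "real N \<ge> 1 / 24 * (1 / \<epsilon>) * 2 powr (real n / 2)"
proof (rule pauli_learning_lower_bound[OF assms(1-3)])
  show "solves_pauli_learning n \<epsilon> (records (in_nout T) N) (input_prob n N T) (in_est T)"
    using assms(6) by (simp add: input_protocol_solves_def)
  show "valid_process (in_memdim T) N (in_nout T) (input_step n T p)" if "pauli_distribution n p" for p
    by (rule valid_process_input[OF T that])
  show "psd (in_memdim T 0) (1\<^sub>m 1)"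
    using T psd_one[of 1] by (simp add: valid_input_protocol_def)
  show "input_prob n N T p h = Re (mtrace (run (input_step n T p) (1\<^sub>m 1) h N))"
    if "h \<in> records (in_nout T) N" for p h
    unfolding input_prob_def by (subst run_input_step) (simp_all add: length_records[OF that])
  show "mtrace (1\<^sub>m 1) = 1" by simp
qed (rule input_step_advantage[OF T assms(5)], use assms(2) in simp)

section \<open>Measurement-restricted protocols\<close>

text \<open>This is Tr (F Y) with the entries of Y read in transposed order, z i j = Y_ji. Taking z
  as a function lets reduced states be written as sums in place.\<close>

definition mat_pairing :: "nat \<Rightarrow> complex mat \<Rightarrow> (nat \<Rightarrow> nat \<Rightarrow> complex) \<Rightarrow> complex" where
  "mat_pairing m F z = (\<Sum>i<m. \<Sum>j<m. F $$ (i, j) * z i j)"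

lemma mat_pairing_minus:
  "A \<in> carrier_mat m m \<Longrightarrow> B \<in> carrier_mat m m \<Longrightarrow> mat_pairing m (A - B) z = mat_pairing m A z - mat_pairing m B z"
  by (auto simp: mat_pairing_def left_diff_distrib sum_subtractf)

lemma mat_pairing_add:
  "A \<in> carrier_mat m m \<Longrightarrow> B \<in> carrier_mat m m \<Longrightarrow> mat_pairing m (A + B) z = mat_pairing m A z + mat_pairing m B z"
  by (auto simp: mat_pairing_def distrib_right sum.distrib)

lemma mat_pairing_smult:
  "A \<in> carrier_mat m m \<Longrightarrow> mat_pairing m (c \<cdot>\<^sub>m A) z = c * mat_pairing m A z"
  by (auto simp: mat_pairing_def sum_distrib_left mult.assoc)

lemma mat_pairing_msum: "mat_pairing m (msum m S F) z = (\<Sum>x\<in>S. mat_pairing m (F x) z)"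
proof -
  have "mat_pairing m (msum m S F) z = (\<Sum>i<m. \<Sum>j<m. \<Sum>x\<in>S. F x $$ (i, j) * z i j)"
    by (simp add: mat_pairing_def sum_distrib_right)
  also have "\<dots> = (\<Sum>x\<in>S. mat_pairing m (F x) z)"
    by (simp add: mat_pairing_def sum.swap[of _ _ S])
  finally show ?thesis .
qed

text \<open>Measuring 1 \<otimes> F amounts to measuring F on the marginal: the sum over s is the
  trace over the first factor.\<close>

lemma mat_pairing_kron_one:
  assumes "F \<in> carrier_mat m m"
  shows "mat_pairing (d * m) (kron (1\<^sub>m d) F) y = mat_pairing m F (\<lambda>a a'. \<Sum>s<d. y (s * m + a) (s * m + a'))"
proof -
  have "mat_pairing (d * m) (kron (1\<^sub>m d) F) y = (\<Sum>s<d. \<Sum>a<m. \<Sum>s'<d.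
      if s' = s then (\<Sum>a'<m. F $$ (a, a') * y (s * m + a) (s' * m + a')) else 0)"
    unfolding mat_pairing_def sum_lessThan_mult
    by (intro sum.cong refl) (auto simp: kron_index[OF one_carrier_mat assms] intro!: sum.neutral)
  also have "\<dots> = (\<Sum>s<d. \<Sum>a<m. \<Sum>a'<m. F $$ (a, a') * y (s * m + a) (s * m + a'))"
    by simp
  also have "\<dots> = (\<Sum>a<m. \<Sum>a'<m. \<Sum>s<d. F $$ (a, a') * y (s * m + a) (s * m + a'))"
    by (simp add: sum.swap[of _ _ "{..<d}"])
  finally show ?thesis by (simp add: mat_pairing_def sum_distrib_left)
qed

lemma mtrace_ptrace_left_kron_mult:
  assumes "E \<in> carrier_mat d d" "Y \<in> carrier_mat (d * m) (d * m)"
  shows "mtrace (ptrace_left d m (kron E (1\<^sub>m m) * Y)) =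
    mat_pairing d E (\<lambda>i j. \<Sum>c<m. Y $$ (j * m + c, i * m + c))"
proof -
  have "mtrace (ptrace_left d m (kron E (1\<^sub>m m) * Y)) =
      (\<Sum>c<m. \<Sum>i<d. \<Sum>j<d. E $$ (i, j) * Y $$ (j * m + c, i * m + c))"
    by (simp add: mtrace_carrier[OF ptrace_left_carrier] ptrace_left_kron_mult_index[OF assms])
  also have "\<dots> = (\<Sum>i<d. \<Sum>j<d. \<Sum>c<m. E $$ (i, j) * Y $$ (j * m + c, i * m + c))"
    by (simp add: sum.swap[of _ _ "{..<m}"])
  finally show ?thesis by (simp add: mat_pairing_def sum_distrib_left)
qed

lemma ptrace_left_kron_mult_diff:
  assumes E: "E \<in> carrier_mat d d" and F: "F \<in> carrier_mat d d" and Y: "Y \<in> carrier_mat (d * m) (d * m)"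
  shows "ptrace_left d m (kron (E - F) (1\<^sub>m m) * Y) =
    ptrace_left d m (kron E (1\<^sub>m m) * Y) - ptrace_left d m (kron F (1\<^sub>m m) * Y)"
proof (rule eq_matI)
  fix i j assume "i < dim_row (ptrace_left d m (kron E (1\<^sub>m m) * Y) - ptrace_left d m (kron F (1\<^sub>m m) * Y))"
    "j < dim_col (ptrace_left d m (kron E (1\<^sub>m m) * Y) - ptrace_left d m (kron F (1\<^sub>m m) * Y))"
  then have ij: "i < m" "j < m" by (auto simp: ptrace_left_def)
  then show "ptrace_left d m (kron (E - F) (1\<^sub>m m) * Y) $$ (i, j) =
      (ptrace_left d m (kron E (1\<^sub>m m) * Y) - ptrace_left d m (kron F (1\<^sub>m m) * Y)) $$ (i, j)"
    using E F carrier_matD[OF ptrace_left_carrier[of d m]]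
    by (simp add: ptrace_left_kron_mult_index[OF minus_carrier_mat[OF F] Y] ptrace_left_kron_mult_index[OF E Y]
      ptrace_left_kron_mult_index[OF F Y] left_diff_distrib sum_subtractf)
qed (auto simp: ptrace_left_def)

lemma linear_map_ptrace_left_kron_mult:
  assumes E: "E \<in> carrier_mat d d"
  shows "linear_map (d * m) m (\<lambda>Y. ptrace_left d m (kron E (1\<^sub>m m) * Y))"
  unfolding linear_map_def
proof (intro conjI ballI allI)
  fix X Y :: "complex mat" and c
  assume X: "X \<in> carrier_mat (d * m) (d * m)"
  show "ptrace_left d m (kron E (1\<^sub>m m) * X) \<in> carrier_mat m m" by simp
  have dim [simp]: "dim_row (ptrace_left d m Z) = m" "dim_col (ptrace_left d m Z) = m" for Z
    by (auto simp: ptrace_left_def)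
  note idx = ptrace_left_kron_mult_index[OF E]
  show "ptrace_left d m (kron E (1\<^sub>m m) * (c \<cdot>\<^sub>m X)) = c \<cdot>\<^sub>m ptrace_left d m (kron E (1\<^sub>m m) * X)"
  proof (rule eq_matI, simp_all only: dim index_smult_mat)
    fix i j assume ij: "i < m" "j < m"
    then show "ptrace_left d m (kron E (1\<^sub>m m) * (c \<cdot>\<^sub>m X)) $$ (i, j) =
        c * ptrace_left d m (kron E (1\<^sub>m m) * X) $$ (i, j)"
      unfolding idx[OF smult_carrier_mat[OF X] ij] idx[OF X ij] sum_distrib_left
      by (intro sum.cong refl) (simp add: smult_mat_index[OF X] prod_index_less)
  qed
  assume Y: "Y \<in> carrier_mat (d * m) (d * m)"
  show "ptrace_left d m (kron E (1\<^sub>m m) * (X + Y)) =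
      ptrace_left d m (kron E (1\<^sub>m m) * X) + ptrace_left d m (kron E (1\<^sub>m m) * Y)"
  proof (rule eq_matI, simp_all only: dim index_add_mat)
    fix i j assume ij: "i < m" "j < m"
    have "(X + Y) $$ (x * m + i, y * m + j) = X $$ (x * m + i, y * m + j) + Y $$ (x * m + i, y * m + j)"
      if "x < d" "y < d" for x y
      using carrier_matD[OF Y] prod_index_less[OF that(1) ij(1)] prod_index_less[OF that(2) ij(2)] by simp
    then show "ptrace_left d m (kron E (1\<^sub>m m) * (X + Y)) $$ (i, j) =
        ptrace_left d m (kron E (1\<^sub>m m) * X) $$ (i, j) + ptrace_left d m (kron E (1\<^sub>m m) * Y) $$ (i, j)"
      unfolding idx[OF add_carrier_mat[OF Y] ij] idx[OF X ij] idx[OF Y ij] sum.distrib[symmetric]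
      by (intro sum.cong refl) (simp add: distrib_left)
  qed
qed

text \<open>Passage to the Heisenberg picture. The disturbance Y \<mapsto> \<alpha> / 2^n Tr (P Y) P
  on S is its own adjoint for the trace pairing, so E applied to the disturbance of X acts as
  \<alpha> / 2^n P \<otimes> R_P applied to X, with R_P formed from E.\<close>

lemma ptrace_left_kron_local_map_diff:
  assumes P: "P \<in> pauli_strings n" and E: "E \<in> carrier_mat (2 ^ n * A) (2 ^ n * A)"
    and X: "X \<in> carrier_mat (2 ^ n * A * r) (2 ^ n * A * r)"
  shows "ptrace_left (2 ^ n * A) r (kron E (1\<^sub>m r) *
      (local_map 1 (A * r) (2 ^ n) (2 ^ n) (pauli_channel n (biased_pauli n \<alpha> P)) X -
       local_map 1 (A * r) (2 ^ n) (2 ^ n) (pauli_channel n (uniform_pauli n)) X)) =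
    ptrace_left (2 ^ n * A) r
      (kron (of_real (\<alpha> / 2 ^ n) \<cdot>\<^sub>m kron (pauli_op P) (pauli_marginal n A P E)) (1\<^sub>m r) * X)"
    (is "ptrace_left _ _ (_ * ?\<Delta>) = ptrace_left _ _ (kron ?F _ * _)")
proof (rule eq_matI)
  let ?d = "2 ^ n :: nat" and ?s = "complex_of_real (\<alpha> / 2 ^ n)"
  let ?N = "?d * A * r"
  fix c c' assume "c < dim_row (ptrace_left (?d * A) r (kron ?F (1\<^sub>m r) * X))"
    "c' < dim_col (ptrace_left (?d * A) r (kron ?F (1\<^sub>m r) * X))"
  then have c: "c < r" "c' < r" by (auto simp: ptrace_left_def)
  have \<Delta>C: "?\<Delta> \<in> carrier_mat ?N ?N"
    using local_map_carrier[of 1 "A * r" ?d ?d] by (intro minus_carrier_mat) (simp add: mult.assoc)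
  have PR: "kron (pauli_op P) (pauli_marginal n A P E) \<in> carrier_mat (?d * A) (?d * A)"
    by (intro kron_carrier pauli_op_carrier[OF P] pauli_marginal_carrier)
  have \<Delta>: "?\<Delta> $$ ((s' * A + a') * r + c, (s * A + a) * r + c') = ?s * pauli_op P $$ (s', s) *
      (\<Sum>u<?d. \<Sum>t<?d. pauli_op P $$ (u, t) * X $$ ((t * A + a') * r + c, (u * A + a) * r + c'))"
    if "s < ?d" "s' < ?d" "a < A" "a' < A" for s s' a a'
  proof -
    have "a * r + c' < A * r" "a' * r + c < A * r" using that c by (auto intro: prod_index_less)
    \<comment> \<open>No factor stands to the left of S, hence the arguments 0, 1, 0.\<close>
    note * = local_map_biased_minus_uniform_index[OF P, of 0 1 0 s' s "a' * r + c" "A * r" "a * r + c'" \<alpha> X]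
    have assoc: "(x * A + y) * r + z = x * (A * r) + (y * r + z)" for x y z
      by (simp add: algebra_simps)
    have "s' * (A * r) + (a' * r + c) < ?d * (A * r)" "s * (A * r) + (a * r + c') < ?d * (A * r)"
      using that c by (auto intro!: prod_index_less)
    then show ?thesis
      using * that c carrier_matD[OF local_map_carrier[of 1 "A * r" ?d ?d]] prod_index_less[of a' A c r]
        prod_index_less[of a A c' r]
      by (simp add: assoc)
  qed
  \<comment> \<open>One Pauli entry is the output of the disturbance and meets E, the other belongs
    to its trace and meets X. Reordering the sixfold sum exchanges their roles: the first then forms
    R_P and the second the factor P of the new effect.\<close>
  let ?t = "\<lambda>u a t a' s' s. ?s * (pauli_op P $$ (s', s) * E $$ (s * A + a, s' * A + a')) *
      (pauli_op P $$ (u, t) * X $$ ((t * A + a') * r + c, (u * A + a) * r + c'))"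
  have "ptrace_left (?d * A) r (kron E (1\<^sub>m r) * ?\<Delta>) $$ (c, c') =
      (\<Sum>s<?d. \<Sum>a<A. \<Sum>s'<?d. \<Sum>a'<A. \<Sum>u<?d. \<Sum>t<?d. ?t u a t a' s' s)"
    unfolding ptrace_left_kron_mult_index[OF E \<Delta>C c] sum_lessThan_mult
    by (intro sum.cong refl, simp only: \<Delta> lessThan_iff) (simp add: sum_distrib_left mult_ac)
  also have "\<dots> = (\<Sum>(s, a, s', a', u, t)\<in>{..<?d} \<times> {..<A} \<times> {..<?d} \<times> {..<A} \<times> {..<?d} \<times> {..<?d}.
      ?t u a t a' s' s)"
    by (simp add: sum.cartesian_product)
  also have "\<dots> = (\<Sum>(u, a, t, a', s', s)\<in>{..<?d} \<times> {..<A} \<times> {..<?d} \<times> {..<A} \<times> {..<?d} \<times> {..<?d}.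
      ?t u a t a' s' s)"
    by (rule sum.reindex_bij_witness[of _ "\<lambda>(u, a, t, a', s', s). (s, a, s', a', u, t)"
          "\<lambda>(s, a, s', a', u, t). (u, a, t, a', s', s)"]) auto
  also have "\<dots> = (\<Sum>u<?d. \<Sum>a<A. \<Sum>t<?d. \<Sum>a'<A. \<Sum>s'<?d. \<Sum>s<?d. ?t u a t a' s' s)"
    by (simp add: sum.cartesian_product)
  also have "\<dots> = ptrace_left (?d * A) r (kron ?F (1\<^sub>m r) * X) $$ (c, c')"
    unfolding ptrace_left_kron_mult_index[OF smult_carrier_mat[OF PR] X c] sum_lessThan_mult
  proof (intro sum.cong refl)
    fix u a t a' assume *: "u \<in> {..<?d}" "a \<in> {..<A}" "t \<in> {..<?d}" "a' \<in> {..<A}"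
    then have "?F $$ (u * A + a, t * A + a') = ?s * (pauli_op P $$ (u, t) * pauli_marginal n A P E $$ (a, a'))"
      by (subst smult_mat_index[OF PR])
        (auto simp: prod_index_less kron_index[OF pauli_op_carrier[OF P] pauli_marginal_carrier])
    moreover have "pauli_marginal n A P E $$ (a, a') =
        (\<Sum>s'<?d. \<Sum>s<?d. pauli_op P $$ (s', s) * E $$ (s * A + a, s' * A + a'))"
      using * by (simp add: pauli_marginal_def)
    ultimately show "(\<Sum>s'<?d. \<Sum>s<?d. ?t u a t a' s' s) =
        ?F $$ (u * A + a, t * A + a') * X $$ ((t * A + a') * r + c, (u * A + a) * r + c')"
      by (simp add: sum_distrib_left sum_distrib_right mult_ac)
  qed
  finally show "ptrace_left (?d * A) r (kron E (1\<^sub>m r) * ?\<Delta>) $$ (c, c') =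
      ptrace_left (?d * A) r (kron ?F (1\<^sub>m r) * X) $$ (c, c')" .
qed (auto simp: ptrace_left_def)

text \<open>Nonnegative diagonal entries with sum 0 vanish, and with each of them its whole
  row.\<close>

lemma psd_mtrace_zero:
  assumes A: "psd d A" and "mtrace A = 0"
  shows "A = 0\<^sub>m d d"
proof (rule eq_matI)
  have pos: "\<And>f. 0 \<le> qform d (\<lambda>i j. A $$ (i, j)) f" using A by (simp add: psd_iff_qform)
  have "\<forall>i\<in>{..<d}. A $$ (i, i) = 0"
    using assms(2) qform_nonneg_diag[OF pos]
    unfolding mtrace_carrier[OF psd_carrier[OF A]] by (subst (asm) sum_nonneg_eq_0_iff) auto
  then show "A $$ (i, j) = 0\<^sub>m d d $$ (i, j)" if "i < dim_row (0\<^sub>m d d)" "j < dim_col (0\<^sub>m d d)" for i j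
    using qform_nonneg_zero_diag[OF pos, of i j] that by auto
qed (use psd_carrier[OF A] in auto)

text \<open>The restriction speaks about outcomes of positive trace and is scaled back by that
  trace; an outcome of trace 0 has E = 0, where the inequality is trivial.\<close>

lemma povm_reduction_psd:
  assumes "povm_reduction_restriction d m S E" "x \<in> S" and E: "psd (d * m) (E x)"
  shows "psd (d * m) (kron (1\<^sub>m d) (ptrace_left d m (E x)) - E x)"
proof (cases "mtrace (E x) = 0")
  case True
  then have "E x = 0\<^sub>m (d * m) (d * m)" by (rule psd_mtrace_zero[OF E])
  moreover have "kron (1\<^sub>m d) (ptrace_left d m (E x)) \<in> carrier_mat (d * m) (d * m)"
    by (intro kron_carrier) auto
  moreover have "psd (d * m) (kron (1\<^sub>m d) (ptrace_left d m (E x)))"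
    by (intro psd_kron psd_one psd_ptrace_left E)
  moreover have "A - 0\<^sub>m (d * m) (d * m) = A" if "A \<in> carrier_mat (d * m) (d * m)" for A :: "complex mat"
    using that by (intro eq_matI) auto
  ultimately show ?thesis by simp
next
  case False
  let ?t = "mtrace (E x)" and ?S = "kron (1\<^sub>m d) (ptrace_left d m (E x))"
  note EC = psd_carrier[OF E]
  have S: "?S \<in> carrier_mat (d * m) (d * m)" by (intro kron_carrier) auto
  have t: "0 < ?t" using psd_mtrace_nonneg[OF E] False by (simp add: order.strict_iff_order)
  then have "psd (d * m) (kron (1\<^sub>m d) ((1 / ?t) \<cdot>\<^sub>m ptrace_left d m (E x)) - (1 / ?t) \<cdot>\<^sub>m E x)"
    using assms(1,2) by (simp add: povm_reduction_restriction_def loewner_le_def)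
  then have "psd (d * m) (?t \<cdot>\<^sub>m ((1 / ?t) \<cdot>\<^sub>m ?S - (1 / ?t) \<cdot>\<^sub>m E x))"
    using t by (intro psd_smult) (auto simp: kron_smult_right)
  moreover have "?t \<cdot>\<^sub>m ((1 / ?t) \<cdot>\<^sub>m ?S - (1 / ?t) \<cdot>\<^sub>m E x) = ?S - E x"
    using carrier_matD[OF S] carrier_matD[OF EC] False by (intro eq_matI) (auto simp: field_simps)
  ultimately show ?thesis by simp
qed

section \<open>Measurement-restricted protocols as processes\<close>

definition meas_step ::
  "nat \<Rightarrow> nat \<Rightarrow> meas_protocol \<Rightarrow> (pauli list \<Rightarrow> real) \<Rightarrow> nat list \<Rightarrow> nat \<Rightarrow> complex mat \<Rightarrow> complex mat" where
  "meas_step n N T p h x X = ms_chan T (h @ [x])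
     (ptrace_left (2 ^ n * ms_ancdim T (length h)) (rest_dim n N T (Suc (length h)))
       (kron (ms_povm T h x) (1\<^sub>m (rest_dim n N T (Suc (length h)))) *
        local_map 1 (ms_ancdim T (length h) * rest_dim n N T (Suc (length h))) (2 ^ n) (2 ^ n)
          (pauli_channel n p) X))"

lemma run_meas_step:
  "k \<le> length h \<Longrightarrow> run (meas_step n N T p) (ms_init T) h k = meas_state n N T p h k"
  by (induction k) (auto simp: meas_step_def min_def take_Suc_conv_app_nth)

lemma rest_dim_Suc: "k < N \<Longrightarrow> rest_dim n N T k = 2 ^ n * ms_ancdim T k * rest_dim n N T (Suc k)"
  by (simp add: rest_dim_def prod.atLeast_Suc_lessThan)

lemma valid_process_meas:
  assumes T: "valid_meas_protocol n N T" and p: "pauli_distribution n p"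
  shows "valid_process (rest_dim n N T) N (ms_nout T) (meas_step n N T p)"
  unfolding valid_process_def
proof (intro allI impI ballI conjI)
  fix k h assume k: "k < N" and h: "h \<in> records (ms_nout T) k"
  let ?A = "ms_ancdim T k" and ?r = "rest_dim n N T (Suc k)"
  let ?E = "local_map 1 (?A * ?r) (2 ^ n) (2 ^ n) (pauli_channel n p)"
  let ?P = "\<lambda>x Y. ptrace_left (2 ^ n * ?A) ?r (kron (ms_povm T h x) (1\<^sub>m ?r) * Y)"
  have povm: "povm (2 ^ n * ?A) {..<ms_nout T h} (ms_povm T h)"
    and cptp: "\<And>x. x < ms_nout T h \<Longrightarrow> cptp ?r ?r (ms_chan T (h @ [x]))"
    using T k h by (auto simp: valid_meas_protocol_def)
  have M: "psd (2 ^ n * ?A) (ms_povm T h x)" if "x < ms_nout T h" for x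
    using povm that by (simp add: povm_def)
  have st: "meas_step n N T p h x X = ms_chan T (h @ [x]) (?P x (?E X))" for x X
    by (simp add: meas_step_def length_records[OF h])
  have dim: "1 * 2 ^ n * (?A * ?r) = 2 ^ n * ?A * ?r" by simp
  have E: "linear_map (2 ^ n * ?A * ?r) (2 ^ n * ?A * ?r) ?E"
    using linear_map_local_map_pauli_channel[of 1 n "?A * ?r" p] unfolding dim .
  note D = rest_dim_Suc[OF k, of n T]
  {
    fix x assume x: "x < ms_nout T h"
    then have cp: "completely_positive ?r ?r (ms_chan T (h @ [x]))"
      using cptp by (simp add: cptp_def)
    show "linear_map (rest_dim n N T k) ?r (meas_step n N T p h x)"
      using linear_map_compose[OF linear_map_compose[OF E linear_map_ptrace_left_kron_mult[OF psd_carrier[OF M[OF x]]]]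
        completely_positive_linear[OF cp]]
      by (simp add: st[abs_def] D)
    fix X assume X: "psd (rest_dim n N T k) X"
    have "psd (2 ^ n * ?A * ?r) (?E X)"
      using psd_local_map_pauli_channel[of 1 n "?A * ?r", OF _ p] X unfolding dim D by blast
    then show "psd ?r (meas_step n N T p h x X)"
      unfolding st by (intro completely_positive_psd[OF cp] psd_ptrace_left_kron_mult M x)
  }
  fix X :: "complex mat" assume "X \<in> carrier_mat (rest_dim n N T k) (rest_dim n N T k)"
  then have X: "X \<in> carrier_mat (2 ^ n * ?A * ?r) (2 ^ n * ?A * ?r)" by (simp add: D)
  have EX: "?E X \<in> carrier_mat (2 ^ n * ?A * ?r) (2 ^ n * ?A * ?r)"
    by (rule linear_map_carrier[OF E X])
  let ?z = "\<lambda>i j. \<Sum>c<?r. ?E X $$ (j * ?r + c, i * ?r + c)"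
  have "(\<Sum>x<ms_nout T h. mtrace (meas_step n N T p h x X)) =
      (\<Sum>x<ms_nout T h. mat_pairing (2 ^ n * ?A) (ms_povm T h x) ?z)"
  proof (intro sum.cong refl)
    fix x assume "x \<in> {..<ms_nout T h}"
    then have x: "x < ms_nout T h" by simp
    have "mtrace (meas_step n N T p h x X) = mtrace (?P x (?E X))"
      using cptp[OF x] unfolding st by (simp add: cptp_def trace_preserving_def)
    then show "mtrace (meas_step n N T p h x X) = mat_pairing (2 ^ n * ?A) (ms_povm T h x) ?z"
      by (simp only: mtrace_ptrace_left_kron_mult[OF psd_carrier[OF M[OF x]] EX])
  qed
  also have "\<dots> = mat_pairing (2 ^ n * ?A) (1\<^sub>m (2 ^ n * ?A)) ?z"
    using povm by (simp only: povm_def flip: mat_pairing_msum)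
  also have "\<dots> = mtrace (ptrace_left (2 ^ n * ?A) ?r (?E X))"
    using mtrace_ptrace_left_kron_mult[OF one_carrier_mat EX] EX by (simp add: kron_one)
  also have "\<dots> = mtrace (?E X)"
    by (rule mtrace_ptrace_left[OF EX])
  also have "\<dots> = mtrace X"
    using mtrace_local_map_pauli_channel[of X 1 n "?A * ?r", OF _ p] X unfolding dim by blast
  finally show "(\<Sum>x<ms_nout T h. mtrace (meas_step n N T p h x X)) = mtrace X" .
qed

text \<open>The domination is applied to the POVM element of each outcome and then paired with X. In
  the sum over outcomes the completeness relation takes the part that the normalisation of \<rho>
  has in the input model.\<close>

lemma meas_step_advantage:
  assumes T: "valid_meas_protocol n N T" and red: "meas_reduction_restricted n N T"
    and \<alpha>: "0 \<le> \<alpha>" and k: "k < N" and h: "h \<in> records (ms_nout T) k" and X: "psd (rest_dim n N T k) X"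
  shows "\<exists>Z. (\<forall>P\<in>pauli_strings n. \<forall>x<ms_nout T h. psd (rest_dim n N T (Suc k)) (Z P x) \<and>
      psd (rest_dim n N T (Suc k)) (Z P x -
        (meas_step n N T (biased_pauli n \<alpha> P) h x X - meas_step n N T (uniform_pauli n) h x X))) \<and>
    (\<Sum>P\<in>pauli_strings n. \<Sum>x<ms_nout T h. Re (mtrace (Z P x))) \<le>
      2 * \<alpha> * (2 ^ n * sqrt (2 ^ n)) * Re (mtrace X)"
proof -
  let ?A = "ms_ancdim T k" and ?r = "rest_dim n N T (Suc k)"
  let ?d = "2 ^ n :: nat" and ?E = "ms_povm T h" and ?m = "ms_nout T h"
  let ?I = "1\<^sub>m ?d :: complex mat"
  let ?c = "2 ^ n * sqrt (2 ^ n) :: real"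
  have povm: "povm (?d * ?A) {..<?m} ?E"
    and cptp: "\<And>x. x < ?m \<Longrightarrow> cptp ?r ?r (ms_chan T (h @ [x]))"
    using T k h by (auto simp: valid_meas_protocol_def)
  have M: "psd (?d * ?A) (?E x)" if "x < ?m" for x
    using povm that by (simp add: povm_def)
  have Xpsd: "psd (?d * ?A * ?r) X" using X by (simp add: rest_dim_Suc[OF k])
  note XC = psd_carrier[OF Xpsd]
  \<comment> \<open>Over all outcomes the added identities sum to 2^n times the identity on A, as
    much as the marginals Tr_S E_x; this is again the factor 2.\<close>
  define \<delta> where "\<delta> = 2 ^ n / real ?m"
  define S where "S x = ptrace_left ?d ?A (?E x) + of_real \<delta> \<cdot>\<^sub>m 1\<^sub>m ?A" for x
  have SC: "S x \<in> carrier_mat ?A ?A" for x by (simp add: S_def)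
  have "\<exists>K. (\<forall>P\<in>pauli_strings n. psd ?A (K P) \<and>
        psd (?d * ?A) (kron ?I (K P) - kron (pauli_op P) (pauli_marginal n ?A P (?E x)))) \<and>
      psd ?A (of_real ?c \<cdot>\<^sub>m S x - msum ?A (pauli_strings n) K)" if x: "x < ?m" for x
  proof -
    have "povm_reduction_restriction ?d ?A {..<?m} ?E"
      using red k h by (simp add: meas_reduction_restricted_def)
    then have r: "psd (?d * ?A) (kron ?I (ptrace_left ?d ?A (?E x)) - ?E x)"
      by (rule povm_reduction_psd) (use x M[OF x] in auto)
    have "0 < \<delta>" using x by (simp add: \<delta>_def)
    from reduction_criterion_pauli_bound[OF M[OF x] r this] show ?thesis
      unfolding S_def by metis
  qed
  then obtain K where
    KX: "\<And>x. x < ?m \<Longrightarrow> (\<forall>P\<in>pauli_strings n. psd ?A (K x P) \<and>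
        psd (?d * ?A) (kron ?I (K x P) - kron (pauli_op P) (pauli_marginal n ?A P (?E x)))) \<and>
      psd ?A (of_real ?c \<cdot>\<^sub>m S x - msum ?A (pauli_strings n) (K x))"
    by metis
  have K: "psd ?A (K x P)"
    and KR: "psd (?d * ?A) (kron ?I (K x P) - kron (pauli_op P) (pauli_marginal n ?A P (?E x)))"
    if "x < ?m" "P \<in> pauli_strings n" for x P
    using KX[OF that(1)] that(2) by auto
  have KS: "psd ?A (of_real ?c \<cdot>\<^sub>m S x - msum ?A (pauli_strings n) (K x))" if "x < ?m" for x
    using KX[OF that] by blast
  let ?s = "complex_of_real (\<alpha> / 2 ^ n)"
  have s: "0 \<le> ?s" using \<alpha> by (simp add: less_eq_complex_def)
  \<comment> \<open>\<open>Q F\<close> is the unnormalised state that the effect F on S A leaves on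
    the later registers.\<close>
  define Q where "Q F = ptrace_left (?d * ?A) ?r (kron F (1\<^sub>m ?r) * X)" for F
  define Z where "Z P x = ms_chan T (h @ [x]) (Q (?s \<cdot>\<^sub>m kron ?I (K x P)))" for P x
  have cp: "completely_positive ?r ?r (ms_chan T (h @ [x]))" if "x < ?m" for x
    using cptp[OF that] by (simp add: cptp_def)
  have Qpsd: "psd ?r (Q F)" if "psd (?d * ?A) F" for F
    unfolding Q_def by (rule psd_ptrace_left_kron_mult[OF that Xpsd])
  have IK: "psd (?d * ?A) (?s \<cdot>\<^sub>m kron ?I (K x P))" if "x < ?m" "P \<in> pauli_strings n" for x P
    by (intro psd_smult psd_kron psd_one K that s)
  \<comment> \<open>\<open>?y\<close> is the reduced state of X on S A and \<open>?z\<close> its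
    marginal on A, both with transposed indices; so \<open>?f F\<close> is the expectation of 1
    \<otimes> F \<otimes> 1 in X.\<close>
  let ?y = "\<lambda>i j. \<Sum>c<?r. X $$ (j * ?r + c, i * ?r + c)"
  let ?z = "\<lambda>a a'. \<Sum>s<?d. ?y (s * ?A + a) (s * ?A + a')"
  let ?f = "\<lambda>F. mat_pairing ?A F ?z"
  have f: "mtrace (Q (kron ?I F)) = ?f F" if "F \<in> carrier_mat ?A ?A" for F
    unfolding Q_def mtrace_ptrace_left_kron_mult[OF kron_carrier[OF one_carrier_mat that] XC]
    by (rule mat_pairing_kron_one[OF that])
  have Z: "mtrace (Z P x) = ?s * ?f (K x P)" if "x < ?m" "P \<in> pauli_strings n" for x P
  proof -
    note KC = psd_carrier[OF K[OF that]]
    have "mtrace (Z P x) = mtrace (Q (kron ?I (?s \<cdot>\<^sub>m K x P)))"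
      using cptp[OF that(1)] unfolding Z_def kron_smult_right
      by (simp add: cptp_def trace_preserving_def Q_def)
    also have "\<dots> = ?s * ?f (K x P)"
      by (simp only: f[OF smult_carrier_mat[OF KC]] mat_pairing_smult[OF KC])
    finally show ?thesis .
  qed
  have sumK: "(\<Sum>P\<in>pauli_strings n. Re (?f (K x P))) \<le> ?c * Re (?f (S x))" if x: "x < ?m" for x
  proof -
    have "0 \<le> mtrace (Q (kron ?I (of_real ?c \<cdot>\<^sub>m S x - msum ?A (pauli_strings n) (K x))))"
      by (intro psd_mtrace_nonneg[OF Qpsd] psd_kron psd_one KS x)
    also have "\<dots> = of_real ?c * ?f (S x) - (\<Sum>P\<in>pauli_strings n. ?f (K x P))"
      by (simp only: f[OF minus_carrier_mat[OF msum_carrier]] mat_pairing_minus[OF smult_carrier_mat[OF SC] msum_carrier]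
        mat_pairing_smult[OF SC] mat_pairing_msum)
    finally have "0 \<le> Re (of_real ?c * ?f (S x) - (\<Sum>P\<in>pauli_strings n. ?f (K x P)))"
      by (simp add: less_eq_complex_def)
    then show ?thesis by simp
  qed
  have sumS: "(\<Sum>x<?m. ?f (S x)) \<le> 2 ^ n * mtrace X + 2 ^ n * mtrace X"
  proof -
    have "?f (S x) = ?f (ptrace_left ?d ?A (?E x)) + of_real \<delta> * ?f (1\<^sub>m ?A)" for x
      unfolding S_def
      by (simp only: mat_pairing_add[OF ptrace_left_carrier smult_carrier_mat[OF one_carrier_mat]]
        mat_pairing_smult[OF one_carrier_mat])
    moreover have f1: "?f (1\<^sub>m ?A) = mtrace X"
      using XC f[OF one_carrier_mat] mtrace_ptrace_left[OF XC]
      by (simp only: kron_one Q_def left_mult_one_mat)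
    moreover have "(\<Sum>x<?m. ?f (ptrace_left ?d ?A (?E x))) = 2 ^ n * mtrace X"
    proof -
      \<comment> \<open>Tr_S of the completeness relation: the marginals add up to 2^n times the
        identity on A.\<close>
      have "msum ?A {..<?m} (\<lambda>x. ptrace_left ?d ?A (?E x)) = ptrace_left ?d ?A (msum (?d * ?A) {..<?m} ?E)"
        by (rule eq_matI, simp_all add: ptrace_left_def prod_index_less) (rule sum.swap)
      also have "\<dots> = 2 ^ n \<cdot>\<^sub>m 1\<^sub>m ?A"
      proof -
        have "ptrace_left ?d ?A (1\<^sub>m (?d * ?A)) = 2 ^ n \<cdot>\<^sub>m (1\<^sub>m ?A :: complex mat)"
          by (intro eq_matI) (auto simp: ptrace_left_def prod_index_less)
        then show ?thesis using povm by (simp add: povm_def)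
      qed
      finally have "?f (msum ?A {..<?m} (\<lambda>x. ptrace_left ?d ?A (?E x))) = 2 ^ n * ?f (1\<^sub>m ?A)"
        by (simp only: mat_pairing_smult[OF one_carrier_mat])
      then show ?thesis unfolding mat_pairing_msum f1 .
    qed
    ultimately have "(\<Sum>x<?m. ?f (S x)) = 2 ^ n * mtrace X + of_nat ?m * of_real \<delta> * mtrace X"
      by (simp add: sum.distrib)
    also have "\<dots> \<le> 2 ^ n * mtrace X + 2 ^ n * mtrace X"
    proof (cases "?m = 0")
      case True
      \<comment> \<open>Without outcomes the second summand is 0, and the bound follows from Tr X
        being nonnegative.\<close>
      have "0 \<le> complex_of_real (2 ^ n) * mtrace X"
        using psd_mtrace_nonneg[OF Xpsd] by (intro mult_nonneg_nonneg) (auto simp: less_eq_complex_def)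
      then have "0 + 2 ^ n * mtrace X \<le> 2 ^ n * mtrace X + 2 ^ n * mtrace X"
        by (intro add_right_mono) simp
      moreover have "complex_of_nat ?m = 0" using True by simp
      ultimately show ?thesis by (simp only: mult_zero_left add_0_left add_0_right)
    next
      case False
      then show ?thesis by (simp add: \<delta>_def)
    qed
    finally show ?thesis .
  qed
  show ?thesis
  proof (intro exI[of _ Z] conjI ballI allI impI)
    fix P x assume P: "P \<in> pauli_strings n" and x: "x < ?m"
    note lin = completely_positive_linear[OF cp[OF x]]
    let ?PR = "kron (pauli_op P) (pauli_marginal n ?A P (?E x))"
    let ?L = "\<lambda>p. local_map 1 (?A * ?r) ?d ?d (pauli_channel n p) X"
    let ?B = "\<lambda>Y. ptrace_left (?d * ?A) ?r (kron (?E x) (1\<^sub>m ?r) * Y)"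
    have LC: "?L p \<in> carrier_mat (?d * ?A * ?r) (?d * ?A * ?r)" for p
      using local_map_carrier[of 1 "?A * ?r" ?d ?d] by (simp add: mult.assoc)
    have IKC: "kron ?I (K x P) \<in> carrier_mat (?d * ?A) (?d * ?A)"
      by (intro kron_carrier one_carrier_mat psd_carrier[OF K[OF x P]])
    have PR: "?PR \<in> carrier_mat (?d * ?A) (?d * ?A)"
      by (intro kron_carrier pauli_op_carrier[OF P] pauli_marginal_carrier)
    show "psd ?r (Z P x)"
      unfolding Z_def by (intro completely_positive_psd[OF cp[OF x]] Qpsd IK x P)
    have "?B (?L (biased_pauli n \<alpha> P)) - ?B (?L (uniform_pauli n)) = Q (?s \<cdot>\<^sub>m ?PR)"
      unfolding Q_def
      by (subst linear_map_minus[OF linear_map_ptrace_left_kron_mult[OF psd_carrier[OF M[OF x]]] LC LC, symmetric])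
        (rule ptrace_left_kron_local_map_diff[OF P psd_carrier[OF M[OF x]] XC])
    moreover have "Q (?s \<cdot>\<^sub>m kron ?I (K x P)) - Q (?s \<cdot>\<^sub>m ?PR) = Q (?s \<cdot>\<^sub>m (kron ?I (K x P) - ?PR))"
    proof -
      have "?s \<cdot>\<^sub>m (kron ?I (K x P) - ?PR) = ?s \<cdot>\<^sub>m kron ?I (K x P) - ?s \<cdot>\<^sub>m ?PR"
        using carrier_matD[OF IKC] carrier_matD[OF PR] by (intro eq_matI) (auto simp: algebra_simps)
      then show ?thesis
        by (simp only: Q_def ptrace_left_kron_mult_diff[OF smult_carrier_mat[OF IKC] smult_carrier_mat[OF PR] XC])
    qed
    moreover have "psd ?r (ms_chan T (h @ [x]) (Q (?s \<cdot>\<^sub>m (kron ?I (K x P) - ?PR))))"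
      by (intro completely_positive_psd[OF cp[OF x]] Qpsd psd_smult KR x P s)
    ultimately have "psd ?r (ms_chan T (h @ [x]) (Q (?s \<cdot>\<^sub>m kron ?I (K x P)) -
        (?B (?L (biased_pauli n \<alpha> P)) - ?B (?L (uniform_pauli n)))))"
      by simp
    also have "ms_chan T (h @ [x]) (Q (?s \<cdot>\<^sub>m kron ?I (K x P)) -
        (?B (?L (biased_pauli n \<alpha> P)) - ?B (?L (uniform_pauli n)))) =
        Z P x - (meas_step n N T (biased_pauli n \<alpha> P) h x X - meas_step n N T (uniform_pauli n) h x X)"
      using psd_carrier[OF Qpsd[OF IK[OF x P]]]
      by (simp add: linear_map_minus[OF lin] minus_carrier_mat Z_def meas_step_def length_records[OF h])
    finally show "psd ?r (Z P x -
        (meas_step n N T (biased_pauli n \<alpha> P) h x X - meas_step n N T (uniform_pauli n) h x X))" .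
  next
    have "(\<Sum>P\<in>pauli_strings n. \<Sum>x<?m. Re (mtrace (Z P x))) =
        (\<Sum>P\<in>pauli_strings n. \<Sum>x<?m. \<alpha> / 2 ^ n * Re (?f (K x P)))"
      by (intro sum.cong refl) (simp add: Z del: of_real_divide)
    also have "\<dots> = (\<Sum>x<?m. \<Sum>P\<in>pauli_strings n. \<alpha> / 2 ^ n * Re (?f (K x P)))"
      by (rule sum.swap)
    also have "\<dots> = (\<Sum>x<?m. \<alpha> / 2 ^ n * (\<Sum>P\<in>pauli_strings n. Re (?f (K x P))))"
      by (simp only: sum_distrib_left)
    also have "\<dots> \<le> (\<Sum>x<?m. \<alpha> / 2 ^ n * (?c * Re (?f (S x))))"
      using \<alpha> by (intro sum_mono mult_left_mono sumK) auto
    also have "\<dots> = \<alpha> / 2 ^ n * ?c * Re (\<Sum>x<?m. ?f (S x))"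
      by (simp only: Re_sum sum_distrib_left mult.assoc)
    also have "\<dots> \<le> \<alpha> / 2 ^ n * ?c * Re (2 ^ n * mtrace X + 2 ^ n * mtrace X)"
      using \<alpha> sumS by (intro mult_left_mono) (auto simp: less_eq_complex_def)
    also have "\<dots> = 2 * \<alpha> * ?c * Re (mtrace X)"
    proof -
      have "2 ^ n * mtrace X = (2 ^ n) *\<^sub>R mtrace X" by (simp add: scaleR_conv_of_real)
      then have "Re (2 ^ n * mtrace X + 2 ^ n * mtrace X) = 2 * (2 ^ n * Re (mtrace X))"
        by (simp only: plus_complex.sel scaleR_complex.sel mult_2)
      then show ?thesis by simp
    qed
    finally show "(\<Sum>P\<in>pauli_strings n. \<Sum>x<?m. Re (mtrace (Z P x))) \<le> 2 * \<alpha> * ?c * Re (mtrace X)" .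
  qed
qed

lemma meas_lower_bound:
  assumes "1 \<le> n" "0 < \<epsilon>" "\<epsilon> \<le> 1 / 3" and T: "valid_meas_protocol n N T"
    and "meas_reduction_restricted n N T" and "meas_protocol_solves n N \<epsilon> T"
  shows "real N \<ge> 1 / 24 * (1 / \<epsilon>) * 2 powr (real n / 2)"
proof (rule pauli_learning_lower_bound[OF assms(1-3)])
  show "solves_pauli_learning n \<epsilon> (records (ms_nout T) N) (meas_prob n N T) (ms_est T)"
    using assms(6) by (simp add: meas_protocol_solves_def)
  show "valid_process (rest_dim n N T) N (ms_nout T) (meas_step n N T p)" if "pauli_distribution n p" for p
    by (rule valid_process_meas[OF T that])
  show "psd (rest_dim n N T 0) (ms_init T)" "mtrace (ms_init T) = 1"
    using T by (simp_all add: valid_meas_protocol_def density_def)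
  show "meas_prob n N T p h = Re (mtrace (run (meas_step n N T p) (ms_init T) h N))"
    if "h \<in> records (ms_nout T) N" for p h
    unfolding meas_prob_def by (subst run_meas_step) (simp_all add: length_records[OF that])
qed (rule meas_step_advantage[OF T assms(5)], use assms(2) in simp)

theorem theorem2:
  shows "\<exists>c::real. c > 0 \<and>
    (\<forall>(n::nat) (\<epsilon>::real) (N::nat). 1 \<le> n \<longrightarrow> 0 < \<epsilon> \<longrightarrow> \<epsilon> \<le> 1 / 3 \<longrightarrow>
      (\<forall>T. valid_input_protocol n N T \<longrightarrow> input_reduction_restricted n N T \<longrightarrow>
         input_protocol_solves n N \<epsilon> T \<longrightarrow>
         real N \<ge> c * (1 / \<epsilon>) * 2 powr (real n / 2)) \<and>
      (\<forall>T. valid_meas_protocol n N T \<longrightarrow> meas_reduction_restricted n N T \<longrightarrow>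
         meas_protocol_solves n N \<epsilon> T \<longrightarrow>
         real N \<ge> c * (1 / \<epsilon>) * 2 powr (real n / 2)))"
  using input_lower_bound meas_lower_bound by (intro exI[of _ "1 / 24"]) auto

end
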